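(* If $f$ is a nonpolynomial entire function on $\mathbf{C}^n$, then $$1+\frac1n\le\underline\tau(f)\le 2 .$$
   Context: For a function $h$ on $\mathbf{C}^n$, $M_h(r):=\sup_{\|z\|<r}|h(z)|$ (Euclidean ball). $\mathcal{P}_{k,n+1}$ is the space of holomorphic polynomials of degree (at most) $k$ on $\mathbf{C}^{n+1}$. For an entire function $f$ on $\mathbf{C}^n$ and $g\in\mathcal{P}_{k,n+1}$ put $g_f(z):=g(z,f(z))$, $z\in\mathbf{C}^n$, and $$m_k(r,f):=\sup\{\ln M_{g_f}(r): g\in\mathcal{P}_{k,n+1},\ M_{g_f}(1)\le1\},\quad r\ge1.$$ The lower order of transcendence of $f$ is $$\underline\tau(f):=\sup\left\{\tau:\ \liminf_{k\to\infty}\frac{m_k(e,f)}{k^\tau}>0\right\}.$$ *)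

theory Defs
  imports "HOL-Analysis.Analysis"
begin

(* Holomorphic on all of C^n: Frechet differentiable everywhere, with complex-linear derivative.
   (The library's holomorphic_on only covers one variable.) *)
definition entire :: "(complex ^ 'n \<Rightarrow> complex) \<Rightarrow> bool" where
  "entire f \<longleftrightarrow>
     (\<forall>z. \<exists>D. (f has_derivative D) (at z) \<and> (\<forall>c v. D (c *s v) = c * D v))"

(* Complex polynomial functions of total degree at most k on C^m, m = CARD('m);
   \<alpha> ranges over the multi-indices of length at most k. *)
definition poly_space :: "nat \<Rightarrow> (complex ^ 'm \<Rightarrow> complex) set" where
  "poly_space k =
     {p. \<exists>c :: ('m \<Rightarrow> nat) \<Rightarrow> complex.
           \<forall>z. p z = (\<Sum>\<alpha> | (\<Sum>i\<in>UNIV. \<alpha> i) \<le> k. c \<alpha> * (\<Prod>i\<in>UNIV. (z $ i) ^ \<alpha> i))}"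

(* The index set in poly_space is finite, so the sum there is a genuine one. *)
lemma finite_multi_indices: "finite {\<alpha> :: 'm::finite \<Rightarrow> nat. (\<Sum>i\<in>UNIV. \<alpha> i) \<le> k}"
proof (rule finite_subset)
  show "{\<alpha> :: 'm \<Rightarrow> nat. (\<Sum>i\<in>UNIV. \<alpha> i) \<le> k} \<subseteq> (UNIV \<rightarrow>\<^sub>E {..k})"
  proof
    fix \<alpha> :: "'m \<Rightarrow> nat" assume "\<alpha> \<in> {\<alpha>. (\<Sum>i\<in>UNIV. \<alpha> i) \<le> k}"
    moreover have "\<alpha> j \<le> (\<Sum>i\<in>UNIV. \<alpha> i)" for j
      by (rule member_le_sum) simp_all
    ultimately have "\<alpha> j \<le> k" for j
      by (metis le_trans mem_Collect_eq)
    then show "\<alpha> \<in> (UNIV \<rightarrow>\<^sub>E {..k})" by (intro PiE_I) simp_all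
  qed
  show "finite ((UNIV :: 'm set) \<rightarrow>\<^sub>E {..k})"
    by (rule finite_PiE) simp_all
qed

definition polynomial_fun :: "(complex ^ 'm \<Rightarrow> complex) \<Rightarrow> bool" where
  "polynomial_fun p \<longleftrightarrow> (\<exists>k. p \<in> poly_space k)"

(* The norm on complex ^ 'n is the Euclidean one, so ball 0 r is the Euclidean ball. *)
definition max_mod :: "(complex ^ 'n \<Rightarrow> complex) \<Rightarrow> real \<Rightarrow> ereal" where
  "max_mod h r = (SUP z\<in>ball 0 r. ereal (norm (h z)))"

(* Natural logarithm with the usual values at the endpoints: ln 0 = -\<infinity>, in contrast to
   the library's ln on the reals. *)
definition ln_ext :: "ereal \<Rightarrow> ereal" where
  "ln_ext x = (if x = \<infinity> then \<infinity> else if x \<le> 0 then -\<infinity> else ereal (ln (real_of_ereal x)))"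

(* g(z, f z), where C^(n+1) = C^n x C is modelled as complex ^ 'n option:
   the components Some i are those of z, and None is the additional one. *)
definition on_graph ::
    "(complex ^ 'n \<Rightarrow> complex) \<Rightarrow> (complex ^ 'n option \<Rightarrow> complex) \<Rightarrow> complex ^ 'n \<Rightarrow> complex" where
  "on_graph f g z = g (\<chi> j. case j of None \<Rightarrow> f z | Some i \<Rightarrow> z $ i)"

definition m_fun :: "nat \<Rightarrow> real \<Rightarrow> (complex ^ 'n \<Rightarrow> complex) \<Rightarrow> ereal" where
  "m_fun k r f =
     (SUP g\<in>{g \<in> poly_space k. max_mod (on_graph f g) 1 \<le> 1}. ln_ext (max_mod (on_graph f g) r))"

definition lower_transcendence_order :: "(complex ^ 'n \<Rightarrow> complex) \<Rightarrow> ereal" where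
  "lower_transcendence_order f =
     Sup {ereal \<tau> | \<tau>. liminf (\<lambda>k. m_fun k (exp 1) f / ereal (real k powr \<tau>)) > 0}"

end

theory Submission
  imports Defs "HOL-Complex_Analysis.Conformal_Mappings"
    "HOL-Computational_Algebra.Fundamental_Theorem_Algebra" "HOL-Real_Asymp.Real_Asymp"
begin

text \<open>Write \<open>g_f z = g (z, f z)\<close> and \<open>M_h r\<close> for the supremum of \<open>norm \<circ> h\<close> over the ball of
  radius \<open>r\<close>. The two bounds have independent proofs.

  The lower bound is a dimension count. The polynomials \<open>g\<close> of degree at most \<open>k\<close> in \<open>n + 1\<close> variables
  form a space whose dimension has the order of \<open>k ^ (n + 1)\<close>, while vanishing of \<open>g_f\<close> to order \<open>N\<close> at
  the origin amounts to at most \<open>N ^ n\<close> linear conditions (\<open>hom_coeff_eq_0_of_grid\<close>). So there is a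
  \<open>g \<noteq> 0\<close> for which \<open>g_f\<close> vanishes to an order \<open>N\<close> comparable with \<open>k powr (1 + 1 / n)\<close>, and then
  \<open>M_(g_f) e\<close> is at least \<open>2 ^ (N - 1)\<close> times \<open>M_(g_f) 1\<close> (\<open>m_fun_lower_bound\<close>). Moreover \<open>g_f\<close> is not
  identically zero, because an entire function that satisfies a polynomial equation is a polynomial
  (\<open>algebraic_line_holomorphic_imp_polynomial\<close>).

  The upper bound has to be shown for infinitely many \<open>k\<close>, up to an arbitrarily small change of the
  exponent. Suppose that \<open>norm (g_f z) \<le> \<delta>\<close> on a ball slightly larger than that of radius \<open>R\<close>. Consider
  the complex line through a point \<open>b\<close> near the origin and a point where \<open>norm \<circ> f\<close> is maximal on the
  closed ball of radius \<open>R\<close>. On it \<open>f\<close> becomes a function \<open>F\<close> of one variable that is small near 0 and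
  huge at 1. If \<open>ln (M_f R)\<close> is large compared with \<open>k * ln R\<close>, then by Harnack's inequality \<open>F\<close> takes
  at least \<open>k + 1\<close> well separated values at least \<open>k + 1\<close> times each (\<open>many_levels_with_many_zeros\<close>).
  When the last variable of \<open>g\<close> is fixed at such a value, a polynomial of degree at most \<open>k\<close> on the line
  remains, and it interpolates \<open>g_f\<close> at \<open>k + 1\<close> points; hence it is bounded by \<open>\<delta>\<close> times a \<open>k\<close>-th power
  (\<open>hermite_remainder_bound\<close>). Interpolation in the last variable and then in \<open>z\<close> bounds \<open>g\<close> on a large
  set, and so \<open>M_(g_f) R2 \<le> E * M_(g_f) R1\<close> for two radii \<open>R < R1 < R2\<close>, with \<open>ln E\<close> of the order of
  \<open>k * ln (M_f R2)\<close>. The Taylor expansion transfers such an inequality to the radii \<open>e\<close> and 1, where the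
  growth exponent becomes \<open>ln E / ln (R2 / R1)\<close> (\<open>mod_sup_growth_transfer\<close>).

  It remains to choose \<open>R\<close> and \<open>k\<close>. Since \<open>f\<close> is not a polynomial, \<open>S = ln (M_f R) / ln R\<close> is unbounded.
  Borel's lemma (\<open>borel_growth\<close>) yields arbitrarily large \<open>S\<close> for which \<open>ln (M_f r)\<close> increases only by a
  constant factor up to \<open>r = R powr (1 + 8 * \<eta>)\<close>, where \<open>\<eta> = S powr - \<epsilon>\<close>. With \<open>k\<close> close to
  \<open>S powr (1 - \<epsilon>)\<close> the growth exponent is at most a multiple of \<open>k * S powr (1 + \<epsilon>)\<close>, a power of \<open>k\<close>
  whose exponent tends to 2 with \<open>\<epsilon> \<rightarrow> 0\<close>.\<close>


section \<open>Polynomials controlled by their values at nodes and zeros\<close>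

lemma lagrange_interpolation:
  fixes p :: "complex poly"
  assumes "finite S" "degree p < card S"
  shows "poly p t = (\<Sum>x\<in>S. poly p x * (\<Prod>y\<in>S - {x}. (t - y) / (x - y)))"
proof -
  define q where "q = (\<Sum>x\<in>S. smult (poly p x) (\<Prod>y\<in>S - {x}. smult (1 / (x - y)) [:- y, 1:]))"
  have q: "poly q t = (\<Sum>x\<in>S. poly p x * (\<Prod>y\<in>S - {x}. (t - y) / (x - y)))" for t
    by (simp add: q_def poly_sum poly_prod diff_divide_distrib)
  have "degree (smult (poly p x) (\<Prod>y\<in>S - {x}. smult (1 / (x - y)) [:- y, 1:])) < card S"
    if "x \<in> S" for x
  proof -
    have "degree (\<Prod>y\<in>S - {x}. smult (1 / (x - y)) [:- y, 1:])
        \<le> (\<Sum>y\<in>S - {x}. degree (smult (1 / (x - y)) [:- y, 1:]))"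
      using degree_prod_sum_le[of "S - {x}" "\<lambda>y. smult (1 / (x - y)) [:- y, 1:]"] assms(1)
      by (simp add: o_def del: smult_pCons)
    also have "\<dots> \<le> (\<Sum>y\<in>S - {x}. 1)"
      by (intro sum_mono order_trans[OF degree_smult_le]) simp
    also have "\<dots> < card S"
      using card_Diff1_less[OF assms(1) that] by simp
    finally show ?thesis
      by (meson degree_smult_le le_less_trans)
  qed
  then have "degree q < card S"
    unfolding q_def using assms(2) by (intro degree_sum_less) auto
  moreover have "poly p x = poly q x" if "x \<in> S" for x
  proof -
    have "poly p z * (\<Prod>y\<in>S - {z}. (x - y) / (z - y)) = (if z = x then poly p x else 0)"
      if "z \<in> S" for z
    proof (cases "z = x")
      case True
      have "(\<Prod>y\<in>S - {x}. (x - y) / (x - y)) = (\<Prod>y\<in>S - {x}. 1)"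
        by (intro prod.cong) auto
      then show ?thesis using True by simp
    next
      case False
      have "(\<Prod>y\<in>S - {z}. (x - y) / (z - y)) = 0"
        using False \<open>x \<in> S\<close> assms(1) by (intro prod_zero) auto
      then show ?thesis using False by simp
    qed
    then have "poly q x = (\<Sum>z\<in>S. if z = x then poly p x else 0)"
      unfolding q by (intro sum.cong) auto
    then show ?thesis using that assms(1) by simp
  qed
  ultimately have "p = q" using assms(2) by (intro poly_eqI_degree[of S]) auto
  then have "poly p t = poly q t" by simp
  then show ?thesis unfolding q .
qed

text \<open>Each Lagrange basis factor is at most the ratio of the largest distance from \<open>t\<close> to
  a node and the smallest distance between nodes.\<close>

lemma lagrange_bound:
  fixes p :: "complex poly"
  assumes "card S = Suc k" "degree p \<le> k" "d > 0"
    and nodes: "\<And>x. x \<in> S \<Longrightarrow> norm x \<le> a" "\<And>x. x \<in> S \<Longrightarrow> norm (poly p x) \<le> M"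
    and sep: "\<And>x y. x \<in> S \<Longrightarrow> y \<in> S \<Longrightarrow> x \<noteq> y \<Longrightarrow> d \<le> norm (x - y)"
  shows "norm (poly p t) \<le> Suc k * (M * ((norm t + a) / d) ^ k)"
proof -
  have fin: "finite S" using assms(1) card_ge_0_finite by force
  have "norm (poly p t) \<le> (\<Sum>x\<in>S. norm (poly p x * (\<Prod>y\<in>S - {x}. (t - y) / (x - y))))"
    using lagrange_interpolation[of S p t] fin assms(1,2) by (metis less_Suc_eq_le norm_sum)
  also have "\<dots> \<le> (\<Sum>x\<in>S. M * ((norm t + a) / d) ^ k)"
  proof (intro sum_mono)
    fix x assume x: "x \<in> S"
    have a0: "0 \<le> a" using nodes(1)[OF x] norm_ge_zero order_trans by blast
    have "norm (\<Prod>y\<in>S - {x}. (t - y) / (x - y)) = (\<Prod>y\<in>S - {x}. norm ((t - y) / (x - y)))"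
      by (simp add: prod_norm)
    also have "\<dots> \<le> (\<Prod>y\<in>S - {x}. (norm t + a) / d)"
    proof (intro prod_mono conjI)
      fix y assume y: "y \<in> S - {x}"
      have "norm (t - y) \<le> norm t + a"
        using nodes(1)[of y] y norm_triangle_ineq4[of t y] by auto
      then show "norm ((t - y) / (x - y)) \<le> (norm t + a) / d"
        unfolding norm_divide using sep[of x y] x y \<open>d > 0\<close> a0
        by (intro frac_le) auto
    qed auto
    also have "\<dots> = ((norm t + a) / d) ^ k"
      using x fin assms(1) by simp
    finally show "norm (poly p x * (\<Prod>y\<in>S - {x}. (t - y) / (x - y))) \<le> M * ((norm t + a) / d) ^ k"
      unfolding norm_mult using nodes(2)[OF x]
      by (intro mult_mono) (auto intro: order_trans[OF norm_ge_zero])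
  qed
  also have "\<dots> = Suc k * (M * ((norm t + a) / d) ^ k)"
    using assms(1) by simp
  finally show ?thesis .
qed

lemma holomorphic_divide_by_zero_factor:
  assumes "f holomorphic_on S" "open S" "a \<in> S"
  obtains g where "g holomorphic_on S" "\<And>z. z \<in> S \<Longrightarrow> f z = f a + (z - a) * g z"
    "\<And>z. z \<noteq> a \<Longrightarrow> g z = (f z - f a) / (z - a)"
proof
  show "(\<lambda>z. if z = a then deriv f a else (f z - f a) / (z - a)) holomorphic_on S"
    using assms by (intro pole_lemma) (auto simp: interior_open)
qed auto

lemma holomorphic_vanishes_at_puncture:
  assumes "D holomorphic_on S" "open S" "a \<in> S" "\<And>z. z \<in> S - {a} \<Longrightarrow> D z = (0::complex)"
  shows "D a = 0"
proof -
  have "(D \<longlongrightarrow> D a) (at a)"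
    using assms(1-3) by (metis continuous_on_eq_continuous_at holomorphic_on_imp_continuous_on isCont_def)
  moreover have "(D \<longlongrightarrow> 0) (at a)"
    using assms(2-4) by (intro tendsto_eventually) (auto simp: eventually_at_topological)
  ultimately show ?thesis by (rule tendsto_unique[OF at_neq_bot])
qed

text \<open>Splitting off at most \<open>N\<close> zeros, one at a time, leaves the alternative on which the
  main argument rests: either there are enough zeros, with multiplicity, to interpolate at, or the
  cofactor has no zeros at all in \<open>C\<close>.\<close>

lemma factor_out_zeros:
  assumes "F holomorphic_on S" "open S" "C \<subseteq> S"
  obtains zs u where "set zs \<subseteq> C" "u holomorphic_on S" "length zs \<le> N"
    "\<And>t. t \<in> S \<Longrightarrow> F t = prod_list (map (\<lambda>z. t - z) zs) * u t"
    "length zs = N \<or> (\<forall>t\<in>C. u t \<noteq> 0)"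
proof -
  have "\<exists>zs u. set zs \<subseteq> C \<and> u holomorphic_on S \<and> length zs \<le> N \<and>
    (\<forall>t\<in>S. F t = prod_list (map (\<lambda>z. t - z) zs) * u t) \<and> (length zs = N \<or> (\<forall>t\<in>C. u t \<noteq> 0))"
  proof (induction N)
    case 0
    show ?case using assms(1) by (intro exI[of _ "[]"] exI[of _ F]) auto
  next
    case (Suc N)
    then obtain zs u where *: "set zs \<subseteq> C" "u holomorphic_on S" "length zs \<le> N"
      "\<And>t. t \<in> S \<Longrightarrow> F t = prod_list (map (\<lambda>z. t - z) zs) * u t"
      "length zs = N \<or> (\<forall>t\<in>C. u t \<noteq> 0)" by auto
    show ?case
    proof (cases "\<forall>t\<in>C. u t \<noteq> 0")
      case True
      then show ?thesis using * by (intro exI[of _ zs] exI[of _ u]) auto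
    next
      case False
      then obtain a where a: "a \<in> C" "u a = 0" by auto
      with assms(3) have "a \<in> S" by auto
      obtain g where g: "g holomorphic_on S" "\<And>z. z \<in> S \<Longrightarrow> u z = u a + (z - a) * g z"
        using holomorphic_divide_by_zero_factor[OF *(2) assms(2) \<open>a \<in> S\<close>] by metis
      have "length zs = N" using *(5) False by auto
      then show ?thesis using * a g
        by (intro exI[of _ "a # zs"] exI[of _ g]) (auto simp: algebra_simps)
    qed
  qed
  then show thesis using that by blast
qed

text \<open>By the maximum principle it suffices to look at a circle on which the denominator is at least
  \<open>\<eta> / 2\<close>.\<close>

lemma difference_quotient_bound:
  assumes h: "h holomorphic_on ball 0 r" "\<And>t. t \<in> ball 0 r \<Longrightarrow> norm (h t) \<le> \<delta>"
    and a: "norm a \<le> r - \<eta>" and \<eta>: "\<eta> > 0"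
    and h1: "h1 holomorphic_on ball 0 r" "\<And>z. z \<noteq> a \<Longrightarrow> h1 z = (h z - h a) / (z - a)"
    and t: "t \<in> ball 0 r"
  shows "norm (h1 t) \<le> 4 * \<delta> / \<eta>"
proof -
  have ar: "a \<in> ball 0 r" using a \<eta> by simp
  have d0: "0 \<le> \<delta>" using h(2)[OF t] norm_ge_zero order_trans by blast
  define r' where "r' = max (norm t) (r - \<eta> / 2)"
  have r': "norm t \<le> r'" "r - \<eta> / 2 \<le> r'" "r' < r"
    using t \<eta> by (auto simp: r'_def)
  have "0 < r'" using a \<eta> r'(2) norm_ge_zero[of a] by linarith
  have "norm (h1 t) \<le> 4 * \<delta> / \<eta>"
  proof (rule maximum_modulus_frontier[of h1 "cball 0 r'"])
    show "h1 holomorphic_on interior (cball 0 r')"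
      using r' by (intro holomorphic_on_subset[OF h1(1)]) auto
    show "continuous_on (closure (cball 0 r')) h1"
      using r' by (intro holomorphic_on_imp_continuous_on holomorphic_on_subset[OF h1(1)]) auto
    fix z :: complex assume "z \<in> frontier (cball 0 r')"
    then have nz: "norm z = r'" by (simp add: frontier_def)
    have dist: "\<eta> / 2 \<le> norm (z - a)"
      using norm_triangle_ineq2[of z a] nz a r'(2) by linarith
    then have "z \<noteq> a" using \<eta> by auto
    have "norm (h z - h a) \<le> 2 * \<delta>"
      using h(2)[of z] h(2)[OF ar] nz r' norm_triangle_ineq4[of "h z" "h a"] by auto
    then have "norm (h1 z) \<le> (2 * \<delta>) / (\<eta> / 2)"
      unfolding h1(2)[OF \<open>z \<noteq> a\<close>] norm_divide using dist \<eta> d0 by (intro frac_le) auto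
    then show "norm (h1 z) \<le> 4 * \<delta> / \<eta>" by simp
  qed (use r' in auto)
  then show ?thesis .
qed

text \<open>Here \<open>p\<close> is the Hermite interpolant of \<open>h\<close> at the zeros
  \<open>zs\<close>, so a bound for \<open>h\<close> has to yield one for \<open>p\<close>.
  Newton's scheme gives it: subtracting the common value of \<open>h\<close> and \<open>p\<close>
  at a zero \<open>a\<close> and dividing by \<open>t - a\<close> removes one zero and costs a
  constant factor. Nothing is required of the distances between the zeros, which may coincide.\<close>

lemma hermite_remainder_bound:
  fixes p :: "complex poly"
  assumes "\<eta> > 0" and "set zs \<subseteq> cball 0 (r - \<eta>)"
    and "h holomorphic_on ball 0 r" "\<And>t. t \<in> ball 0 r \<Longrightarrow> norm (h t) \<le> \<delta>"
    and "\<And>i. i \<ge> length zs \<Longrightarrow> coeff p i = 0"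
    and "U holomorphic_on ball 0 r"
    and "\<And>t. t \<in> ball 0 r \<Longrightarrow> h t - poly p t = prod_list (map (\<lambda>z. t - z) zs) * U t"
    and "t \<in> ball 0 r"
  shows "norm (poly p t) \<le> (1 + 8 * r / \<eta>) ^ length zs * \<delta>"
  using assms(2-8)
proof (induction zs arbitrary: h p \<delta> t)
  case Nil
  then have "p = 0" by (simp add: poly_eq_iff)
  moreover have "0 \<le> \<delta>" using Nil.prems(3)[OF Nil.prems(7)] norm_ge_zero order_trans by blast
  ultimately show ?case by simp
next
  case (Cons a zs)
  let ?B = "ball (0::complex) r" and ?C = "1 + 8 * r / \<eta>"
  have a: "norm a \<le> r - \<eta>" and ar: "a \<in> ?B" using Cons.prems(1) assms(1) by auto
  have d0: "0 \<le> \<delta>" using Cons.prems(3)[OF Cons.prems(7)] norm_ge_zero order_trans by blast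
  have r: "0 \<le> r" using a assms(1) norm_ge_zero[of a] by linarith
  obtain h1 where h1: "h1 holomorphic_on ?B" "\<And>z. z \<in> ?B \<Longrightarrow> h z = h a + (z - a) * h1 z"
    "\<And>z. z \<noteq> a \<Longrightarrow> h1 z = (h z - h a) / (z - a)"
    using holomorphic_divide_by_zero_factor[OF Cons.prems(2) open_ball ar] by metis
  define p1 where "p1 = synthetic_div p a"
  have pe: "poly p z = poly p a + (z - a) * poly p1 z" for z
  proof -
    have "poly p z = poly ([:-a, 1:] * p1 + [:poly p a:]) z"
      unfolding p1_def synthetic_div_correct' ..
    also have "\<dots> = poly p a + (z - a) * poly p1 z" by (simp add: algebra_simps)
    finally show ?thesis .
  qed
  have hpa: "h a = poly p a" using Cons.prems(6)[OF ar] by simp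
  have agree: "h1 z - poly p1 z = prod_list (map (\<lambda>y. z - y) zs) * U z" if "z \<in> ?B - {a}" for z
  proof -
    have "(z - a) * (h1 z - poly p1 z) = (z - a) * (prod_list (map (\<lambda>y. z - y) zs) * U z)"
      using Cons.prems(6)[of z] h1(2)[of z] pe[of z] hpa that by (simp add: algebra_simps)
    then show ?thesis using that by simp
  qed
  have hol_rhs: "(\<lambda>z. prod_list (map (\<lambda>y. z - y) zs)) holomorphic_on ?B" for zs :: "complex list"
    by (induction zs) (auto intro!: holomorphic_intros)
  have agree': "h1 z - poly p1 z = prod_list (map (\<lambda>y. z - y) zs) * U z" if "z \<in> ?B" for z
  proof (cases "z = a")
    case True
    have "h1 a - poly p1 a - prod_list (map (\<lambda>y. a - y) zs) * U a = 0"
      by (rule holomorphic_vanishes_at_puncture[of _ ?B])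
        (use agree ar in \<open>auto intro!: holomorphic_intros h1(1) Cons.prems(5) hol_rhs\<close>)
    then show ?thesis using True by simp
  qed (use agree that in auto)
  have "norm (poly p1 t) \<le> ?C ^ length zs * (4 * \<delta> / \<eta>)"
  proof (rule Cons.IH[OF _ h1(1) _ _ Cons.prems(5) agree' Cons.prems(7)])
    show "set zs \<subseteq> cball 0 (r - \<eta>)" using Cons.prems(1) by auto
    show "norm (h1 s) \<le> 4 * \<delta> / \<eta>" if "s \<in> ?B" for s
      by (rule difference_quotient_bound[OF Cons.prems(2,3) a assms(1) h1(1,3) that])
    show "coeff p1 i = 0" if "length zs \<le> i" for i
    proof -
      have "degree p \<le> length zs"
        by (rule degree_le) (use Cons.prems(4) in auto)

      show ?thesis
      proof (cases "degree p = 0")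
        case True
        then have "synthetic_div p a = 0" using synthetic_div_eq_0_iff[of p a] by blast
          then show ?thesis by (simp add: p1_def)
      next
        case False
        then show ?thesis using \<open>degree p \<le> length zs\<close> that
          by (intro coeff_eq_0) (simp add: p1_def degree_synthetic_div)
      qed
    qed
  qed
  moreover have "norm (t - a) \<le> 2 * r"
    using Cons.prems(7) ar norm_triangle_ineq4[of t a] by auto
  ultimately have "norm ((t - a) * poly p1 t) \<le> (2 * r) * (?C ^ length zs * (4 * \<delta> / \<eta>))"
    unfolding norm_mult using r by (intro mult_mono) auto
  moreover have "norm (poly p a) \<le> \<delta>" using Cons.prems(3)[OF ar] hpa by simp
  ultimately have "norm (poly p t) \<le> \<delta> + (2 * r) * (?C ^ length zs * (4 * \<delta> / \<eta>))"
    unfolding pe[of t] by (intro norm_triangle_le add_mono)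
  also have "\<dots> = \<delta> + (8 * r / \<eta>) * ?C ^ length zs * \<delta>" by simp
  also have "\<dots> \<le> ?C ^ length zs * \<delta> + (8 * r / \<eta>) * ?C ^ length zs * \<delta>"
  proof -
    have "1 \<le> ?C ^ length zs" using assms(1) r by (intro one_le_power) simp
    from mult_right_mono[OF this d0] show ?thesis by simp
  qed
  also have "\<dots> = ?C ^ length (a # zs) * \<delta>" by (simp add: algebra_simps)
  finally show ?case .
qed


section \<open>Zero-free holomorphic functions and levels with many zeros\<close>

text \<open>This is Harnack's inequality for the positive harmonic function \<open>- ln (norm (u
  s))\<close>. A holomorphic logarithm of \<open>u\<close> takes values in the left half-plane,
  which a Moebius map sends to the unit disc, where the Schwarz lemma applies.\<close>

lemma harnack_nonvanishing:
  fixes u :: "complex \<Rightarrow> complex"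
  assumes hol: "u holomorphic_on ball 0 \<rho>" and nz: "\<And>s. s \<in> ball 0 \<rho> \<Longrightarrow> u s \<noteq> 0"
    and lt1: "\<And>s. s \<in> ball 0 \<rho> \<Longrightarrow> norm (u s) < 1" and t: "norm t < \<rho>"
  shows "- ln (norm (u t)) \<le> (\<rho> + norm t) / (\<rho> - norm t) * (- ln (norm (u 0)))"
proof -
  have \<rho>: "\<rho> > 0" using t norm_ge_zero[of t] by linarith
  obtain g where g: "g holomorphic_on ball 0 \<rho>" "\<And>s. s \<in> ball 0 \<rho> \<Longrightarrow> u s = exp (g s)"
    using holomorphic_logarithm_exists[OF convex_ball open_ball hol nz, of 0] \<rho> by (metis centre_in_ball)
  have Re_g: "Re (g s) = ln (norm (u s))" if "s \<in> ball 0 \<rho>" for s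
    using g(2)[OF that] by simp
  have neg: "Re (g s) < 0" if "s \<in> ball 0 \<rho>" for s
    using Re_g[OF that] lt1[OF that] nz[OF that] by simp
  have 0: "(0::complex) \<in> ball 0 \<rho>" using \<rho> by simp
  (* The Moebius map that takes the left half-plane to the unit disc and g 0 to 0. *)
  define W where "W = (\<lambda>s. (g (of_real \<rho> * s) - g 0) / (g (of_real \<rho> * s) + cnj (g 0)))"
  have scale: "of_real \<rho> * s \<in> ball 0 \<rho>" if "norm s < 1" for s :: complex
    using that \<rho> by (simp add: norm_mult)
  have den: "g (of_real \<rho> * s) + cnj (g 0) \<noteq> 0" if "norm s < 1" for s
  proof -
    have "Re (g (of_real \<rho> * s) + cnj (g 0)) < 0"
      using neg[OF scale[OF that]] neg[OF 0] by simp
    then show ?thesis by (metis less_irrefl zero_complex.simps(1))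
  qed
  have W1: "norm (W s) < 1" if "norm s < 1" for s
  proof -
    define a where "a = g (of_real \<rho> * s)"
    have "Re a * Re (g 0) > 0"
      using neg[OF scale[OF that]] neg[OF 0] by (simp add: a_def mult_neg_neg)
    then have "(norm (a - g 0))\<^sup>2 < (norm (a + cnj (g 0)))\<^sup>2"
      unfolding cmod_power2 by (simp add: power2_eq_square algebra_simps)
    then have "norm (a - g 0) < norm (a + cnj (g 0))"
      by (rule power2_less_imp_less) simp
    then show ?thesis
      using den[OF that] by (simp add: W_def a_def norm_divide divide_simps)
  qed
  have "W holomorphic_on ball 0 1"
    unfolding W_def using scale den
    by (intro holomorphic_intros holomorphic_on_compose_gen[OF _ g(1), unfolded o_def]) auto
  moreover have "W 0 = 0" by (simp add: W_def)
  ultimately have "norm (W (t / of_real \<rho>)) \<le> norm (t / of_real \<rho>)"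
    using W1 t \<rho> by (intro Schwarz_Lemma(1)) (auto simp: norm_divide)
  then have Wt: "norm (g t - g 0) \<le> norm t / \<rho> * norm (g t + cnj (g 0))"
    using den[of "t / of_real \<rho>"] t \<rho> by (simp add: W_def norm_divide divide_simps mult.commute)
  define q where "q = norm t / \<rho>"
  have q: "0 \<le> q" "q < 1" using t \<rho> by (auto simp: q_def)
  define x x0 where "x = - Re (g t)" and "x0 = - Re (g 0)"
  have tb: "t \<in> ball 0 \<rho>" using t by simp
  have pos: "x > 0" "x0 > 0" using neg[OF tb] neg[OF 0] by (auto simp: x_def x0_def)
  have "x - x0 \<le> q * (x + x0)"
  proof -
    have "(norm (g t - g 0))\<^sup>2 \<le> (q * norm (g t + cnj (g 0)))\<^sup>2"
      using Wt by (intro power_mono) (auto simp: q_def)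
    then have "(x - x0)\<^sup>2 + (Im (g t) - Im (g 0))\<^sup>2 \<le> q\<^sup>2 * ((x + x0)\<^sup>2 + (Im (g t) - Im (g 0))\<^sup>2)"
      unfolding power_mult_distrib cmod_power2
      by (simp add: x_def x0_def power2_eq_square algebra_simps)
    moreover have "q\<^sup>2 * (Im (g t) - Im (g 0))\<^sup>2 \<le> 1 * (Im (g t) - Im (g 0))\<^sup>2"
      using q by (intro mult_right_mono) (auto simp: power_le_one)
    ultimately have "(x - x0)\<^sup>2 \<le> (q * (x + x0))\<^sup>2"
      unfolding power_mult_distrib[of q] distrib_left[of "q\<^sup>2"] by linarith
    then show ?thesis by (rule power2_le_imp_le) (use q pos in simp)
  qed
  then have "x * (1 - q) \<le> x0 * (1 + q)" by (simp add: algebra_simps)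
  then have "x \<le> (1 + q) / (1 - q) * x0" using q by (simp add: field_simps)
  also have "(1 + q) / (1 - q) = (\<rho> + norm t) / (\<rho> - norm t)"
    using \<rho> t by (simp add: q_def field_simps)
  finally show ?thesis using Re_g[OF tb] Re_g[OF 0] by (simp add: x_def x0_def)
qed

lemma lipschitz_on_inner_disc:
  fixes F :: "complex \<Rightarrow> complex"
  assumes F: "F holomorphic_on ball 0 r" "\<And>t. t \<in> ball 0 r \<Longrightarrow> norm (F t) \<le> M"
    and "\<eta> > 0" "s \<in> cball 0 (r - 2 * \<eta>)" "t \<in> cball 0 (r - 2 * \<eta>)"
  shows "norm (F s - F t) \<le> M / \<eta> * norm (s - t)"
proof (rule field_differentiable_bound[OF convex_cball _ _ assms(4,5)])
  fix z :: complex assume z: "z \<in> cball 0 (r - 2 * \<eta>)"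
  then have "z \<in> ball 0 r" using \<open>\<eta> > 0\<close> by simp
  then show "(F has_field_derivative deriv F z) (at z within cball 0 (r - 2 * \<eta>))"
    using F(1) holomorphic_derivI open_ball by blast
  have sub: "cball z \<eta> \<subseteq> ball 0 r"
  proof
    fix y assume "y \<in> cball z \<eta>"
    then show "y \<in> ball 0 r"
      using z \<open>\<eta> > 0\<close> norm_triangle_ineq2[of y z] by (auto simp: dist_norm norm_minus_commute)
  qed
  have "norm ((deriv ^^ 1) F z) \<le> fact 1 * M / \<eta> ^ 1"
  proof (rule Cauchy_inequality)
    show "F holomorphic_on ball z \<eta>"
      using sub by (intro holomorphic_on_subset[OF F(1)]) auto
    show "continuous_on (cball z \<eta>) F"
      using sub by (intro holomorphic_on_imp_continuous_on holomorphic_on_subset[OF F(1)]) auto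
    show "norm (F x) \<le> M" if "norm (z - x) = \<eta>" for x
      using sub that by (intro F(2)) (auto simp: dist_norm)
  qed (rule \<open>\<eta> > 0\<close>)
  then show "norm (deriv F z) \<le> M / \<eta>" by simp
qed

text \<open>A chord is shorter than its arc, so \<open>P\<close> equally spaced points form a net.\<close>

lemma circle_net:
  assumes "norm t = \<rho>" "P > 0"
  obtains l where "l < P" "norm (t - of_real \<rho> * cis (2 * pi * real l / real P)) \<le> 2 * pi * \<rho> / real P"
proof -
  define \<theta> where "\<theta> = Arg2pi t"
  have \<theta>: "0 \<le> \<theta>" "\<theta> < 2 * pi" "t = of_real \<rho> * cis \<theta>"
    using Arg2pi[of t] assms(1) by (auto simp: \<theta>_def cis_conv_exp is_Arg_def mult.commute)
  define l where "l = nat \<lfloor>\<theta> * P / (2 * pi)\<rfloor>"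
  have "0 \<le> \<theta> * P / (2 * pi)" using \<theta> by simp
  then have l: "real l \<le> \<theta> * P / (2 * pi)" "\<theta> * P / (2 * pi) < real l + 1"
    unfolding l_def by linarith+
  have "\<theta> * P / (2 * pi) < P" using \<theta> assms(2) by (simp add: field_simps)
  then have "l < P" using l by linarith
  have "\<bar>\<theta> - 2 * pi * l / P\<bar> \<le> 2 * pi / P"
  proof -
    have "\<theta> - 2 * pi * l / P = (\<theta> * P / (2 * pi) - l) * (2 * pi / P)"
      using assms(2) by (simp add: field_simps)
    moreover have "\<bar>\<theta> * P / (2 * pi) - l\<bar> * (2 * pi / P) \<le> 1 * (2 * pi / P)"
      using l by (intro mult_right_mono) auto
    ultimately show ?thesis by (simp add: abs_mult)
  qed
  moreover have "norm (cis \<theta> - cis (2 * pi * l / P)) \<le> \<bar>\<theta> - 2 * pi * l / P\<bar>"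
  proof -
    have "cis \<theta> - cis (2 * pi * l / P) = cis (2 * pi * l / P) * (cis (\<theta> - 2 * pi * l / P) - 1)"
      by (simp add: right_diff_distrib cis_mult)
    then have "norm (cis \<theta> - cis (2 * pi * l / P)) = norm (exp (\<i> * of_real (\<theta> - 2 * pi * l / P)) - 1)"
      by (simp add: norm_mult cis_conv_exp)
    also have "\<dots> \<le> \<bar>\<theta> - 2 * pi * l / P\<bar>"
      unfolding dist_exp_i_1 using abs_sin_x_le_abs_x[of "(\<theta> - 2 * pi * l / P) / 2"] by simp
    finally show ?thesis .
  qed
  ultimately have "norm (cis \<theta> - cis (2 * pi * l / P)) \<le> 2 * pi / P" by linarith
  then have "norm (t - of_real \<rho> * cis (2 * pi * real l / real P)) \<le> \<rho> * (2 * pi / P)"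
    unfolding \<theta>(3) right_diff_distrib[symmetric] norm_mult using assms(1)
    by (intro mult_mono) auto
  then show thesis using that \<open>l < P\<close> by (simp add: mult.commute)
qed


text \<open>The image of the circle is covered by \<open>P\<close> small discs. Among \<open>T * T\<close>
  candidates for \<open>\<zeta>\<close>, taken on a grid of mesh \<open>1 / T\<close> in the unit
  square, each disc excludes at most one, because all the integer translates of the candidates are
  still distinct grid points. As \<open>P < T * T\<close>, some candidate survives.\<close>

lemma levels_avoiding_circle:
  fixes F :: "complex \<Rightarrow> complex"
  assumes F: "F holomorphic_on ball 0 r" "\<And>t. t \<in> ball 0 r \<Longrightarrow> norm (F t) \<le> M"
    and "M \<ge> 1" "0 < \<eta>" "\<eta> \<le> 1" "0 < r - 2 * \<eta>" "r - 2 * \<eta> \<le> 2"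
  obtains \<zeta> where "norm \<zeta> \<le> 2" "0 \<le> Re \<zeta>"
    "\<And>t j. norm t = r - 2 * \<eta> \<Longrightarrow> \<eta> / (500 * M) \<le> norm (F t - (\<zeta> + of_nat j))"
proof -
  define L where "L = M / \<eta>"
  define T where "T = nat \<lceil>102 * L\<rceil> + 1"
  define P where "P = nat \<lceil>32 * pi * T * L\<rceil>"
  define \<rho> where "\<rho> = r - 2 * \<eta>"
  define s where "s = (\<lambda>l. of_real \<rho> * cis (2 * pi * real l / real P))"
  define gp where "gp = (\<lambda>(a, b). (of_nat a + \<i> * of_nat b) / of_nat T :: complex)"
  define bad where "bad = (\<lambda>l. {x \<in> {..<T} \<times> {..<T}. \<exists>j. norm (F (s l) - (gp x + of_nat j)) < 1 / (2 * T)})"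
  have L: "L \<ge> 1" using assms by (simp add: L_def field_simps)
  have T: "real T > 102 * L" "real T \<le> 104 * L" "T > 0"
    using L unfolding T_def by linarith+
  have TL: "T * L \<ge> 1" using T L by (simp add: mult_ge1_I)
  have P: "real P \<ge> 32 * pi * T * L" unfolding P_def by linarith
  have "32 * pi * (T * L) > 0" using TL by simp
  then have "real P \<le> 32 * pi * (T * L) + 1" unfolding P_def mult.assoc by linarith
  also have "32 * pi * (T * L) \<le> 101 * (T * L)"
    using TL pi_approx by (intro mult_right_mono) auto
  finally have "real P \<le> 102 * L * T" using TL by (simp add: algebra_simps)
  also have "\<dots> < real T * T" using T by (intro mult_strict_right_mono) auto
  finally have PT: "P < T * T" by (metis of_nat_less_iff of_nat_mult)
  have P0: "P > 0" using P \<open>32 * pi * (T * L) > 0\<close> by (metis of_nat_0_less_iff less_le_trans mult.assoc)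
  have fin_bad: "finite (bad l)" for l
    unfolding bad_def by (rule finite_subset[of _ "{..<T} \<times> {..<T}"]) auto
  have card1: "card (bad l) \<le> 1" for l
  proof -
    have "x = y" if "x \<in> bad l" "y \<in> bad l" for x y
    proof -
      obtain a b a' b' where xy: "x = (a, b)" "y = (a', b')" by (metis surj_pair)
      obtain i j where ij: "norm (F (s l) - (gp x + of_nat i)) < 1 / (2 * T)"
        "norm (F (s l) - (gp y + of_nat j)) < 1 / (2 * T)"
        using \<open>x \<in> bad l\<close> \<open>y \<in> bad l\<close> by (auto simp: bad_def)
      have "norm ((gp x + of_nat i) - (gp y + of_nat j)) < 1 / T"
        using norm_triangle_ineq4[of "F (s l) - (gp y + of_nat j)" "F (s l) - (gp x + of_nat i)"] ij
        by (simp add: algebra_simps)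
      then have "norm (of_nat T * ((gp x + of_nat i) - (gp y + of_nat j))) < 1"
        using T unfolding norm_mult norm_of_nat by (simp add: field_simps)
      moreover have "of_nat T * ((gp x + of_nat i) - (gp y + of_nat j)) =
          Complex (of_int (int (a + i * T) - int (a' + j * T))) (of_int (int b - int b'))"
        using T by (simp add: xy gp_def field_simps complex_eq_iff)
      ultimately have "norm (Complex (of_int (int (a + i * T) - int (a' + j * T))) (of_int (int b - int b'))) < 1"
        by simp
      then have "\<bar>of_int (int (a + i * T) - int (a' + j * T)) :: real\<bar> < 1" "\<bar>of_int (int b - int b') :: real\<bar> < 1"
        using abs_Re_le_cmod abs_Im_le_cmod by (metis complex.sel le_less_trans)+
      then have "int (a + i * T) - int (a' + j * T) = 0" "int b - int b' = 0" by linarith+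
      then have "a + i * T = a' + j * T" "b = b'" by linarith+
      then have "(a + i * T) mod T = (a' + j * T) mod T" by simp
      then have "a = a'" using that by (simp add: xy bad_def)
      then show ?thesis using xy \<open>b = b'\<close> by simp
    qed
    then show ?thesis using card_le_Suc0_iff_eq[OF fin_bad, of l] by auto
  qed
  have "card (\<Union>l<P. bad l) \<le> (\<Sum>l<P. card (bad l))" by (rule card_UN_le) simp
  also have "\<dots> \<le> (\<Sum>l<P. 1)" by (intro sum_mono card1)
  finally have "card (\<Union>l<P. bad l) < card ({..<T} \<times> {..<T})" using PT by simp
  then have "\<not> {..<T} \<times> {..<T} \<subseteq> (\<Union>l<P. bad l)"
    using card_mono[of "\<Union>l<P. bad l" "{..<T} \<times> {..<T}"] fin_bad by auto
  then obtain x where x: "x \<in> {..<T} \<times> {..<T}" "\<And>l. l < P \<Longrightarrow> x \<notin> bad l" by auto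
  obtain a b where ab: "x = (a, b)" "a < T" "b < T" using x(1) by auto
  have far: "1 / (2 * T) \<le> norm (F (s l) - (gp x + of_nat j))" if "l < P" for l j
    using x(2)[OF that] x(1) by (auto simp: bad_def not_less)
  show thesis
  proof (rule that[of "gp x"])
    have "gp x = of_real (a / T) + \<i> * of_real (b / T)"
      by (simp add: gp_def ab field_simps add_divide_distrib)
    then have "norm (gp x) \<le> a / T + b / T"
      by (metis norm_triangle_le norm_mult norm_ii mult_1 norm_of_real abs_of_nonneg
          divide_nonneg_nonneg of_nat_0_le_iff order_refl)
    also have "\<dots> \<le> 1 + 1" using ab by (intro add_mono) auto
    finally show "norm (gp x) \<le> 2" by simp
    show "0 \<le> Re (gp x)" by (simp add: gp_def ab Re_divide_of_nat)
    fix t :: complex and j assume t: "norm t = r - 2 * \<eta>"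
    obtain l where l: "l < P" "norm (t - s l) \<le> 2 * pi * \<rho> / P"
      using circle_net[of t \<rho> P] t P0 by (auto simp: \<rho>_def s_def)
    have "0 \<le> \<rho>" using assms by (simp add: \<rho>_def)
    then have "norm (s l) = \<rho>" by (simp add: s_def norm_mult)
    then have "norm (F t - F (s l)) \<le> L * norm (t - s l)"
      unfolding L_def using t by (intro lipschitz_on_inner_disc[OF F]) (auto simp: \<rho>_def assms)
    also have "\<dots> \<le> L * (2 * pi * \<rho> / P)" using L l by (intro mult_left_mono) auto
    also have "\<dots> \<le> L * (2 * pi * 2 / (32 * pi * T * L))"
      using P L TL assms by (intro mult_left_mono frac_le) (auto simp: \<rho>_def mult.assoc)
    also have "\<dots> = 1 / (8 * T)" using L T by (simp add: field_simps)
    finally have "1 / (2 * T) - 1 / (8 * T) \<le> norm (F t - (gp x + of_nat j))"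
      using far[OF l(1), of j] dist_triangle[of "F (s l)" "gp x + of_nat j" "F t"]
      unfolding dist_norm norm_minus_commute[of "F (s l)" "F t"] by linarith
    moreover have "1 / (2 * real T) - 1 / (8 * T) = 3 / (8 * T)" using T by (simp add: field_simps)
    moreover have "1 / (500 * L) \<le> 3 / (8 * T)" using T L by (simp add: field_simps)
    ultimately show "\<eta> / (500 * M) \<le> norm (F t - (gp x + of_nat j))"
      by (simp add: L_def)
  qed
qed

text \<open>Levels of mutual distance at least 1 have this property: a point is within \<open>1 / 2\<close>
  of at most one of them.\<close>

lemma prod_lower_bound_one_small:
  fixes x :: "'i \<Rightarrow> real"
  assumes "finite I" "0 < \<epsilon>" "\<epsilon> \<le> 1" "\<And>i. i \<in> I \<Longrightarrow> \<epsilon> \<le> x i"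
    and "\<And>i j. i \<in> I \<Longrightarrow> j \<in> I \<Longrightarrow> i \<noteq> j \<Longrightarrow> 1 / 2 \<le> x i \<or> 1 / 2 \<le> x j"
  shows "\<epsilon> / 2 ^ card I \<le> (\<Prod>i\<in>I. x i)"
proof (cases "\<forall>i\<in>I. 1 / 2 \<le> x i")
  case True
  have "\<epsilon> / 2 ^ card I \<le> (1 / 2) ^ card I"
    using assms by (simp add: power_divide divide_right_mono)
  also have "\<dots> = (\<Prod>i\<in>I. 1 / 2)" by simp
  also have "\<dots> \<le> (\<Prod>i\<in>I. x i)" using True by (intro prod_mono) auto
  finally show ?thesis .
next
  case False
  then obtain a where a: "a \<in> I" "x a < 1 / 2" by auto
  have "\<epsilon> / 2 ^ card I \<le> \<epsilon> * (1 / 2) ^ card (I - {a})"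
    using assms by (simp add: power_divide frac_le card_Diff1_le power_increasing)
  also have "\<dots> = \<epsilon> * (\<Prod>i\<in>I - {a}. 1 / 2)" by simp
  also have "\<dots> \<le> x a * (\<Prod>i\<in>I - {a}. x i)"
  proof (rule mult_mono)
    show "(\<Prod>i\<in>I - {a}. 1 / 2) \<le> (\<Prod>i\<in>I - {a}. x i)"
      using assms(5)[of _ a] a by (intro prod_mono) fastforce
    show "0 \<le> x a" using assms(2) assms(4)[OF a(1)] by linarith
  qed (use assms a in \<open>auto intro: prod_nonneg\<close>)
  also have "\<dots> = (\<Prod>i\<in>I. x i)" using a assms(1) by (simp add: prod.remove)
  finally show ?thesis .
qed

lemma norm_prod_list_diff_le:
  fixes t :: complex
  assumes "norm t \<le> \<rho>" "set zs \<subseteq> cball 0 \<rho>"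
  shows "norm (prod_list (map (\<lambda>z. t - z) zs)) \<le> (2 * \<rho>) ^ length zs"
  using assms(2)
proof (induction zs)
  case (Cons z zs)
  have "norm (t - z) \<le> 2 * \<rho>"
    using Cons.prems assms(1) norm_triangle_ineq4[of t z] by auto
  then show ?case
    using mult_mono[OF _ Cons.IH, of "norm (t - z)" "2 * \<rho>"] Cons.prems norm_ge_zero[of "t - z"]
    by (simp add: norm_mult order_trans[of 0 "norm (t - z)"])
qed simp

lemma norm_prod_list_ge:
  assumes "\<And>z. z \<in> set zs \<Longrightarrow> r \<le> norm (z::complex)" "0 \<le> r"
  shows "r ^ length zs \<le> norm (prod_list (map (\<lambda>z. 0 - z) zs))"
  using assms(1) by (induction zs) (auto simp: norm_mult assms(2) intro!: mult_mono)

text \<open>Suppose that only \<open>k\<close> levels had \<open>k + 1\<close> zeros. The product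
  \<open>G\<close> of the functions \<open>F - w j\<close> over the other levels has at most
  \<open>k\<close> zeros per factor. Dividing each zero \<open>z\<close> out through \<open>(t -
  z) / (2 * \<rho>)\<close>, a function of modulus at most 1, gives a zero-free \<open>E\<close>
  with \<open>norm (G t) \<le> norm (E t)\<close>. Then \<open>E\<close> is bounded below on the
  circle of radius \<open>\<rho>\<close>, by the choice of the levels; it is moderate at 0,
  because the zeros stay away from 0 where \<open>F\<close> is small; and it is huge at 1.
  Harnack's inequality excludes this. Taking \<open>K - k\<close> factors makes the loss \<open>ln
  (500 * M / \<eta>)\<close> caused by the single level close to the circle negligible in
  comparison.\<close>

lemma many_levels_with_many_zeros:
  fixes F :: "complex \<Rightarrow> complex" and c k K :: nat and \<eta> M r0 :: real
  assumes F: "F holomorphic_on ball 0 (1 + 3 * \<eta>)" "\<And>t. t \<in> ball 0 (1 + 3 * \<eta>) \<Longrightarrow> norm (F t) \<le> M"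
    and M: "M \<ge> 1" and \<eta>: "0 < \<eta>" "\<eta> \<le> 1" and r0: "0 < r0" "r0 \<le> 1"
    and small: "\<And>t. norm t \<le> r0 \<Longrightarrow> norm (F t) \<le> c"
    and "k < K" and F1: "norm (F 1) \<ge> 2 * (c + K + 4)"
    and big: "ln (norm (F 1) / 2) > 3 / \<eta> *
      (ln (8 * (c + K + 4)) + k * ln (4 / r0) + ln (500 * M / \<eta>) / (K - k))"
  obtains \<zeta> J zs u where "norm \<zeta> \<le> 2" "J \<subseteq> {..<K}" "card J = Suc k"
    "\<And>j. j \<in> J \<Longrightarrow> set (zs j) \<subseteq> cball 0 (1 + \<eta>)" "\<And>j. j \<in> J \<Longrightarrow> length (zs j) = Suc k"
    "\<And>j. j \<in> J \<Longrightarrow> u j holomorphic_on ball 0 (1 + 3 * \<eta>)"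
    "\<And>j t. j \<in> J \<Longrightarrow> t \<in> ball 0 (1 + 3 * \<eta>) \<Longrightarrow>
      F t - (\<zeta> + of_nat (c + 1 + j)) = prod_list (map (\<lambda>z. t - z) (zs j)) * u j t"
proof -
  define \<rho> where "\<rho> = 1 + \<eta>"
  define \<epsilon> where "\<epsilon> = \<eta> / (500 * M)"
  let ?B = "ball (0::complex) (1 + 3 * \<eta>)" and ?C = "cball (0::complex) \<rho>"
  have \<epsilon>: "0 < \<epsilon>" "\<epsilon> \<le> 1" using \<eta> M by (auto simp: \<epsilon>_def field_simps)
  have CB: "?C \<subseteq> ?B" using \<eta> by (auto simp: \<rho>_def)
  obtain \<zeta> where \<zeta>: "norm \<zeta> \<le> 2" "0 \<le> Re \<zeta>"
    "\<And>t j. norm t = (1 + 3 * \<eta>) - 2 * \<eta> \<Longrightarrow> \<eta> / (500 * M) \<le> norm (F t - (\<zeta> + of_nat j))"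
    by (rule levels_avoiding_circle[OF F M \<eta>]) (use \<eta> in auto)
  define w where "w = (\<lambda>j. \<zeta> + of_nat (c + 1 + j))"
  have "\<exists>zs u. set zs \<subseteq> ?C \<and> u holomorphic_on ?B \<and> length zs \<le> Suc k \<and>
    (\<forall>t\<in>?B. F t - w j = prod_list (map (\<lambda>z. t - z) zs) * u t) \<and>
    (length zs = Suc k \<or> (\<forall>t\<in>?C. u t \<noteq> 0))" for j
  proof -
    have "(\<lambda>t. F t - w j) holomorphic_on ?B" by (intro holomorphic_intros F)
    from factor_out_zeros[OF this open_ball CB, of "Suc k"] show ?thesis by metis
  qed
  then obtain zs u where zu: "\<And>j. set (zs j) \<subseteq> ?C" "\<And>j. u j holomorphic_on ?B"
    "\<And>j. length (zs j) \<le> Suc k"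
    "\<And>j t. t \<in> ?B \<Longrightarrow> F t - w j = prod_list (map (\<lambda>z. t - z) (zs j)) * u j t"
    "\<And>j. length (zs j) = Suc k \<or> (\<forall>t\<in>?C. u j t \<noteq> 0)"
    by metis
  define J0 where "J0 = {j \<in> {..<K}. length (zs j) = Suc k}"
  have "Suc k \<le> card J0"
  proof (rule ccontr)
    assume "\<not> Suc k \<le> card J0"
    define I where "I = {..<K} - J0"
    define m where "m = card I"
    have finI: "finite I" by (simp add: I_def)
    have "card I = K - card J0" unfolding I_def by (subst card_Diff_subset) (auto simp: J0_def)
    then have m: "K - k \<le> m" using \<open>\<not> Suc k \<le> card J0\<close> by (simp add: m_def)
    then have m1: "m \<ge> 1" using \<open>k < K\<close> by linarith
    have I: "length (zs j) \<le> k" "\<And>t. t \<in> ?C \<Longrightarrow> u j t \<noteq> 0" "j < K" if "j \<in> I" for j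
      using that zu(3)[of j] zu(5)[of j] by (auto simp: I_def J0_def)
    have nw: "norm (w j) \<le> c + K + 4" if "j < K" for j
    proof -
      have "norm (w j) \<le> norm \<zeta> + norm (of_nat (c + 1 + j) :: complex)"
        unfolding w_def by (rule norm_triangle_ineq)
      then show ?thesis using \<zeta>(1) that unfolding norm_of_nat by simp
    qed
    define E where "E = (\<lambda>t. \<Prod>j\<in>I. u j t * of_real ((2 * \<rho>) ^ length (zs j)))"
    have E_ge: "(\<Prod>j\<in>I. norm (F t - w j)) \<le> norm (E t)" if "t \<in> ?C" for t
    proof -
      have "norm (F t - w j) \<le> norm (u j t * of_real ((2 * \<rho>) ^ length (zs j)))" for j
      proof -
        have "norm (prod_list (map (\<lambda>z. t - z) (zs j))) \<le> (2 * \<rho>) ^ length (zs j)"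
          using that zu(1) by (intro norm_prod_list_diff_le) auto
        moreover have "F t - w j = prod_list (map (\<lambda>z. t - z) (zs j)) * u j t"
          using zu(4) that CB by blast
        moreover have "norm (of_real ((2 * \<rho>) ^ length (zs j)) :: complex) = (2 * \<rho>) ^ length (zs j)"
          using \<eta> unfolding norm_of_real by (simp add: \<rho>_def)
        ultimately show ?thesis
          by (simp only: norm_mult mult.commute[of "norm (u j t)"]) (intro mult_right_mono norm_ge_zero)
      qed
      then show ?thesis unfolding E_def prod_norm[symmetric] by (intro prod_mono) auto
    qed
    have Enz: "E t \<noteq> 0" if "t \<in> ?C" for t
    proof -
      have "\<rho> \<noteq> 0" using \<eta> by (simp add: \<rho>_def)
      then show ?thesis using that I(2) finI by (simp add: E_def)
    qed
    have holE: "E holomorphic_on ?B" unfolding E_def by (intro holomorphic_intros zu(2))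
    have min: "\<epsilon> / 2 ^ m \<le> norm (E t)" if "t \<in> ?C" for t
    proof -
      have "norm (inverse (E t)) \<le> 2 ^ m / \<epsilon>"
      proof (rule maximum_modulus_frontier[of "\<lambda>t. inverse (E t)" ?C])
        show "(\<lambda>t. inverse (E t)) holomorphic_on interior ?C"
          using CB Enz by (intro holomorphic_intros holomorphic_on_subset[OF holE]) auto
        show "continuous_on (closure ?C) (\<lambda>t. inverse (E t))"
          using CB Enz
          by (intro holomorphic_on_imp_continuous_on holomorphic_intros holomorphic_on_subset[OF holE]) auto
        fix z assume "z \<in> frontier ?C"
        then have z: "norm z = \<rho>" by (simp add: frontier_def)
        have "\<epsilon> / 2 ^ m \<le> (\<Prod>j\<in>I. norm (F z - w j))"
          unfolding m_def
        proof (rule prod_lower_bound_one_small[OF finI \<epsilon>])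
          show "\<epsilon> \<le> norm (F z - w j)" for j
            using \<zeta>(3)[of z "c + 1 + j"] z by (simp add: \<epsilon>_def \<rho>_def w_def)
          fix i j :: nat assume "i \<noteq> j"
          have "w i - w j = of_int (int i - int j)" by (simp add: w_def)
          then have "norm (w i - w j) = \<bar>real_of_int (int i - int j)\<bar>" by (metis norm_of_int)
          then have "1 \<le> norm (w i - w j)" using \<open>i \<noteq> j\<close> by linarith
          then show "1 / 2 \<le> norm (F z - w i) \<or> 1 / 2 \<le> norm (F z - w j)"
            using norm_triangle_ineq4[of "F z - w j" "F z - w i"] by auto
        qed
        also have "\<dots> \<le> norm (E z)" using z by (intro E_ge) auto
        finally show "norm (inverse (E z)) \<le> 2 ^ m / \<epsilon>"
          using \<epsilon> Enz[of z] z unfolding norm_inverse by (simp add: field_simps)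
      qed (use that in auto)
      then show ?thesis using \<epsilon> Enz[OF that] unfolding norm_inverse by (simp add: field_simps)
    qed
    (* Twice the reciprocal of the lower bound, as Harnack needs modulus strictly below 1. *)
    define A where "A = 2 ^ Suc m / \<epsilon>"
    have A: "A > 1" "0 < A" using \<epsilon> by (auto simp: A_def field_simps intro: less_le_trans[of _ 2])
    have lnA: "ln A = Suc m * ln 2 + ln (500 * M / \<eta>)"
    proof -
      have "A = 2 ^ Suc m * (500 * M / \<eta>)" by (simp add: A_def \<epsilon>_def)
      then have "ln A = ln (2 ^ Suc m * (500 * M / \<eta>))" by (rule arg_cong)
      also have "\<dots> = ln (2 ^ Suc m) + ln (500 * M / \<eta>)"
        by (rule ln_mult_pos) (use M \<eta> in auto)
      also have "ln (2 ^ Suc m) = Suc m * ln (2::real)" by (rule ln_realpow)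
      finally show ?thesis .
    qed
    have 0: "(0::complex) \<in> ball 0 \<rho>" using \<eta> by (simp add: \<rho>_def)
    have harn: "- ln (norm (inverse (E 1) / of_real A)) \<le> (\<rho> + norm (1::complex)) / (\<rho> - norm (1::complex)) *
      (- ln (norm (inverse (E 0) / of_real A)))"
    proof (rule harnack_nonvanishing)
      show "(\<lambda>s. inverse (E s) / of_real A) holomorphic_on ball 0 \<rho>"
        using A Enz CB by (intro holomorphic_intros holomorphic_on_subset[OF holE]) auto
      fix s :: complex assume s: "s \<in> ball 0 \<rho>"
      then have "s \<in> ?C" by auto
      then show "inverse (E s) / of_real A \<noteq> 0" using Enz A by simp
      have "1 < A * norm (E s)"
      proof -
        have "A * (\<epsilon> / 2 ^ m) \<le> A * norm (E s)" using min[OF \<open>s \<in> ?C\<close>] A by (intro mult_left_mono) auto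
        moreover have "A * (\<epsilon> / 2 ^ m) = 2" using \<epsilon> by (simp add: A_def)
        ultimately show ?thesis by linarith
      qed
      then show "norm (inverse (E s) / of_real A) < 1"
      proof -
        have "norm (inverse (E s) / of_real A) = 1 / (A * norm (E s))"
          using A by (simp only: norm_divide norm_inverse norm_of_real) (simp add: inverse_eq_divide)
        then show ?thesis using \<open>1 < A * norm (E s)\<close> by simp
      qed
    qed (use \<eta> in \<open>simp add: \<rho>_def\<close>)
    have ln_scaled: "- ln (norm (inverse (E s) / of_real A)) = ln (norm (E s)) + ln A" if "s \<in> ?C" for s
      using Enz[OF that] A by (simp add: norm_divide norm_inverse ln_div ln_inverse)
    have 1: "(1::complex) \<in> ?C" and 0: "(0::complex) \<in> ?C" using \<eta> by (auto simp: \<rho>_def)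
    have E0_pos: "0 \<le> ln (norm (E 0)) + ln A"
    proof -
      have "1 \<le> A * norm (E 0)"
      proof -
        have "A * (\<epsilon> / 2 ^ m) \<le> A * norm (E 0)" using min[OF 0] A by (intro mult_left_mono) auto
        moreover have "A * (\<epsilon> / 2 ^ m) = 2" using \<epsilon> by (simp add: A_def)
        ultimately show ?thesis by linarith
      qed
      then have "0 \<le> ln (norm (E 0) * A)" by (simp add: mult.commute)
      then show ?thesis using Enz[OF 0] A by (simp add: ln_mult_pos)
    qed
    have "ln (norm (E 1)) + ln A \<le> (\<rho> + 1) / (\<rho> - 1) * (ln (norm (E 0)) + ln A)"
      using harn unfolding ln_scaled[OF 0] ln_scaled[OF 1] by simp
    also have "\<dots> \<le> 3 / \<eta> * (ln (norm (E 0)) + ln A)"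
      using \<eta> E0_pos by (intro mult_right_mono) (auto simp: \<rho>_def field_simps)
    finally have H: "ln (norm (E 1)) \<le> 3 / \<eta> * (ln (norm (E 0)) + ln A)" using A by (smt (verit) ln_gt_zero)
    have lower: "m * ln (norm (F 1) / 2) \<le> ln (norm (E 1))"
    proof -
      have "(norm (F 1) / 2) ^ m = (\<Prod>j\<in>I. norm (F 1) / 2)" by (simp add: m_def)
      also have "\<dots> \<le> (\<Prod>j\<in>I. norm (F 1 - w j))"
      proof (intro prod_mono conjI)
        fix j assume "j \<in> I"
        then show "norm (F 1) / 2 \<le> norm (F 1 - w j)"
          using nw[OF I(3)] F1 norm_triangle_ineq2[of "F 1" "w j"] by fastforce
      qed auto
      also have "\<dots> \<le> norm (E 1)" by (rule E_ge[OF 1])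
      finally have le: "(norm (F 1) / 2) ^ m \<le> norm (E 1)" .
      have "8 \<le> norm (F 1)" using F1 by simp
      then have "norm (F 1) / 2 > 0" by linarith
      then have "ln ((norm (F 1) / 2) ^ m) \<le> ln (norm (E 1))" using le Enz[OF 1] by (subst ln_le_cancel_iff) auto
      then show ?thesis using \<open>norm (F 1) / 2 > 0\<close> by (simp only: ln_realpow)
    qed
    have upper: "ln (norm (E 0)) \<le> m * (ln (2 * (c + K + 4)) + k * ln (4 / r0))"
    proof -
      define b where "b = 2 * real (c + K + 4) * (4 / r0) ^ k"
      have "norm (u j 0 * of_real ((2 * \<rho>) ^ length (zs j))) \<le> b" if j: "j \<in> I" for j
      proof -
        (* The levels have real part above c, the bound of F near 0. *)
        have "r0 \<le> norm z" if "z \<in> set (zs j)" for z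
        proof (rule ccontr)
          assume "\<not> r0 \<le> norm z"
          then have "norm (F z) \<le> c" by (intro small) simp
          moreover have "F z = w j"
          proof -
            have "z \<in> ?B" using that zu(1)[of j] CB by blast
            moreover have "0 \<in> set (map (\<lambda>y. z - y) (zs j))" using that by force
            then have "prod_list (map (\<lambda>y. z - y) (zs j)) = 0" by (simp only: prod_list_zero_iff)
            ultimately show ?thesis using zu(4)[of z j] by simp
          qed
          moreover have "c + 1 \<le> Re (w j)" using \<zeta>(2) by (simp add: w_def)
          ultimately show False using complex_Re_le_cmod[of "w j"] by simp
        qed
        then have "r0 ^ length (zs j) \<le> norm (prod_list (map (\<lambda>z. 0 - z) (zs j)))"
          using r0 by (intro norm_prod_list_ge) auto
        then have "r0 ^ length (zs j) * norm (u j 0) \<le> norm (F 0 - w j)"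
          using zu(4)[of 0 j] \<eta> by (simp add: norm_mult mult_right_mono)
        also have "\<dots> \<le> c + (c + K + 4)"
          using small[of 0] r0 nw[OF I(3)[OF j]] norm_triangle_ineq4[of "F 0" "w j"] by fastforce
        also have "\<dots> \<le> 2 * real (c + K + 4)" by simp
        finally have u0: "norm (u j 0) \<le> 2 * real (c + K + 4) / r0 ^ length (zs j)"
          using r0 by (simp add: field_simps)
        have "norm (u j 0 * of_real ((2 * \<rho>) ^ length (zs j))) = norm (u j 0) * (2 * \<rho>) ^ length (zs j)"
          using \<eta> unfolding norm_mult norm_of_real by (simp add: \<rho>_def)
        also have "\<dots> \<le> 2 * real (c + K + 4) / r0 ^ length (zs j) * 4 ^ length (zs j)"
          using u0 \<eta> r0 by (intro mult_mono power_mono) (auto simp: \<rho>_def)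
        also have "\<dots> = 2 * real (c + K + 4) * (4 / r0) ^ length (zs j)" by (simp add: power_divide)
        also have "\<dots> \<le> b"
          unfolding b_def using I(1)[OF j] r0 by (intro mult_left_mono power_increasing) auto
        finally show ?thesis .
      qed
      then have "norm (E 0) \<le> (\<Prod>j\<in>I. b)"
        unfolding E_def prod_norm[symmetric] by (intro prod_mono) auto
      also have "\<dots> = b ^ m" by (simp add: m_def)
      finally have le: "norm (E 0) \<le> b ^ m" .
      have b: "b > 0" using r0 by (simp add: b_def)
      have "ln (norm (E 0)) \<le> ln (b ^ m)" using le Enz[OF 0] by (intro ln_mono) auto
      also have "\<dots> = m * ln b" using b by (simp add: ln_realpow)
      also have "ln b = ln (2 * real (c + K + 4)) + k * ln (4 / r0)"
        unfolding b_def using r0 by (subst ln_mult_pos) (auto simp: ln_realpow)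
      finally show ?thesis by simp
    qed
    have lnA': "ln A \<le> m * (ln 4 + ln (500 * M / \<eta>) / (K - k))"
    proof -
      have "Suc m * ln 2 \<le> (2 * m) * ln (2::real)" using m1 by (intro mult_right_mono) auto
      also have "\<dots> = m * ln 4" using ln_realpow[of 2 2] by simp
      finally have 1: "Suc m * ln 2 \<le> m * ln (4::real)" .
      have "0 \<le> ln (500 * M / \<eta>)" using M \<eta> by (intro ln_ge_zero) (simp add: field_simps)
      moreover have "1 \<le> m / real (K - k)" using m \<open>k < K\<close> by (simp add: field_simps)
      ultimately have "1 * ln (500 * M / \<eta>) \<le> m / real (K - k) * ln (500 * M / \<eta>)"
        by (intro mult_right_mono) auto
      then show ?thesis using 1 \<open>k < K\<close> by (simp add: lnA distrib_left of_nat_diff)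
    qed
    have "m * ln (norm (F 1) / 2) \<le> 3 / \<eta> * (m * (ln (2 * (c + K + 4)) + k * ln (4 / r0))
        + m * (ln 4 + ln (500 * M / \<eta>) / (K - k)))"
      using lower H upper lnA' \<eta> by (smt (verit, best) mult_left_mono divide_nonneg_pos)
    also have "\<dots> = m * (3 / \<eta> * ((ln (2 * (c + K + 4)) + ln 4) + k * ln (4 / r0) + ln (500 * M / \<eta>) / (K - k)))"
      by (simp add: algebra_simps)
    finally have *: "m * ln (norm (F 1) / 2) \<le> m * (3 / \<eta> *
        ((ln (2 * (c + K + 4)) + ln 4) + k * ln (4 / r0) + ln (500 * M / \<eta>) / (K - k)))" .
    have "ln (2 * (c + K + 4)) + ln 4 = ln (8 * real (c + K + 4))"
      by (subst ln_mult_pos[symmetric]) auto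
    from *[unfolded this] have "m * ln (norm (F 1) / 2) \<le> m * (3 / \<eta> * (ln (8 * real (c + K + 4)) + k * ln (4 / r0)
        + ln (500 * M / \<eta>) / (K - k)))" by simp
    moreover have "0 < real m" using m1 by simp
    ultimately have "ln (norm (F 1) / 2) \<le> 3 / \<eta> * (ln (8 * real (c + K + 4)) + k * ln (4 / r0)
        + ln (500 * M / \<eta>) / (K - k))" by (simp only: mult_le_cancel_left_pos)
    then show False using big by simp
  qed
  then obtain J where J: "J \<subseteq> J0" "card J = Suc k" by (metis obtain_subset_with_card_n)
  show thesis
  proof (rule that[of \<zeta> J zs u])
    show "J \<subseteq> {..<K}" using J by (auto simp: J0_def)
    show "length (zs j) = Suc k" if "j \<in> J" for j using that J by (auto simp: J0_def)
    show "set (zs j) \<subseteq> cball 0 (1 + \<eta>)" for j using zu(1) by (simp add: \<rho>_def)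
    show "F t - (\<zeta> + of_nat (c + 1 + j)) = prod_list (map (\<lambda>z. t - z) (zs j)) * u j t"
      if "t \<in> ?B" for t j using zu(4)[OF that] by (simp add: w_def)
  qed (use \<zeta> J zu in auto)
qed


section \<open>Homogeneous expansions of entire functions\<close>

text \<open>Continuity together with holomorphy along every complex line passes to sums and products at
  once, and it is the form in which one-variable theorems are applied below.\<close>

definition line_holomorphic :: "(complex ^ 'n \<Rightarrow> complex) \<Rightarrow> bool" where
  "line_holomorphic h \<longleftrightarrow>
     continuous_on UNIV h \<and> (\<forall>z v. (\<lambda>s. h (z + s *s v)) holomorphic_on UNIV)"

lemma norm_scalar_mult_vec: "norm (s *s v) = norm s * norm (v :: complex ^ 'n)"
  by (simp add: norm_vec_def norm_mult L2_set_right_distrib)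

lemma bounded_linear_scalar_mult_vec: "bounded_linear (\<lambda>s. s *s (v :: complex ^ 'n))"
  by (rule bounded_linear_intro[of _ "norm v"])
    (auto simp: vec_eq_iff norm_scalar_mult_vec algebra_simps)

lemma entire_imp_line_holomorphic:
  assumes "entire h"
  shows "line_holomorphic h"
  unfolding line_holomorphic_def
proof (intro conjI allI)
  have diff: "\<exists>D. (h has_derivative D) (at z) \<and> (\<forall>c v. D (c *s v) = c * D v)" for z
    using assms by (simp add: entire_def)
  show "continuous_on UNIV h"
    using diff by (meson continuous_at_imp_continuous_on has_derivative_continuous)
  fix z v :: "complex ^ 'a"
  show "(\<lambda>s. h (z + s *s v)) holomorphic_on UNIV"
  proof (rule holomorphic_onI)
    fix s :: complex
    obtain D where D: "(h has_derivative D) (at (z + s *s v))" "\<And>c v. D (c *s v) = c * D v"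
      using diff by blast
    have "((\<lambda>s. s *s v) has_derivative (\<lambda>s. s *s v)) (at s)"
      by (intro bounded_linear_imp_has_derivative bounded_linear_scalar_mult_vec)
    then have "((\<lambda>s. z + s *s v) has_derivative (\<lambda>c. 0 + c *s v)) (at s)"
      by (intro has_derivative_add has_derivative_const)
    from has_derivative_compose[OF this D(1)]
    have "((\<lambda>s. h (z + s *s v)) has_derivative (\<lambda>c. D (c *s v))) (at s)" by simp
    then have "((\<lambda>s. h (z + s *s v)) has_field_derivative D v) (at s)"
      unfolding has_field_derivative_def D(2) by (simp add: mult_commute_abs)
    then show "(\<lambda>s. h (z + s *s v)) field_differentiable at s within UNIV"
      by (auto simp: field_differentiable_def)
  qed
qed

lemma line_holomorphic_const: "line_holomorphic (\<lambda>_. c)"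
  by (auto simp: line_holomorphic_def intro!: continuous_intros holomorphic_intros)

lemma line_holomorphic_component: "line_holomorphic (\<lambda>z. z $ i)"
  by (auto simp: line_holomorphic_def intro!: continuous_intros holomorphic_intros)

lemma line_holomorphic_add:
  "line_holomorphic f \<Longrightarrow> line_holomorphic g \<Longrightarrow> line_holomorphic (\<lambda>z. f z + g z)"
  by (auto simp: line_holomorphic_def intro!: continuous_intros holomorphic_intros)

lemma line_holomorphic_diff:
  "line_holomorphic f \<Longrightarrow> line_holomorphic g \<Longrightarrow> line_holomorphic (\<lambda>z. f z - g z)"
  by (auto simp: line_holomorphic_def intro!: continuous_intros holomorphic_intros)

lemma line_holomorphic_mult:
  "line_holomorphic f \<Longrightarrow> line_holomorphic g \<Longrightarrow> line_holomorphic (\<lambda>z. f z * g z)"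
  by (auto simp: line_holomorphic_def intro!: continuous_intros holomorphic_intros)

lemma line_holomorphic_power: "line_holomorphic f \<Longrightarrow> line_holomorphic (\<lambda>z. f z ^ k)"
  by (auto simp: line_holomorphic_def intro!: continuous_intros holomorphic_intros)

lemma line_holomorphic_sum:
  "(\<And>i. i \<in> I \<Longrightarrow> line_holomorphic (f i)) \<Longrightarrow> line_holomorphic (\<lambda>z. \<Sum>i\<in>I. f i z)"
  by (auto simp: line_holomorphic_def intro!: continuous_intros holomorphic_intros)

lemma line_holomorphic_prod:
  "(\<And>i. i \<in> I \<Longrightarrow> line_holomorphic (f i)) \<Longrightarrow> line_holomorphic (\<lambda>z. \<Prod>i\<in>I. f i z)"
  by (auto simp: line_holomorphic_def intro!: continuous_intros holomorphic_intros)

lemmas line_holomorphic_intros = line_holomorphic_const line_holomorphic_component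
  line_holomorphic_add line_holomorphic_diff line_holomorphic_mult line_holomorphic_power
  line_holomorphic_sum line_holomorphic_prod

lemma line_holomorphicD:
  assumes "line_holomorphic h"
  shows "(\<lambda>s. h (z + s *s v)) holomorphic_on A" "(\<lambda>s. h (s *s v)) holomorphic_on A"
proof -
  show *: "(\<lambda>s. h (z + s *s v)) holomorphic_on A" for z
    using assms by (auto simp: line_holomorphic_def intro: holomorphic_on_subset)
  show "(\<lambda>s. h (s *s v)) holomorphic_on A" using *[of 0] by simp
qed

lemma line_holomorphic_bounded:
  assumes "line_holomorphic h"
  obtains M where "M > 0" "\<And>z. norm z \<le> r \<Longrightarrow> norm (h z) \<le> M"
proof -
  have "compact (h ` cball 0 r)"
    using assms by (intro compact_continuous_image) (auto simp: line_holomorphic_def intro: continuous_on_subset)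
  then obtain M where "\<And>x. x \<in> h ` cball 0 r \<Longrightarrow> norm x \<le> M"
    by (meson bounded_iff compact_imp_bounded)
  then have "norm (h z) \<le> max M 1" if "norm z \<le> r" for z using that by fastforce
  then show thesis using that[of "max M 1"] by force
qed

text \<open>The homogeneous part of degree \<open>m\<close> of the Taylor expansion of \<open>h\<close> at
  0.\<close>

definition hom_coeff :: "(complex ^ 'n \<Rightarrow> complex) \<Rightarrow> nat \<Rightarrow> complex ^ 'n \<Rightarrow> complex" where
  "hom_coeff h m z = (deriv ^^ m) (\<lambda>t. h (t *s z)) 0 / fact m"

lemma hom_coeff_sums:
  assumes "line_holomorphic h"
  shows "(\<lambda>m. hom_coeff h m z * t ^ m) sums h (t *s z)"
  using holomorphic_power_series[of "\<lambda>t. h (t *s z)" 0 "norm t + 1" t]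
    line_holomorphicD(2)[OF assms] by (simp add: hom_coeff_def)

lemma hom_coeff_sums_1:
  assumes "line_holomorphic h"
  shows "(\<lambda>m. hom_coeff h m z) sums h z"
  using hom_coeff_sums[OF assms, of z 1] by simp

lemma power_series_unique:
  fixes a b :: "nat \<Rightarrow> complex"
  assumes "\<And>t. (\<lambda>m. a m * t ^ m) sums F t" "\<And>t. (\<lambda>m. b m * t ^ m) sums F t"
  shows "a = b"
proof -
  have "(\<lambda>m. (a m - b m) * t ^ m) sums 0" for t
    using sums_diff[OF assms(1)[of t] assms(2)[of t]] by (simp add: algebra_simps)
  then have zero: "(\<lambda>m. (a m - b m) * (t - 0) ^ m) sums 0" for t by simp
  have "a m - b m = 0" for m
  proof (cases m)
    case 0
    have "(\<lambda>m. (a m - b m) * 0 ^ m) sums (a 0 - b 0)" by (rule powser_sums_zero)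
    with zero[of 0] show ?thesis using 0 by (simp add: sums_unique2)
  next
    case (Suc n)
    show ?thesis
    proof (rule ccontr)
      assume "a m - b m \<noteq> 0"
      then show False
      proof (rule powser_0_nonzero[OF zero_less_one zero refl])
        show "0 < m" using Suc by simp
        fix s :: real assume "0 < s" "\<And>z. z \<in> cball 0 s - {0::complex} \<Longrightarrow> (0::complex) \<noteq> 0"
        from this(2)[of "of_real s"] this(1) show False by simp
      qed
    qed
  qed
  then show ?thesis by (simp add: fun_eq_iff)
qed

lemma hom_coeff_eqI:
  assumes "line_holomorphic h" "\<And>t. (\<lambda>m. a m * t ^ m) sums h (t *s z)"
  shows "hom_coeff h m z = a m"
  using power_series_unique[OF hom_coeff_sums[OF assms(1)] assms(2)] by (rule fun_cong)

lemma hom_coeff_scale: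
  assumes "line_holomorphic h"
  shows "hom_coeff h m (c *s z) = c ^ m * hom_coeff h m z"
proof (rule hom_coeff_eqI[OF assms])
  show "(\<lambda>m. c ^ m * hom_coeff h m z * t ^ m) sums h (t *s (c *s z))" for t
    using hom_coeff_sums[OF assms, of z "t * c"] by (simp add: power_mult_distrib algebra_simps)
qed

lemma hom_coeff_sum:
  assumes "\<And>i. i \<in> I \<Longrightarrow> line_holomorphic (h i)"
  shows "hom_coeff (\<lambda>z. \<Sum>i\<in>I. c i * h i z) m z = (\<Sum>i\<in>I. c i * hom_coeff (h i) m z)"
proof (rule hom_coeff_eqI)
  show "line_holomorphic (\<lambda>z. \<Sum>i\<in>I. c i * h i z)"
    using assms by (intro line_holomorphic_intros)
  show "(\<lambda>m. (\<Sum>i\<in>I. c i * hom_coeff (h i) m z) * t ^ m) sums (\<Sum>i\<in>I. c i * h i (t *s z))" for t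
    using sums_sum[of I "\<lambda>i m. c i * (hom_coeff (h i) m z * t ^ m)" "\<lambda>i. c i * h i (t *s z)"]
      sums_mult[OF hom_coeff_sums[OF assms]]
    by (simp add: sum_distrib_right mult.assoc)
qed

text \<open>Cauchy's inequality on the complex line through 0 and \<open>z\<close>.\<close>

lemma hom_coeff_bound:
  assumes "line_holomorphic h" "r > 0" "\<And>w. norm w \<le> r \<Longrightarrow> norm (h w) \<le> B"
  shows "norm (hom_coeff h m z) \<le> B * (norm z / r) ^ m"
proof (cases "z = 0")
  case True
  have "hom_coeff h m 0 = (if m = 0 then h 0 else 0)"
    by (rule hom_coeff_eqI[OF assms(1)])
      (use sums_single[of 0 "\<lambda>_. h 0"] in \<open>simp add: if_distrib[of "\<lambda>x. x * _"] cong: if_cong\<close>)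
  moreover have "norm (h 0) \<le> B" using assms(2) by (intro assms(3)) simp
  ultimately show ?thesis using True by (simp add: power_0_left)
next
  case False
  define R where "R = r / norm z"
  have "R > 0" using False assms(2) by (simp add: R_def)
  have "norm ((deriv ^^ m) (\<lambda>t. h (t *s z)) 0) \<le> fact m * B / R ^ m"
  proof (rule Cauchy_inequality)
    show "(\<lambda>t. h (t *s z)) holomorphic_on ball 0 R" by (rule line_holomorphicD(2)[OF assms(1)])
    show "continuous_on (cball 0 R) (\<lambda>t. h (t *s z))"
      by (intro holomorphic_on_imp_continuous_on line_holomorphicD(2)[OF assms(1)])
    show "norm (h (x *s z)) \<le> B" if "norm (0 - x) = R" for x
      using that False by (intro assms(3)) (simp add: norm_scalar_mult_vec R_def)
  qed (rule \<open>R > 0\<close>)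
  then have "norm (hom_coeff h m z) \<le> B / R ^ m"
    by (simp add: hom_coeff_def norm_divide field_simps)
  then show ?thesis by (simp add: R_def power_divide field_simps)
qed

lemma hom_coeff_tail:
  assumes "line_holomorphic h" "r > 0" "\<And>w. norm w \<le> r \<Longrightarrow> norm (h w) \<le> B" "norm z < r"
  shows "norm (h z - (\<Sum>l<N. hom_coeff h l z)) \<le> B * (norm z / r) ^ N / (1 - norm z / r)"
proof -
  define q where "q = norm z / r"
  have q: "0 \<le> q" "q < 1" using assms(2,4) by (auto simp: q_def)
  have "(\<lambda>l. hom_coeff h (l + N) z) sums (h z - (\<Sum>l<N. hom_coeff h l z))"
    by (rule sums_split_initial_segment[OF hom_coeff_sums_1[OF assms(1)]])
  moreover have "(\<lambda>l. B * q ^ N * q ^ l) sums (B * q ^ N * (1 / (1 - q)))"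
    using q by (intro sums_mult geometric_sums) simp
  moreover have "norm (hom_coeff h (l + N) z) \<le> B * q ^ N * q ^ l" for l
    using hom_coeff_bound[OF assms(1-3), of "l + N" z] by (simp add: q_def power_add mult_ac)
  ultimately have "norm (h z - (\<Sum>l<N. hom_coeff h l z)) \<le> B * q ^ N * (1 / (1 - q))"
    by (rule norm_sums_le)
  then show ?thesis by (simp add: q_def)
qed

text \<open>By induction on \<open>m\<close>: the part of degree \<open>m\<close> is the locally uniform
  limit, as \<open>e\<close> tends to 0, of \<open>e ^ (- m)\<close> times the difference of
  \<open>h (e *s z)\<close> and its homogeneous parts of degree less than \<open>m\<close>. The
  tail estimate makes the convergence uniform.\<close>

lemma hom_coeff_holomorphic_on_lines:
  assumes h: "line_holomorphic h"
  shows "(\<lambda>s. hom_coeff h m (z + s *s v)) holomorphic_on UNIV"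
proof (induction m rule: less_induct)
  case (less m)
  define e where "e = (\<lambda>i. 1 / of_nat (Suc i) :: real)"
  define P where "P = (\<lambda>i s. (of_real (1 / e i)) ^ m *
    (h (of_real (e i) *s (z + s *s v)) - (\<Sum>l<m. hom_coeff h l (z + s *s v) * of_real (e i) ^ l)))"
  have e: "0 < e i" "e i \<le> 1" for i by (auto simp: e_def)
  show ?case
  proof (rule holomorphic_uniform_sequence[of _ P])
    show "P i holomorphic_on UNIV" for i
    proof -
      have "of_real (e i) *s (z + s *s v) = of_real (e i) *s z + s *s (of_real (e i) *s v)" for s
        by (simp add: vector_add_ldistrib vector_smult_assoc mult.commute)
      then have "(\<lambda>s. h (of_real (e i) *s (z + s *s v))) holomorphic_on UNIV"
        using line_holomorphicD(1)[OF h] by presburger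
      then show ?thesis unfolding P_def
        by (intro holomorphic_intros less.IH) auto
    qed
    fix x :: complex
    define \<rho> where "\<rho> = norm z + (norm x + 1) * norm v + 1"
    have "\<rho> > 0" unfolding \<rho>_def by (intro add_nonneg_pos add_nonneg_nonneg mult_nonneg_nonneg) auto
    obtain M where M: "M > 0" "\<And>w. norm w \<le> 2 * \<rho> \<Longrightarrow> norm (h w) \<le> M"
      using line_holomorphic_bounded[OF h] by metis
    have est: "norm (P i s - hom_coeff h m (z + s *s v)) \<le> 2 * M * e i" if "s \<in> cball x 1" for i s
    proof -
      define w where "w = z + s *s v"
      have "norm s \<le> norm x + 1" using that norm_triangle_ineq2[of s x] by (auto simp: dist_norm norm_minus_commute)
      then have w: "norm w \<le> \<rho>" unfolding w_def \<rho>_def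
        by (intro order_trans[OF norm_triangle_ineq] add_mono add_increasing2)
          (auto simp: norm_scalar_mult_vec intro: mult_right_mono)
      have nw: "norm (of_real (e i) *s w) = e i * norm w"
        using e[of i] by (simp add: norm_scalar_mult_vec)
      define q where "q = e i * norm w / (2 * \<rho>)"
      have q: "0 \<le> q" "q \<le> e i / 2" "q \<le> 1 / 2"
      proof -
        show "0 \<le> q" using e[of i] \<open>\<rho> > 0\<close> by (simp add: q_def)
        have "e i * norm w \<le> e i * \<rho>" using w e[of i] by (intro mult_left_mono) auto
        then show "q \<le> e i / 2" using \<open>\<rho> > 0\<close> by (simp add: q_def field_simps)
        then show "q \<le> 1 / 2" using e(2)[of i] by linarith
      qed
      then have "e i * norm w / (2 * \<rho>) < 1" by (simp add: q_def)
      then have lt: "norm (of_real (e i) *s w) < 2 * \<rho>" using \<open>\<rho> > 0\<close> by (simp add: nw)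
      have split: "(\<Sum>l<Suc m. hom_coeff h l (of_real (e i) *s w)) =
          (\<Sum>l<m. hom_coeff h l w * of_real (e i) ^ l) + of_real (e i) ^ m * hom_coeff h m w"
        by (simp add: hom_coeff_scale[OF h] mult.commute)
      have "P i s - hom_coeff h m w = of_real (1 / e i) ^ m *
          (h (of_real (e i) *s w) - (\<Sum>l<Suc m. hom_coeff h l (of_real (e i) *s w)))"
        unfolding split P_def w_def[symmetric] using e[of i] by (simp add: field_simps)
      then have "norm (P i s - hom_coeff h m w) = (1 / e i) ^ m *
          norm (h (of_real (e i) *s w) - (\<Sum>l<Suc m. hom_coeff h l (of_real (e i) *s w)))"
        using e[of i] by (simp add: norm_mult norm_power norm_divide)
      also have "\<dots> \<le> (1 / e i) ^ m * (M * q ^ Suc m / (1 - q))"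
        using hom_coeff_tail[OF h _ M(2) lt, of "Suc m"] \<open>\<rho> > 0\<close> e[of i]
        by (intro mult_left_mono) (auto simp: nw q_def)
      also have "\<dots> \<le> (1 / e i) ^ m * (M * (e i / 2) ^ Suc m / (1 / 2))"
        using q e[of i] M(1)
        by (intro mult_left_mono frac_le power_mono) auto
      also have "\<dots> \<le> (1 / e i) ^ m * (M * (e i) ^ Suc m / (1 / 2))"
        using e[of i] M(1) by (intro mult_left_mono divide_right_mono power_mono) auto
      also have "\<dots> = 2 * M * e i" using e[of i] by (simp add: power_divide)
      finally show ?thesis by (simp add: w_def)
    qed
    have "uniform_limit (cball x 1) P (\<lambda>s. hom_coeff h m (z + s *s v)) sequentially"
    proof (rule uniform_limitI)
      fix \<epsilon> :: real assume "\<epsilon> > 0"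
      have "(\<lambda>i. 2 * M * e i) \<longlonglongrightarrow> 2 * M * 0"
        unfolding e_def by (intro tendsto_intros LIMSEQ_Suc[OF lim_1_over_n])
      then have "\<forall>\<^sub>F i in sequentially. 2 * M * e i < \<epsilon>"
        using \<open>\<epsilon> > 0\<close> by (intro order_tendstoD(2)) auto
      then show "\<forall>\<^sub>F i in sequentially. \<forall>s\<in>cball x 1. dist (P i s) (hom_coeff h m (z + s *s v)) < \<epsilon>"
      proof eventually_elim
        case (elim i)
        show ?case
        proof
          fix s assume "s \<in> cball x 1"
          from est[OF this, of i] elim show "dist (P i s) (hom_coeff h m (z + s *s v)) < \<epsilon>"
            by (simp add: dist_norm)
        qed
      qed
    qed
    then show "\<exists>d. 0 < d \<and> cball x d \<subseteq> UNIV \<and> uniform_limit (cball x d) P (\<lambda>s. hom_coeff h m (z + s *s v)) sequentially"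
      by (intro exI[of _ 1]) auto
  qed auto
qed


section \<open>Polynomial functions of several variables\<close>

lemma poly_space_add:
  assumes "p \<in> poly_space k" "q \<in> poly_space k"
  shows "(\<lambda>z. p z + q z) \<in> poly_space k"
proof -
  obtain c d where "\<And>z. p z = (\<Sum>\<alpha> | (\<Sum>i\<in>UNIV. \<alpha> i) \<le> k. c \<alpha> * (\<Prod>i\<in>UNIV. (z $ i) ^ \<alpha> i))"
    "\<And>z. q z = (\<Sum>\<alpha> | (\<Sum>i\<in>UNIV. \<alpha> i) \<le> k. d \<alpha> * (\<Prod>i\<in>UNIV. (z $ i) ^ \<alpha> i))"
    using assms by (auto simp: poly_space_def)
  then show ?thesis
    by (auto simp: poly_space_def distrib_right sum.distrib intro!: exI[of _ "\<lambda>\<alpha>. c \<alpha> + d \<alpha>"])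
qed

lemma poly_space_cmult:
  assumes "p \<in> poly_space k"
  shows "(\<lambda>z. a * p z) \<in> poly_space k"
proof -
  obtain c where "\<And>z. p z = (\<Sum>\<alpha> | (\<Sum>i\<in>UNIV. \<alpha> i) \<le> k. c \<alpha> * (\<Prod>i\<in>UNIV. (z $ i) ^ \<alpha> i))"
    using assms by (auto simp: poly_space_def)
  then show ?thesis
    by (auto simp: poly_space_def sum_distrib_left mult.assoc intro!: exI[of _ "\<lambda>\<alpha>. a * c \<alpha>"])
qed

lemma poly_space_sum:
  assumes "\<And>i. i \<in> I \<Longrightarrow> p i \<in> poly_space k"
  shows "(\<lambda>z. \<Sum>i\<in>I. p i z) \<in> poly_space k"
proof -
  have 0: "(\<lambda>z. 0) \<in> poly_space k"
    by (auto simp: poly_space_def intro!: exI[of _ "\<lambda>_. 0"])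
  from assms show ?thesis
    by (induction I rule: infinite_finite_induct) (auto simp: 0 intro: poly_space_add)
qed

lemma poly_space_monomial:
  assumes "(\<Sum>i\<in>UNIV. \<alpha> i) \<le> k"
  shows "(\<lambda>z. \<Prod>i\<in>UNIV. (z $ i) ^ \<alpha> i) \<in> poly_space k"
proof -
  have "(\<Sum>\<beta> | (\<Sum>i\<in>UNIV. \<beta> i) \<le> k. (if \<beta> = \<alpha> then 1 else 0) * (\<Prod>i\<in>UNIV. (z $ i) ^ \<beta> i)) =
      (\<Prod>i\<in>UNIV. (z $ i) ^ \<alpha> i)" for z :: "complex ^ 'a"
    using assms by (simp add: if_distrib[of "\<lambda>x. x * _"] sum.delta finite_multi_indices cong: if_cong)
  then show ?thesis
    by (auto simp: poly_space_def intro!: exI[of _ "\<lambda>\<beta>. if \<beta> = \<alpha> then 1 else 0"])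
qed

lemma poly_space_mult:
  assumes "p \<in> poly_space a" "q \<in> poly_space b"
  shows "(\<lambda>z. p z * q z) \<in> poly_space (a + b)"
proof -
  obtain c d where cd: "\<And>z. p z = (\<Sum>\<alpha> | (\<Sum>i\<in>UNIV. \<alpha> i) \<le> a. c \<alpha> * (\<Prod>i\<in>UNIV. (z $ i) ^ \<alpha> i))"
    "\<And>z. q z = (\<Sum>\<alpha> | (\<Sum>i\<in>UNIV. \<alpha> i) \<le> b. d \<alpha> * (\<Prod>i\<in>UNIV. (z $ i) ^ \<alpha> i))"
    using assms by (auto simp: poly_space_def)
  have "p z * q z = (\<Sum>\<alpha> | (\<Sum>i\<in>UNIV. \<alpha> i) \<le> a. \<Sum>\<beta> | (\<Sum>i\<in>UNIV. \<beta> i) \<le> b.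
      (c \<alpha> * d \<beta>) * (\<Prod>i\<in>UNIV. (z $ i) ^ (\<alpha> i + \<beta> i)))" for z
    unfolding cd sum_product power_add prod.distrib by (simp add: mult_ac)
  moreover have "(\<lambda>z. \<Sum>\<alpha> | (\<Sum>i\<in>UNIV. \<alpha> i) \<le> a. \<Sum>\<beta> | (\<Sum>i\<in>UNIV. \<beta> i) \<le> b.
      (c \<alpha> * d \<beta>) * (\<Prod>i\<in>UNIV. (z $ i) ^ (\<alpha> i + \<beta> i))) \<in> poly_space (a + b)"
    by (intro poly_space_sum poly_space_cmult poly_space_monomial) (auto simp: sum.distrib intro: add_mono)
  ultimately show ?thesis by presburger
qed

lemma poly_space_mono:
  assumes "p \<in> poly_space a" "a \<le> b"
  shows "p \<in> poly_space b"
proof -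
  obtain c where c: "p = (\<lambda>z. \<Sum>\<alpha> | (\<Sum>i\<in>UNIV. \<alpha> i) \<le> a. c \<alpha> * (\<Prod>i\<in>UNIV. (z $ i) ^ \<alpha> i))"
    using assms(1) by (auto simp: poly_space_def fun_eq_iff)
  show ?thesis unfolding c using assms(2)
    by (intro poly_space_sum poly_space_cmult poly_space_monomial) auto
qed

lemma poly_space_const: "(\<lambda>z. c) \<in> poly_space k"
  using poly_space_cmult[OF poly_space_monomial[of "\<lambda>_. 0" k], of c] by simp

lemma poly_space_component: "(\<lambda>z. z $ i) \<in> poly_space 1"
proof -
  have "(\<Prod>j\<in>UNIV. (z $ j) ^ (if j = i then 1 else 0)) = z $ i" for z :: "complex ^ 'a"
    by (simp add: if_distrib[of "\<lambda>n. _ ^ n"] prod.delta cong: if_cong)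
  then show ?thesis
    using poly_space_monomial[of "\<lambda>j. if j = i then 1 else 0" 1] by simp
qed

lemma poly_space_affine: "(\<lambda>z. z $ i - c) \<in> poly_space 1"
  using poly_space_add[OF poly_space_component poly_space_const[of "- c"]] by simp

lemma poly_space_prod:
  assumes "\<And>i. i \<in> I \<Longrightarrow> p i \<in> poly_space (d i)" "finite I"
  shows "(\<lambda>z. \<Prod>i\<in>I. p i z) \<in> poly_space (\<Sum>i\<in>I. d i)"
  using assms(2,1) by (induction I rule: finite_induct) (auto intro: poly_space_const poly_space_mult)

lemma poly_space_power: "p \<in> poly_space d \<Longrightarrow> (\<lambda>z. p z ^ j) \<in> poly_space (j * d)"
  by (induction j) (auto intro: poly_space_const poly_space_mult)

lemma poly_space_on_line:
  assumes "p \<in> poly_space k"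
  obtains Q where "degree Q \<le> k" "\<And>t. p (b + t *s v) = poly Q t"
proof -
  obtain c where c: "\<And>z. p z = (\<Sum>\<alpha> | (\<Sum>i\<in>UNIV. \<alpha> i) \<le> k. c \<alpha> * (\<Prod>i\<in>UNIV. (z $ i) ^ \<alpha> i))"
    using assms by (auto simp: poly_space_def)
  define Q where "Q = (\<Sum>\<alpha> | (\<Sum>i\<in>UNIV. \<alpha> i) \<le> k. smult (c \<alpha>) (\<Prod>i\<in>UNIV. [:b $ i, v $ i:] ^ \<alpha> i))"
  have "degree (\<Prod>i\<in>UNIV. [:b $ i, v $ i:] ^ \<alpha> i) \<le> (\<Sum>i\<in>UNIV. \<alpha> i)" for \<alpha>
  proof -
    have "degree (\<Prod>i\<in>UNIV. [:b $ i, v $ i:] ^ \<alpha> i) \<le> (\<Sum>i\<in>UNIV. degree ([:b $ i, v $ i:] ^ \<alpha> i))"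
      using degree_prod_sum_le[OF finite, of "\<lambda>i. [:b $ i, v $ i:] ^ \<alpha> i" UNIV] by (simp add: o_def)
    also have "\<dots> \<le> (\<Sum>i\<in>UNIV. \<alpha> i)"
    proof (rule sum_mono)
      fix i
      have "degree ([:b $ i, v $ i:] ^ \<alpha> i) \<le> degree [:b $ i, v $ i:] * \<alpha> i" by (rule degree_power_le)
      also have "\<dots> \<le> 1 * \<alpha> i" by (rule mult_right_mono) auto
      finally show "degree ([:b $ i, v $ i:] ^ \<alpha> i) \<le> \<alpha> i" by simp
    qed
    finally show ?thesis .
  qed
  then have "degree Q \<le> k"
    unfolding Q_def by (intro degree_sum_le) (auto intro: order_trans[OF degree_smult_le] le_trans simp: finite_multi_indices)
  moreover have "p (b + t *s v) = poly Q t" for t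
    unfolding c Q_def by (simp add: poly_sum poly_prod mult.commute)
  ultimately show thesis using that by blast
qed

lemma poly_space_growth:
  assumes "p \<in> poly_space k"
  obtains C where "C > 0" "\<And>z. norm (p z) \<le> C * (1 + norm z) ^ k"
proof -
  obtain c where c: "\<And>z. p z = (\<Sum>\<alpha> | (\<Sum>i\<in>UNIV. \<alpha> i) \<le> k. c \<alpha> * (\<Prod>i\<in>UNIV. (z $ i) ^ \<alpha> i))"
    using assms by (auto simp: poly_space_def)
  define C where "C = (\<Sum>\<alpha> | (\<Sum>i\<in>(UNIV::'a set). \<alpha> i) \<le> k. norm (c \<alpha>)) + 1"
  have "norm (p z) \<le> C * (1 + norm z) ^ k" for z
  proof -
    have "norm (p z) \<le> (\<Sum>\<alpha> | (\<Sum>i\<in>(UNIV::'a set). \<alpha> i) \<le> k. norm (c \<alpha>) * (1 + norm z) ^ k)"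
      unfolding c
    proof (rule sum_norm_le)
      fix \<alpha> :: "'a \<Rightarrow> nat" assume \<alpha>: "\<alpha> \<in> {\<alpha>. (\<Sum>i\<in>UNIV. \<alpha> i) \<le> k}"
      have "norm (\<Prod>i\<in>UNIV. (z $ i) ^ \<alpha> i) = (\<Prod>i\<in>UNIV. norm (z $ i) ^ \<alpha> i)"
        by (simp add: prod_norm[symmetric] norm_power)
      also have "\<dots> \<le> (\<Prod>i\<in>UNIV. (1 + norm z) ^ \<alpha> i)"
        by (intro prod_mono conjI power_mono)
          (auto intro: add_increasing Finite_Cartesian_Product.norm_nth_le)
      also have "\<dots> = (1 + norm z) ^ (\<Sum>i\<in>UNIV. \<alpha> i)" by (simp add: power_sum)
      also have "\<dots> \<le> (1 + norm z) ^ k" using \<alpha> by (intro power_increasing) auto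
      finally show "norm (c \<alpha> * (\<Prod>i\<in>UNIV. (z $ i) ^ \<alpha> i)) \<le> norm (c \<alpha>) * (1 + norm z) ^ k"
        by (simp add: norm_mult mult_left_mono)
    qed
    also have "\<dots> \<le> C * (1 + norm z) ^ k"
      by (simp add: C_def sum_distrib_right[symmetric] mult_right_mono)
    finally show ?thesis .
  qed
  moreover have "C > 0" unfolding C_def by (intro add_nonneg_pos sum_nonneg) auto
  ultimately show thesis using that by blast
qed

lemma poly_space_line_holomorphic:
  assumes "p \<in> poly_space k"
  shows "line_holomorphic p"
proof -
  obtain c where c: "p = (\<lambda>z. \<Sum>\<alpha> | (\<Sum>i\<in>UNIV. \<alpha> i) \<le> k. c \<alpha> * (\<Prod>i\<in>UNIV. (z $ i) ^ \<alpha> i))"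
    using assms by (auto simp: poly_space_def fun_eq_iff)
  show ?thesis unfolding c by (intro line_holomorphic_intros)
qed

text \<open>The monomials are sorted by their exponent in the additional variable.\<close>

lemma poly_space_option_decompose:
  fixes g :: "complex ^ 'n::finite option \<Rightarrow> complex"
  assumes "g \<in> poly_space k"
  obtains B :: "nat \<Rightarrow> complex ^ 'n::finite \<Rightarrow> complex" where "\<And>j. B j \<in> poly_space k"
    "\<And>z w. g (\<chi> j. case j of None \<Rightarrow> w | Some i \<Rightarrow> z $ i) = (\<Sum>j\<le>k. B j z * w ^ j)"
proof -
  obtain c where c: "\<And>z. g z = (\<Sum>\<alpha> | (\<Sum>i\<in>UNIV. \<alpha> i) \<le> k. c \<alpha> * (\<Prod>i\<in>UNIV. (z $ i) ^ \<alpha> i))"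
    using assms by (auto simp: poly_space_def)
  let ?S = "{\<alpha> :: 'n::finite option \<Rightarrow> nat. (\<Sum>i\<in>UNIV. \<alpha> i) \<le> k}"
  have sum_opt: "(\<Sum>i\<in>UNIV. \<alpha> i) = \<alpha> None + (\<Sum>i\<in>UNIV. \<alpha> (Some i))" for \<alpha> :: "'n::finite option \<Rightarrow> nat"
    by (simp add: UNIV_option_conv sum.reindex)
  have prod_opt: "(\<Prod>i\<in>UNIV. a i) = a None * (\<Prod>i\<in>UNIV. a (Some i))" for a :: "'n::finite option \<Rightarrow> complex"
    by (simp add: UNIV_option_conv prod.reindex)
  define B where "B = (\<lambda>j z. \<Sum>\<alpha>\<in>{\<alpha>\<in>?S. \<alpha> None = j}. c \<alpha> * (\<Prod>i\<in>UNIV. ((z::complex^'n) $ i) ^ \<alpha> (Some i)))"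
  show thesis
  proof (rule that)
    show "B j \<in> poly_space k" for j
      unfolding B_def by (intro poly_space_sum poly_space_cmult poly_space_monomial) (auto simp: sum_opt)
    fix z :: "complex ^ 'n" and w
    have "(\<Sum>j\<le>k. B j z * w ^ j) =
        (\<Sum>j\<le>k. \<Sum>\<alpha>\<in>{\<alpha>\<in>?S. \<alpha> None = j}. c \<alpha> * (w ^ \<alpha> None * (\<Prod>i\<in>UNIV. (z $ i) ^ \<alpha> (Some i))))"
      unfolding B_def sum_distrib_right by (intro sum.cong refl) (auto simp: mult_ac)
    also have "\<dots> = (\<Sum>\<alpha>\<in>?S. c \<alpha> * (w ^ \<alpha> None * (\<Prod>i\<in>UNIV. (z $ i) ^ \<alpha> (Some i))))"
      by (rule sum.group[OF finite_multi_indices]) (auto simp: sum_opt)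
    also have "\<dots> = g (\<chi> j. case j of None \<Rightarrow> w | Some i \<Rightarrow> z $ i)"
      unfolding c prod_opt by simp
    finally show "g (\<chi> j. case j of None \<Rightarrow> w | Some i \<Rightarrow> z $ i) = (\<Sum>j\<le>k. B j z * w ^ j)" ..
  qed
qed

lemma polynomial_fun_add: "polynomial_fun p \<Longrightarrow> polynomial_fun q \<Longrightarrow> polynomial_fun (\<lambda>z. p z + q z)"
  unfolding polynomial_fun_def by (metis poly_space_add poly_space_mono max.cobounded1 max.cobounded2)

lemma polynomial_fun_mult: "polynomial_fun p \<Longrightarrow> polynomial_fun q \<Longrightarrow> polynomial_fun (\<lambda>z. p z * q z)"
  unfolding polynomial_fun_def using poly_space_mult by blast

lemma polynomial_fun_const: "polynomial_fun (\<lambda>z. c)"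
  unfolding polynomial_fun_def using poly_space_const by blast

lemma polynomial_fun_sum:
  "(\<And>i. i \<in> I \<Longrightarrow> polynomial_fun (p i)) \<Longrightarrow> polynomial_fun (\<lambda>z. \<Sum>i\<in>I. p i z)"
  by (induction I rule: infinite_finite_induct) (auto intro: polynomial_fun_const polynomial_fun_add)

lemma polynomial_fun_prod:
  "(\<And>i. i \<in> I \<Longrightarrow> polynomial_fun (p i)) \<Longrightarrow> polynomial_fun (\<lambda>z. \<Prod>i\<in>I. p i z)"
  by (induction I rule: infinite_finite_induct) (auto intro: polynomial_fun_const polynomial_fun_mult)

definition vec_update :: "complex ^ 'n \<Rightarrow> 'n \<Rightarrow> complex \<Rightarrow> complex ^ 'n" where
  "vec_update z i s = (\<chi> j. if j = i then s else z $ j)"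

text \<open>A bound on the degree in each variable separately is what Liouville's theorem yields for
  functions of polynomial growth.\<close>

definition separately_polynomial :: "nat \<Rightarrow> (complex ^ 'n \<Rightarrow> complex) \<Rightarrow> bool" where
  "separately_polynomial D F \<longleftrightarrow>
     (\<forall>z i. \<exists>q. degree q \<le> D \<and> (\<forall>s. F (vec_update z i s) = poly q s))"

lemma vec_update_line: "vec_update z i s = vec_update z i 0 + s *s axis i 1"
  by (simp add: vec_update_def vec_eq_iff axis_def)

lemma separately_polynomial_of_growth:
  fixes F :: "complex ^ 'n \<Rightarrow> complex"
  assumes "\<And>z v. (\<lambda>s. F (z + s *s v)) holomorphic_on UNIV"
    and "\<And>z. norm (F z) \<le> C * (1 + norm z) ^ D"
  shows "separately_polynomial D F"
  unfolding separately_polynomial_def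
proof (intro allI)
  fix z :: "complex ^ 'n" and i
  let ?\<phi> = "\<lambda>s. F (vec_update z i s)"
  let ?z0 = "vec_update z i 0"
  have hol: "?\<phi> holomorphic_on UNIV"
  proof -
    have "?\<phi> = (\<lambda>s. F (?z0 + s *s axis i 1))"
      by (rule ext) (rule arg_cong[OF vec_update_line])
    then show ?thesis using assms(1) by presburger
  qed
  have C0: "0 \<le> C" using order_trans[OF norm_ge_zero assms(2)[of 0]] by simp
  define a where "a = (\<lambda>l. (deriv ^^ l) ?\<phi> 0 / fact l)"
  have "?\<phi> s = (\<Sum>l\<le>D. a l * s ^ l)" for s
    unfolding a_def
  proof (rule Liouville_polynomial[OF hol])
    fix s :: complex assume s: "1 \<le> norm s"
    have "norm (?\<phi> s) \<le> C * (1 + norm (vec_update z i s)) ^ D" by (rule assms(2))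
    also have "\<dots> \<le> C * ((2 + norm ?z0) * norm s) ^ D"
    proof (intro mult_left_mono power_mono C0)
      have "norm (vec_update z i s) \<le> norm ?z0 + norm s"
        unfolding vec_update_line[of z i s]
        by (rule order_trans[OF norm_triangle_ineq]) (simp add: norm_scalar_mult_vec)
      also have "norm ?z0 \<le> norm ?z0 * norm s" using s by (simp add: mult_le_cancel_left1)
      finally show "1 + norm (vec_update z i s) \<le> (2 + norm ?z0) * norm s"
        using s by (simp add: algebra_simps)
    qed simp
    finally show "norm (?\<phi> s) \<le> C * (2 + norm ?z0) ^ D * norm s ^ D"
      by (simp add: power_mult_distrib)
  qed
  then have "?\<phi> s = poly (\<Sum>l\<le>D. monom (a l) l) s" for s
    by (simp add: poly_sum poly_monom)
  moreover have "degree (\<Sum>l\<le>D. monom (a l) l) \<le> D"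
    by (intro degree_sum_le) (auto intro: order_trans[OF degree_monom_le])
  ultimately show "\<exists>q. degree q \<le> D \<and> (\<forall>s. ?\<phi> s = poly q s)" by blast
qed

text \<open>Lagrange interpolation at the nodes \<open>0, \<dots>, D\<close>, performed in one variable
  after the other, expresses \<open>F\<close> through finitely many of its values.\<close>

lemma separately_polynomial_imp_polynomial_fun:
  fixes F :: "complex ^ 'n \<Rightarrow> complex"
  assumes "separately_polynomial D F"
  shows "polynomial_fun F"
proof -
  define S where "S = (of_nat ` {..D} :: complex set)"
  have S: "finite S" "card S = Suc D" by (auto simp: S_def card_image inj_on_def)
  have "polynomial_fun (\<lambda>z. F (\<chi> j. if j \<in> I then z $ j else y $ j))" if "finite I" for I y
    using that
  proof (induction I arbitrary: y rule: finite_induct)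
    case empty
    then show ?case by (simp add: polynomial_fun_const)
  next
    case (insert i I)
    let ?v = "\<lambda>z x. \<chi> j. if j \<in> I then z $ j else vec_update y i x $ j"
    have "F (\<chi> j. if j \<in> insert i I then z $ j else y $ j) =
      (\<Sum>x\<in>S. F (?v z x) * (\<Prod>x'\<in>S - {x}. (z $ i - x') * (1 / (x - x'))))" for z
    proof -
      let ?b = "\<chi> j. if j \<in> I then z $ j else y $ j"
      obtain q where q: "degree q \<le> D" "\<And>s. F (vec_update ?b i s) = poly q s"
        using assms unfolding separately_polynomial_def by blast
      have upd: "vec_update ?b i x = (?v z x)" for x
        using insert.hyps by (auto simp: vec_update_def vec_eq_iff)
      have "(\<chi> j. if j \<in> insert i I then z $ j else y $ j) = vec_update ?b i (z $ i)"
        by (auto simp: vec_update_def vec_eq_iff)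
      then have "F (\<chi> j. if j \<in> insert i I then z $ j else y $ j) = poly q (z $ i)"
        using q(2) by simp
      also have "\<dots> = (\<Sum>x\<in>S. poly q x * (\<Prod>x'\<in>S - {x}. (z $ i - x') / (x - x')))"
        using q(1) S by (intro lagrange_interpolation) auto
      also have "\<dots> = (\<Sum>x\<in>S. F (?v z x) * (\<Prod>x'\<in>S - {x}. (z $ i - x') * (1 / (x - x'))))"
        unfolding q(2)[symmetric] upd by simp
      finally show ?thesis .
    qed
    moreover have "polynomial_fun (\<lambda>z. \<Sum>x\<in>S. F (?v z x) * (\<Prod>x'\<in>S - {x}. (z $ i - x') * (1 / (x - x'))))"
      using poly_space_affine
      by (intro polynomial_fun_sum polynomial_fun_mult polynomial_fun_prod insert.IH polynomial_fun_const)
        (auto simp: polynomial_fun_def)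
    ultimately show ?case by presburger
  qed
  from this[of UNIV] show ?thesis by simp
qed

lemma separately_polynomial_eq_0_of_grid:
  fixes F :: "complex ^ 'n \<Rightarrow> complex" and z :: "complex ^ 'n"
  assumes "separately_polynomial D F" "D < N"
    and grid: "\<And>z :: complex ^ 'n. z $ i0 = 1 \<Longrightarrow> (\<And>i. i \<noteq> i0 \<Longrightarrow> z $ i \<in> of_nat ` {..<N}) \<Longrightarrow> F z = 0"
    and "z $ i0 = 1"
  shows "F z = 0"
proof -
  have "\<forall>z :: complex ^ 'n. z $ i0 = 1 \<longrightarrow> (\<forall>i. i \<noteq> i0 \<longrightarrow> i \<notin> I \<longrightarrow> z $ i \<in> of_nat ` {..<N}) \<longrightarrow> F z = 0"
    if "finite I" for I
    using that
  proof (induction I rule: finite_induct)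
    case empty
    then show ?case using grid by auto
  next
    case (insert i I)
    show ?case
    proof (intro allI impI)
      fix z :: "complex ^ 'n" assume z: "z $ i0 = 1" "\<forall>j. j \<noteq> i0 \<longrightarrow> j \<notin> insert i I \<longrightarrow> z $ j \<in> of_nat ` {..<N}"
      show "F z = 0"
      proof (cases "i = i0")
        case True
        then show ?thesis using insert.IH z by auto
      next
        case False
        obtain q where q: "degree q \<le> D" "\<And>s. F (vec_update z i s) = poly q s"
          using assms(1) unfolding separately_polynomial_def by blast
        have "poly q s = poly 0 s" if "s \<in> of_nat ` {..<N}" for s
          using insert.IH z False that unfolding q(2)[symmetric] by (auto simp: vec_update_def)
        then have "q = 0"
          using q(1) assms(2) by (intro poly_eqI_degree[of "of_nat ` {..<N}"]) (auto simp: card_image inj_on_def)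
        moreover have "vec_update z i (z $ i) = z" by (simp add: vec_update_def vec_eq_iff)
        ultimately show ?thesis using q(2)[of "z $ i"] by simp
      qed
    qed
  qed
  from this[of UNIV] assms(4) show ?thesis by simp
qed

text \<open>Homogeneity bounds the part of degree \<open>m\<close> by a multiple of \<open>norm z ^
  m\<close>, so Liouville's theorem applies in each variable.\<close>

lemma hom_coeff_separately_polynomial:
  assumes "line_holomorphic h"
  shows "separately_polynomial m (hom_coeff h m)"
proof -
  obtain M where M: "M > 0" "\<And>z. norm z \<le> 1 \<Longrightarrow> norm (h z) \<le> M"
    using line_holomorphic_bounded[OF assms] by metis
  show ?thesis
  proof (rule separately_polynomial_of_growth)
    show "(\<lambda>s. hom_coeff h m (z + s *s v)) holomorphic_on UNIV" for z v
      by (rule hom_coeff_holomorphic_on_lines[OF assms])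
    show "norm (hom_coeff h m z) \<le> M * (1 + norm z) ^ m" for z
      by (rule order_trans[OF hom_coeff_bound[OF assms _ M(2)]])
        (use M(1) in \<open>auto intro!: mult_left_mono power_mono\<close>)
  qed
qed


section \<open>Lower bound: restrictions vanishing to high order\<close>

text \<open>The real-valued form of \<open>max_mod\<close>, which is finite for the functions considered
  here.\<close>

definition mod_sup :: "(complex ^ 'n \<Rightarrow> complex) \<Rightarrow> real \<Rightarrow> real" where
  "mod_sup h r = real_of_ereal (max_mod h r)"

lemma mod_sup_facts:
  assumes "line_holomorphic h" "r > 0"
  shows max_mod_eq_mod_sup: "max_mod h r = ereal (mod_sup h r)"
    and norm_le_mod_sup: "norm z < r \<Longrightarrow> norm (h z) \<le> mod_sup h r"
    and mod_sup_le: "(\<And>z. norm z < r \<Longrightarrow> norm (h z) \<le> B) \<Longrightarrow> mod_sup h r \<le> B"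
    and mod_sup_nonneg: "0 \<le> mod_sup h r"
proof -
  obtain M where M: "\<And>z. norm z \<le> r \<Longrightarrow> norm (h z) \<le> M"
    using line_holomorphic_bounded[OF assms(1)] by metis
  have "max_mod h r \<le> ereal M" unfolding max_mod_def by (rule SUP_least) (use M in auto)
  moreover have ge: "ereal (norm (h z)) \<le> max_mod h r" if "norm z < r" for z
    unfolding max_mod_def using that by (intro SUP_upper) auto
  moreover have "0 \<le> max_mod h r"
    using ge[of 0] assms(2) by (metis ereal_less_eq(3) norm_ge_zero norm_zero order_trans zero_ereal_def)
  ultimately have "\<bar>max_mod h r\<bar> \<noteq> \<infinity>" by auto
  then show eq: "max_mod h r = ereal (mod_sup h r)" by (simp add: mod_sup_def ereal_real)
  show "norm z < r \<Longrightarrow> norm (h z) \<le> mod_sup h r" using ge[of z] eq by simp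
  show "0 \<le> mod_sup h r" using \<open>0 \<le> max_mod h r\<close> eq by simp
  assume "\<And>z. norm z < r \<Longrightarrow> norm (h z) \<le> B"
  then have "max_mod h r \<le> ereal B" unfolding max_mod_def by (intro SUP_least) auto
  then show "mod_sup h r \<le> B" using eq by simp
qed

text \<open>Gaussian elimination: one equation with a non-zero coefficient is solved for the corresponding
  unknown.\<close>

lemma homogeneous_system_nontrivial_solution:
  fixes A :: "'e \<Rightarrow> 'u \<Rightarrow> complex"
  assumes "finite E" "finite U" "card E < card U"
  shows "\<exists>c. (\<exists>u\<in>U. c u \<noteq> 0) \<and> (\<forall>e\<in>E. (\<Sum>u\<in>U. c u * A e u) = 0)"
  using assms
proof (induction E arbitrary: A U rule: finite_induct)
  case empty
  then show ?case by (intro exI[of _ "\<lambda>_. 1"]) (auto simp: card_gt_0_iff)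
next
  case (insert e E)
  show ?case
  proof (cases "\<forall>u\<in>U. A e u = 0")
    case True
    have "card E < card U" using insert.prems insert.hyps by simp
    with insert.IH[OF insert.prems(1)] obtain c where
      "\<exists>u\<in>U. c u \<noteq> 0" "\<forall>e\<in>E. (\<Sum>u\<in>U. c u * A e u) = 0" by blast
    then show ?thesis using True by (intro exI[of _ c]) auto
  next
    case False
    then obtain u0 where u0: "u0 \<in> U" "A e u0 \<noteq> 0" by auto
    define U' where "U' = U - {u0}"
    define A' where "A' = (\<lambda>e' u. A e' u - A e' u0 * A e u / A e u0)"
    have "finite U'" "card E < card U'"
      using insert.prems insert.hyps u0 by (auto simp: U'_def)
    with insert.IH obtain c where c: "\<exists>u\<in>U'. c u \<noteq> 0" "\<And>e'. e' \<in> E \<Longrightarrow> (\<Sum>u\<in>U'. c u * A' e' u) = 0"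
      by blast
    (* The value at u0 is the one that satisfies the equation e. *)
  define c' where "c' = c(u0 := - (\<Sum>u\<in>U'. c u * A e u) / A e u0)"
    have sum_c': "(\<Sum>u\<in>U. c' u * X u) = c' u0 * X u0 + (\<Sum>u\<in>U'. c u * X u)" for X
    proof -
      have "(\<Sum>u\<in>U. c' u * X u) = c' u0 * X u0 + (\<Sum>u\<in>U'. c' u * X u)"
        unfolding U'_def using u0 insert.prems by (intro sum.remove) auto
      also have "(\<Sum>u\<in>U'. c' u * X u) = (\<Sum>u\<in>U'. c u * X u)"
        by (intro sum.cong) (auto simp: c'_def U'_def)
      finally show ?thesis .
    qed
    have "(\<Sum>u\<in>U. c' u * A e u) = 0"
      unfolding sum_c' using u0 by (simp add: c'_def)
    moreover have "(\<Sum>u\<in>U. c' u * A e' u) = 0" if "e' \<in> E" for e'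
    proof -
      have "0 = (\<Sum>u\<in>U'. c u * A' e' u)" using c(2)[OF that] by simp
      also have "\<dots> = (\<Sum>u\<in>U'. c u * A e' u) - (\<Sum>u\<in>U'. c u * A e u) * (A e' u0 / A e u0)"
        unfolding A'_def sum_distrib_right sum_subtractf[symmetric]
        by (intro sum.cong) (auto simp: algebra_simps)
      also have "\<dots> = (\<Sum>u\<in>U. c' u * A e' u)"
        unfolding sum_c' by (simp add: c'_def)
      finally show ?thesis ..
    qed
    moreover have "\<exists>u\<in>U. c' u \<noteq> 0" using c(1) by (auto simp: c'_def U'_def)
    ultimately show ?thesis by (intro exI[of _ c']) auto
  qed
qed

text \<open>By homogeneity it is enough to know the part of degree \<open>m\<close> on the hyperplane where
  the coordinate \<open>i0\<close> equals 1, and there it is determined by its values on a grid of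
  \<open>N ^ (n - 1)\<close> points. Vanishing to order \<open>N\<close> at 0 thus costs only
  \<open>N ^ n\<close> linear conditions. The points with coordinate \<open>i0\<close> equal to 0
  are reached along lines.\<close>

lemma hom_coeff_eq_0_of_grid:
  fixes h :: "complex ^ 'n \<Rightarrow> complex" and z :: "complex ^ 'n"
  assumes h: "line_holomorphic h" and "m < N"
    and grid: "\<And>z :: complex ^ 'n. z $ i0 = 1 \<Longrightarrow> (\<And>i. i \<noteq> i0 \<Longrightarrow> z $ i \<in> of_nat ` {..<N}) \<Longrightarrow> hom_coeff h m z = 0"
  shows "hom_coeff h m z = 0"
proof -
  have 1: "hom_coeff h m z = 0" if "z $ i0 \<noteq> 0" for z
  proof -
    have "hom_coeff h m (inverse (z $ i0) *s z) = 0"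
      by (rule separately_polynomial_eq_0_of_grid[OF hom_coeff_separately_polynomial[OF h] \<open>m < N\<close> grid, where ?i0.0 = i0])
        (use that in auto)
    then show ?thesis using that by (simp add: hom_coeff_scale[OF h])
  qed
  show ?thesis
  proof (cases "z $ i0 = 0")
    case True
    have "hom_coeff h m (z + 0 *s axis i0 1) = 0"
    proof (rule holomorphic_vanishes_at_puncture[OF hom_coeff_holomorphic_on_lines[OF h]])
      show "hom_coeff h m (z + s *s axis i0 1) = 0" if "s \<in> UNIV - {0}" for s
        by (rule 1) (use that True in \<open>simp add: axis_def\<close>)
    qed auto
    then show ?thesis by simp
  qed (rule 1)
qed

lemma poly_bounded_below_at_infinity:
  fixes p :: "complex poly"
  assumes "p \<noteq> 0"
  obtains c R where "c > 0" "\<And>t. R \<le> norm t \<Longrightarrow> c \<le> norm (poly p t)"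
proof (cases p)
  case (pCons a q)
  show thesis
  proof (cases "q = 0")
    case True
    then show thesis using that[of "norm a" 0] pCons assms by auto
  next
    case False
    then show thesis using poly_infinity[OF False, of 1 a] that[of 1] pCons by auto
  qed
qed

text \<open>Cauchy's bound for the zeros of a polynomial.\<close>

lemma norm_root_le:
  fixes w :: complex
  assumes "(\<Sum>j\<le>d. a j * w ^ j) = 0" "a d \<noteq> 0"
  shows "norm w \<le> 1 + (\<Sum>j<d. norm (a j)) / norm (a d)"
proof (cases "norm w \<le> 1")
  case True
  then show ?thesis by (simp add: sum_nonneg add_increasing2)
next
  case False
  have "d \<noteq> 0" using assms by (intro notI) simp
  have "a d * w ^ d = - (\<Sum>j<d. a j * w ^ j)"
    using assms(1) by (simp add: lessThan_Suc_atMost[symmetric] eq_neg_iff_add_eq_0 add.commute)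
  then have "norm (a d) * norm w ^ d = norm (\<Sum>j<d. a j * w ^ j)"
    by (metis norm_minus_cancel norm_mult norm_power)
  also have "\<dots> \<le> (\<Sum>j<d. norm (a j) * norm w ^ (d - 1))"
    using False by (intro sum_norm_le) (auto simp: norm_mult norm_power intro!: mult_left_mono power_increasing)
  also have "\<dots> = (\<Sum>j<d. norm (a j)) * norm w ^ (d - 1)" by (simp add: sum_distrib_right)
  finally have "norm (a d) * norm w * norm w ^ (d - 1) \<le> (\<Sum>j<d. norm (a j)) * norm w ^ (d - 1)"
    using \<open>d \<noteq> 0\<close> by (simp add: power_eq_if[of _ d] mult.assoc)
  then have "norm (a d) * norm w \<le> (\<Sum>j<d. norm (a j))"
    by (rule mult_right_le_imp_le) (rule zero_less_power, use False in linarith)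
  then have "norm w \<le> (\<Sum>j<d. norm (a j)) / norm (a d)" using assms(2) by (simp add: field_simps)
  then show ?thesis by simp
qed

text \<open>On a line through 0 on which the leading coefficient \<open>A d\<close> is not identically zero,
  the equation forces \<open>f\<close> to grow at most like the power \<open>k\<close>, hence the
  homogeneous parts of degree above \<open>k\<close> vanish there. Such lines are dense, so these
  parts vanish everywhere.\<close>

lemma algebraic_line_holomorphic_imp_polynomial:
  assumes f: "line_holomorphic f" and A: "\<And>j. A j \<in> poly_space k"
    and nz: "A d v0 \<noteq> 0" and eq: "\<And>z. (\<Sum>j\<le>d. A j z * f z ^ j) = 0"
  shows "polynomial_fun f"
proof -
  have generic: "hom_coeff f m v = 0" if m: "m > k" and v: "A d v \<noteq> 0" for m v
  proof -
    let ?\<phi> = "\<lambda>t. f (t *s v)"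
    have hol: "?\<phi> holomorphic_on UNIV" by (rule line_holomorphicD(2)[OF f])
    obtain Q where Q: "\<And>t. A d (0 + t *s v) = poly Q t" using poly_space_on_line[OF A] by metis
    have "poly Q 1 \<noteq> 0" using Q[of 1] v by simp
    then have "Q \<noteq> 0" by auto
    then obtain c R where c: "c > 0" "\<And>t. R \<le> norm t \<Longrightarrow> c \<le> norm (poly Q t)"
      using poly_bounded_below_at_infinity by blast
    have "\<forall>j. \<exists>C>0. \<forall>z. norm (A j z) \<le> C * (1 + norm z) ^ k"
      using poly_space_growth[OF A] by metis
    then obtain C where C: "\<And>j. C j > 0" "\<And>j z. norm (A j z) \<le> C j * (1 + norm z) ^ k" by metis
    define B where "B = 1 + (\<Sum>j<d. C j) * (1 + norm v) ^ k / c"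
    have growth: "norm (?\<phi> t) \<le> B * norm t ^ k" if t: "max R 1 \<le> norm t" for t
    proof -
      have ct: "c \<le> norm (A d (t *s v))" using c(2)[of t] Q[of t] t by simp
      have Aj: "norm (A j (t *s v)) \<le> C j * ((1 + norm v) ^ k * norm t ^ k)" for j
      proof -
        have "1 + norm (t *s v) \<le> (1 + norm v) * norm t"
          using t by (simp add: norm_scalar_mult_vec algebra_simps)
        then have "(1 + norm (t *s v)) ^ k \<le> ((1 + norm v) * norm t) ^ k" by (intro power_mono) auto
        then show ?thesis using C(1)[of j]
          by (intro order_trans[OF C(2)] mult_left_mono) (auto simp: power_mult_distrib)
      qed
      have "norm (?\<phi> t) \<le> 1 + (\<Sum>j<d. norm (A j (t *s v))) / norm (A d (t *s v))"
        by (rule norm_root_le[of "\<lambda>j. A j (t *s v)", OF eq]) (use ct c(1) in auto)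
      also have "\<dots> \<le> 1 + (\<Sum>j<d. C j * ((1 + norm v) ^ k * norm t ^ k)) / c"
        using ct c(1) Aj C(1)
        by (intro add_left_mono frac_le sum_mono sum_nonneg) (auto intro!: mult_nonneg_nonneg intro: less_imp_le)
      also have "\<dots> \<le> norm t ^ k + (\<Sum>j<d. C j * ((1 + norm v) ^ k * norm t ^ k)) / c"
        using t by (intro add_right_mono one_le_power) auto
      also have "\<dots> = B * norm t ^ k"
        by (simp add: B_def sum_distrib_right[symmetric] algebra_simps)
      finally show ?thesis .
    qed
    have pol: "?\<phi> t = (\<Sum>l\<le>k. hom_coeff f l v * t ^ l)" for t
      unfolding hom_coeff_def by (rule Liouville_polynomial[OF hol growth])
    have "hom_coeff f m v = (if m \<in> {..k} then hom_coeff f m v else 0)"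
    proof (rule hom_coeff_eqI[OF f])
      fix t
      have "(\<lambda>l. if l \<in> {..k} then hom_coeff f l v * t ^ l else 0) sums (\<Sum>l\<in>{..k}. hom_coeff f l v * t ^ l)"
        by (rule sums_If_finite_set) simp
      also have "(\<lambda>l. if l \<in> {..k} then hom_coeff f l v * t ^ l else 0) =
          (\<lambda>l. (if l \<in> {..k} then hom_coeff f l v else 0) * t ^ l)" by auto
      finally show "(\<lambda>l. (if l \<in> {..k} then hom_coeff f l v else 0) * t ^ l) sums f (t *s v)"
        using pol by simp
    qed
    then show ?thesis using m by simp
  qed
  have Ad: "line_holomorphic (A d)" by (rule poly_space_line_holomorphic[OF A])
  have all: "hom_coeff f m w = 0" if m: "m > k" for m w
  proof (cases "A d w = 0")
    case True
    let ?a = "\<lambda>s. A d (w + s *s (v0 - w))"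
    have hol: "?a holomorphic_on UNIV" by (rule line_holomorphicD(1)[OF Ad])
    have a0: "?a 0 = 0" and a1: "?a 1 \<noteq> 0" using True nz by simp_all
    obtain r where "0 < r" and r: "\<And>s. s \<in> ball 0 r - {0} \<Longrightarrow> ?a s \<noteq> 0"
      using isolated_zeros[OF hol open_UNIV connected_UNIV UNIV_I a0 UNIV_I a1] by metis
    have "hom_coeff f m (w + 0 *s (v0 - w)) = 0"
    proof (rule holomorphic_vanishes_at_puncture[of "\<lambda>s. hom_coeff f m (w + s *s (v0 - w))" "ball 0 r" 0])
      show "(\<lambda>s. hom_coeff f m (w + s *s (v0 - w))) holomorphic_on ball 0 r"
        by (rule holomorphic_on_subset[OF hom_coeff_holomorphic_on_lines[OF f]]) simp
    qed (use \<open>0 < r\<close> r generic[OF m] in auto)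
    then show ?thesis by simp
  qed (rule generic[OF m])
  have "f z = (\<Sum>m\<le>k. hom_coeff f m z)" for z
    using sums_unique2[OF hom_coeff_sums_1[OF f] sums_finite[of "{..k}" "\<lambda>m. hom_coeff f m z"]] all
    by (simp add: not_le)
  then have "f = (\<lambda>z. \<Sum>m\<le>k. hom_coeff f m z)" by (rule ext)
  moreover have "polynomial_fun (\<lambda>z. \<Sum>m\<le>k. hom_coeff f m z)"
    using separately_polynomial_imp_polynomial_fun[OF hom_coeff_separately_polynomial[OF f]]
    by (intro polynomial_fun_sum) simp
  ultimately show ?thesis by simp
qed

lemma line_holomorphic_eq_0_of_ball:
  assumes h: "line_holomorphic h" and "\<And>z. norm z < 1 \<Longrightarrow> h z = 0"
  shows "h z = 0"
proof -
  have "norm (hom_coeff h m z) \<le> 0 * (norm z / (1 / 2)) ^ m" for m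
    by (rule hom_coeff_bound[OF h]) (use assms(2) in auto)
  then have "(\<lambda>m. hom_coeff h m z) = (\<lambda>_. 0)" by simp
  then have "(\<lambda>_. 0) sums h z" using hom_coeff_sums_1[OF h, of z] by simp
  then show ?thesis by (rule sums_unique2[OF _ sums_zero])
qed

text \<open>The radius 2 lies strictly between 1 and \<open>exp 1\<close>; Cauchy's estimates on it give the
  factor \<open>2 ^ N\<close>, up to the factor 2 from the geometric series.\<close>

lemma mod_sup_lower_of_vanishing:
  assumes h: "line_holomorphic h" and van: "\<And>m z. m < N \<Longrightarrow> hom_coeff h m z = 0"
  shows "2 ^ N * mod_sup h 1 \<le> 2 * mod_sup h (exp 1)"
proof -
  have e2: "2 < exp (1::real)" using exp_lower_Taylor_quadratic[of "1::real"] by simp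
  have "norm (h z) \<le> 2 * mod_sup h (exp 1) / 2 ^ N" if z: "norm z < 1" for z
  proof -
    have B: "norm (h w) \<le> mod_sup h (exp 1)" if "norm w \<le> 2" for w
      using that e2 by (intro norm_le_mod_sup[OF h]) auto
    have "norm (h z - (\<Sum>l<N. hom_coeff h l z)) \<le> mod_sup h (exp 1) * (norm z / 2) ^ N / (1 - norm z / 2)"
      by (rule hom_coeff_tail[OF h]) (use z B in auto)
    also have "\<dots> \<le> mod_sup h (exp 1) * (1 / 2) ^ N / (1 / 2)"
      using z mod_sup_nonneg[OF h, of "exp 1"]
      by (intro frac_le mult_left_mono power_mono mult_nonneg_nonneg) auto
    finally show ?thesis using van by (simp add: power_divide mult.commute)
  qed
  then have "mod_sup h 1 \<le> 2 * mod_sup h (exp 1) / 2 ^ N" by (rule mod_sup_le[OF h zero_less_one])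
  then show ?thesis by (simp add: field_simps)
qed

text \<open>Up to a non-zero factor, the Lagrange basis polynomial of the node \<open>a\<close> of the grid
  \<open>{0..<q} ^ n\<close>.\<close>

definition grid_lagrange :: "nat \<Rightarrow> ('n \<Rightarrow> nat) \<Rightarrow> complex ^ 'n \<Rightarrow> complex" where
  "grid_lagrange q a z = (\<Prod>i\<in>UNIV. \<Prod>b\<in>{..<q} - {a i}. (z $ i - of_nat b))"

lemma grid_lagrange_at_node:
  assumes "\<And>i. a' i < q"
  shows "grid_lagrange q a (\<chi> i. of_nat (a' i)) = 0 \<longleftrightarrow> a \<noteq> a'"
proof -
  have "grid_lagrange q a (\<chi> i. of_nat (a' i)) = 0 \<longleftrightarrow> (\<exists>i. a' i \<noteq> a i)"
    using assms by (auto simp: grid_lagrange_def)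
  also have "\<dots> \<longleftrightarrow> a \<noteq> a'" by (metis ext)
  finally show ?thesis .
qed

text \<open>The functions \<open>grid_lagrange q a z * f z ^ j\<close> span a space with \<open>q ^ (n +
  1)\<close> parameters, more than the \<open>N ^ n\<close> conditions for vanishing to order
  \<open>N\<close> at 0. A non-trivial combination \<open>H\<close> that satisfies them is not the
  zero function, since otherwise \<open>f\<close> would be algebraic; the Lagrange basis makes it
  evident that some coefficient of the algebraic equation is not zero.\<close>

lemma m_fun_lower_bound:
  fixes f :: "complex ^ 'n \<Rightarrow> complex" and N q k :: nat
  assumes f: "line_holomorphic f" and np: "\<not> polynomial_fun f"
    and q: "0 < q" "(CARD('n) + 1) * (q - 1) \<le> k"
    and N: "N ^ CARD('n) < q ^ (CARD('n) + 1)"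
  shows "ereal (real N * ln 2 - ln 2) \<le> m_fun k (exp 1) f"
proof (cases "N = 0")
  case False
  fix i0 :: 'n
  let ?S = "{a :: 'n \<Rightarrow> nat. \<forall>i. a i < q}"
  let ?L = "grid_lagrange q :: ('n \<Rightarrow> nat) \<Rightarrow> complex ^ 'n \<Rightarrow> complex"
  have S: "?S = (\<Pi>\<^sub>E i\<in>UNIV. {..<q})" by (auto simp: PiE_UNIV_domain)
  have finS: "finite ?S" unfolding S by (intro finite_PiE) auto
  have cardS: "card ?S = q ^ CARD('n)" unfolding S by (subst card_PiE) auto
  define U where "U = ?S \<times> {..<q}"
  have U: "finite U" "card U = q ^ (CARD('n) + 1)" using finS cardS by (auto simp: U_def)
  define G where "G = {b :: 'n \<Rightarrow> nat. b i0 = 1 \<and> (\<forall>i. i \<noteq> i0 \<longrightarrow> b i < N)}"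
  have G: "G = (\<Pi>\<^sub>E i\<in>UNIV. if i = i0 then {1} else {..<N})"
    by (auto simp: G_def PiE_UNIV_domain split: if_splits)
  have finG: "finite G" unfolding G by (intro finite_PiE) auto
  have "card G = (\<Prod>i\<in>UNIV. if i = i0 then 1 else N)"
    unfolding G by (subst card_PiE) (auto intro: prod.cong)
  also have "\<dots> = N ^ (CARD('n) - 1)"
    by (subst prod.remove[of _ i0]) (auto simp: card_Diff_singleton)
  finally have cardG: "card G = N ^ (CARD('n) - 1)" .
  define E where "E = G \<times> {..<N}"
  have E: "finite E" "card E = N ^ CARD('n)"
    using finG cardG by (auto simp: E_def power_eq_if[of N "CARD('n)"])
  define h where "h = (\<lambda>(a, j) z. ?L a z * f z ^ j)"
  have lhL: "line_holomorphic (?L a)" for a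
    unfolding grid_lagrange_def by (intro line_holomorphic_intros)
  have hu: "line_holomorphic (h u)" for u
    using line_holomorphic_mult[OF lhL line_holomorphic_power[OF f]]
    unfolding h_def case_prod_beta by presburger
  define V where "V = (\<lambda>(b, m) u. hom_coeff (h u) m (\<chi> i. of_nat (b i)))"
  have "card E < card U" using N E(2) U(2) by simp
  from homogeneous_system_nontrivial_solution[OF E(1) U(1) this, of V]
  obtain c where c: "\<exists>u\<in>U. c u \<noteq> 0" "\<And>e. e \<in> E \<Longrightarrow> (\<Sum>u\<in>U. c u * V e u) = 0" by auto
  define H where "H = (\<lambda>z. \<Sum>u\<in>U. c u * h u z)"
  have lhH: "line_holomorphic H" unfolding H_def
    by (intro line_holomorphic_sum line_holomorphic_mult line_holomorphic_const hu)
  define A where "A = (\<lambda>j z. \<Sum>a\<in>?S. c (a, j) * ?L a z)"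
  have H_A: "H z = (\<Sum>j<q. A j z * f z ^ j)" for z
  proof -
    have "H z = (\<Sum>a\<in>?S. \<Sum>j<q. c (a, j) * (?L a z * f z ^ j))"
      unfolding H_def U_def h_def by (simp add: sum.cartesian_product case_prod_beta)
    also have "\<dots> = (\<Sum>j<q. A j z * f z ^ j)"
      unfolding A_def sum_distrib_right by (subst sum.swap) (simp add: mult.assoc)
    finally show ?thesis .
  qed
  let ?deg = "\<lambda>a. \<Sum>i\<in>(UNIV :: 'n set). \<Sum>b\<in>{..<q} - {a i}. 1"
  have L_poly: "?L a \<in> poly_space (CARD('n) * (q - 1))" if "a \<in> ?S" for a
  proof -
    have "?L a \<in> poly_space (?deg a)"
      unfolding grid_lagrange_def by (intro poly_space_prod poly_space_affine) auto
    also have "(?deg a) = CARD('n) * (q - 1)"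
      using that by simp
    finally show ?thesis .
  qed
  have A_poly: "A j \<in> poly_space (CARD('n) * (q - 1))" for j
    unfolding A_def by (intro poly_space_sum poly_space_cmult L_poly)
  have H_nz: "\<exists>z. H z \<noteq> 0"
  proof (rule ccontr)
    assume "\<not> (\<exists>z. H z \<noteq> 0)"
    then have H0: "H z = 0" for z by simp
    define J where "J = {j. j < q \<and> (\<exists>z. A j z \<noteq> 0)}"
    obtain a j where aj: "a \<in> ?S" "j < q" "c (a, j) \<noteq> 0" using c(1) by (auto simp: U_def)
    let ?pt = "\<chi> i. (of_nat (a i) :: complex)"
    have "A j ?pt = (\<Sum>a'\<in>?S. if a' = a then c (a, j) * ?L a ?pt else 0)"
      unfolding A_def using aj(1) by (intro sum.cong) (auto simp: grid_lagrange_at_node)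
    also have "\<dots> = c (a, j) * ?L a ?pt" using finS aj(1) by simp
    also have "\<dots> \<noteq> 0" using aj by (simp add: grid_lagrange_at_node)
    finally have "j \<in> J" using aj(2) by (auto simp: J_def)
    have "finite J" by (simp add: J_def)
    define d where "d = Max J"
    have d: "d \<in> J" "\<And>j. j \<in> J \<Longrightarrow> j \<le> d"
      using \<open>finite J\<close> \<open>j \<in> J\<close> by (auto simp: d_def intro: Max_in)
    then obtain v0 where v0: "A d v0 \<noteq> 0" "d < q" by (auto simp: J_def)
    have "(\<Sum>j\<le>d. A j z * f z ^ j) = 0" for z
    proof -
      have "(\<Sum>j\<le>d. A j z * f z ^ j) = (\<Sum>j<q. A j z * f z ^ j)"
        using d(2) v0(2) by (intro sum.mono_neutral_left) (auto simp: J_def not_le)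
      then show ?thesis using H0 H_A by simp
    qed
    then have "polynomial_fun f"
      using algebraic_line_holomorphic_imp_polynomial[where A = A and d = d, OF f A_poly v0(1)] by blast
    then show False using np by simp
  qed
  have H_van: "hom_coeff H m z = 0" if "m < N" for m z
  proof (rule hom_coeff_eq_0_of_grid[OF lhH that, where ?i0.0 = i0])
    fix z :: "complex ^ 'n"
    assume z: "z $ i0 = 1" "\<And>i. i \<noteq> i0 \<Longrightarrow> z $ i \<in> of_nat ` {..<N}"
    have "\<forall>i. \<exists>b. z $ i = of_nat b \<and> (i = i0 \<longrightarrow> b = 1) \<and> (i \<noteq> i0 \<longrightarrow> b < N)"
      using z by (metis imageE lessThan_iff of_nat_1)
    then obtain b where b: "\<And>i. z $ i = of_nat (b i)" "b i0 = 1" "\<And>i. i \<noteq> i0 \<Longrightarrow> b i < N" by metis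
    have zb: "z = (\<chi> i. of_nat (b i))" by (simp add: vec_eq_iff b)
    have "(b, m) \<in> E" using b that by (simp add: E_def G_def)
    from c(2)[OF this] show "hom_coeff H m z = 0"
      unfolding H_def zb V_def by (subst hom_coeff_sum) (auto simp: hu)
  qed
  define M where "M = mod_sup H 1"
  have M0: "M > 0"
  proof (rule ccontr)
    assume "\<not> M > 0"
    then have le0: "norm (H z) \<le> 0" if "norm z < 1" for z
      using norm_le_mod_sup[OF lhH zero_less_one that] unfolding M_def by linarith
    have "H z = 0" for z by (rule line_holomorphic_eq_0_of_ball[OF lhH]) (use le0 in simp)
    then show False using H_nz by simp
  qed
  define Hn where "Hn = (\<lambda>z. (1 / of_real M) * H z)"
  have lhHn: "line_holomorphic Hn" unfolding Hn_def
    by (intro line_holomorphic_mult line_holomorphic_const lhH)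
  have Hn_le1: "mod_sup Hn 1 \<le> 1"
    by (rule mod_sup_le[OF lhHn zero_less_one])
      (use M0 norm_le_mod_sup[OF lhH zero_less_one] in \<open>auto simp: Hn_def M_def norm_divide norm_mult field_simps\<close>)
  have "2 ^ N * M \<le> 2 * mod_sup H (exp 1)"
    unfolding M_def by (rule mod_sup_lower_of_vanishing[OF lhH H_van])
  moreover have "mod_sup H (exp 1) \<le> M * mod_sup Hn (exp 1)"
  proof (rule mod_sup_le[OF lhH])
    fix z :: "complex ^ 'n" assume "norm z < exp 1"
    from norm_le_mod_sup[OF lhHn _ this] show "norm (H z) \<le> M * mod_sup Hn (exp 1)"
      using M0 by (simp add: Hn_def norm_divide norm_mult field_simps)
  qed simp
  ultimately have "M * 2 ^ N \<le> M * (2 * mod_sup Hn (exp 1))" by (simp add: mult.commute)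
  then have big: "2 ^ N \<le> 2 * mod_sup Hn (exp 1)" using M0 by simp
  let ?Pr = "\<lambda>a (y :: complex ^ 'n option). \<Prod>i\<in>UNIV. \<Prod>b\<in>{..<q} - {a i}. (y $ Some i - of_nat b)"
  define g where "g = (\<lambda>y :: complex ^ 'n option. (1 / of_real M) *
    (\<Sum>(a, j)\<in>U. c (a, j) * (?Pr a y * (y $ None) ^ j)))"
  have g: "g \<in> poly_space k"
    unfolding g_def
  proof (rule poly_space_cmult, rule poly_space_sum)
    fix u assume "u \<in> U"
    then obtain a j where u: "u = (a, j)" "a \<in> ?S" "j < q" by (auto simp: U_def)
    have "(\<lambda>y :: complex ^ 'n option. ?Pr a y * (y $ None) ^ j)
        \<in> poly_space ((?deg a) + j * 1)"
      by (intro poly_space_mult poly_space_prod poly_space_affine poly_space_power poly_space_component) auto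
    then have "(\<lambda>y :: complex ^ 'n option. ?Pr a y * (y $ None) ^ j)
        \<in> poly_space k"
    proof (rule poly_space_mono)
      have "(?deg a) = CARD('n) * (q - 1)" using u by simp
      then show "(?deg a) + j * 1 \<le> k" using u q by simp
    qed
    then show "(\<lambda>y :: complex ^ 'n option. case u of (a, j) \<Rightarrow> c (a, j) *
        (?Pr a y * (y $ None) ^ j)) \<in> poly_space k"
      unfolding u by (simp only: prod.case) (rule poly_space_cmult)
  qed
  have gH: "on_graph f g = Hn"
    by (simp add: fun_eq_iff on_graph_def g_def Hn_def H_def h_def grid_lagrange_def case_prod_beta)
  have "ereal (real N * ln 2 - ln 2) \<le> ln_ext (max_mod (on_graph f g) (exp 1))"
  proof -
    have pos: "mod_sup Hn (exp 1) > 0" using big by (smt (verit) zero_less_power)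
    have "real N * ln 2 = ln (2 ^ N)" by (simp add: ln_realpow)
    also have "\<dots> \<le> ln (2 * mod_sup Hn (exp 1))" using big pos by (intro ln_mono) auto
    also have "\<dots> = ln 2 + ln (mod_sup Hn (exp 1))" using pos by (intro ln_mult_pos) auto
    finally show ?thesis
      using pos by (simp add: gH max_mod_eq_mod_sup[OF lhHn] ln_ext_def)
  qed
  also have "\<dots> \<le> m_fun k (exp 1) f"
    unfolding m_fun_def
    by (rule SUP_upper) (use g Hn_le1 in \<open>auto simp: gH max_mod_eq_mod_sup[OF lhHn] one_ereal_def\<close>)
  finally show ?thesis .
next
  case True
  define g where "g = (\<lambda>y :: complex ^ 'n option. 1 :: complex)"
  have one: "on_graph f g = (\<lambda>_. 1)" by (simp add: fun_eq_iff on_graph_def g_def)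
  have g_poly: "g \<in> poly_space k" unfolding g_def by (rule poly_space_const)
  have mm: "max_mod (\<lambda>_ :: complex ^ 'n. 1) r = 1" if "r > 0" for r
    using that by (auto simp: max_mod_def one_ereal_def)
  have "ereal 0 \<le> ln_ext (max_mod (on_graph f g) (exp 1))"
    by (simp add: one mm ln_ext_def)
  also have "\<dots> \<le> m_fun k (exp 1) f"
    unfolding m_fun_def by (rule SUP_upper) (simp add: one mm g_poly)
  finally show ?thesis using True by (auto intro: order_trans[rotated])
qed


section \<open>Upper bound: a polynomial against its restriction to the graph\<close>

lemma norm_le_mod_sup_closed:
  assumes "line_holomorphic h" "r > 0" "norm z \<le> r"
  shows "norm (h z) \<le> mod_sup h r"
proof (rule continuous_on_closure_norm_le[of "ball 0 r" h])
  show "continuous_on (closure (ball 0 r)) h"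
    using assms(1) by (auto simp: line_holomorphic_def intro: continuous_on_subset)
  show "\<forall>y\<in>ball 0 r. norm (h y) \<le> mod_sup h r"
    using norm_le_mod_sup[OF assms(1,2)] by simp
  show "z \<in> closure (ball 0 r)" using assms(2,3) by simp
qed

text \<open>Lagrange interpolation on the line through 0 and \<open>z\<close>, with equally spaced nodes in
  the small ball; a crude form of the Bernstein-Walsh inequality.\<close>

lemma poly_norm_le_on_ball:
  fixes B :: "nat \<Rightarrow> complex ^ 'n \<Rightarrow> complex" and \<beta> R M :: real
  assumes B: "\<And>j. B j \<in> poly_space k" and "\<beta> > 0" "norm z \<le> R"
    and bnd: "\<And>b. norm b \<le> \<beta> \<Longrightarrow> norm (\<Sum>j\<le>k. B j b * w ^ j) \<le> M"
  shows "norm (\<Sum>j\<le>k. B j z * w ^ j) \<le> Suc k * (M * ((R + \<beta>) * Suc k / \<beta>) ^ k)"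
proof -
  define v where "v = of_real (1 / norm z) *s z"
  have v: "norm v \<le> 1" "of_real (norm z) *s v = z"
    by (auto simp: v_def norm_scalar_mult_vec norm_divide vector_smult_assoc)
  have "\<exists>Q. degree Q \<le> k \<and> (\<forall>t. B j (0 + t *s v) = poly Q t)" for j
    using poly_space_on_line[OF B] by metis
  then obtain Q where Q: "\<And>j. degree (Q j) \<le> k" "\<And>j t. B j (t *s v) = poly (Q j) t"
    by (metis add_0)
  define P where "P = (\<Sum>j\<le>k. smult (w ^ j) (Q j))"
  have P: "poly P t = (\<Sum>j\<le>k. B j (t *s v) * w ^ j)" for t
    by (simp add: P_def poly_sum Q(2) mult.commute)
  have degP: "degree P \<le> k"
    unfolding P_def using Q(1) by (intro degree_sum_le) (auto intro: order_trans[OF degree_smult_le])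
  define d where "d = \<beta> / Suc k"
  have d: "d > 0" using assms(2) by (simp add: d_def)
  define node where "node = (\<lambda>i :: nat. of_real (d * i) :: complex)"
  have M0: "0 \<le> M" using assms(2) by (intro order_trans[OF norm_ge_zero bnd[of 0]]) simp
  have "norm (poly P (of_real (norm z))) \<le> Suc k * (M * ((norm (of_real (norm z) :: complex) + \<beta>) / d) ^ k)"
  proof (rule lagrange_bound[OF _ degP d])
    have "inj_on node {..k}" using d by (auto simp: node_def inj_on_def)
    then show "card (node ` {..k}) = Suc k" by (simp add: card_image)
    fix x assume "x \<in> node ` {..k}"
    then obtain i where i: "i \<le> k" "x = node i" by auto
    have "d * i \<le> d * Suc k" using d i by (intro mult_left_mono) auto
    moreover have "norm x = d * i" unfolding i node_def norm_of_real using d by simp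
    ultimately show x: "norm x \<le> \<beta>" by (simp add: d_def)
    show "norm (poly P x) \<le> M" unfolding P
    proof (rule bnd)
      have "norm x * norm v \<le> \<beta> * 1" using x v(1) assms(2) by (intro mult_mono) auto
      then show "norm (x *s v) \<le> \<beta>" by (simp add: norm_scalar_mult_vec)
    qed
    fix y assume "y \<in> node ` {..k}" "x \<noteq> y"
    then obtain j where j: "y = node j" "i \<noteq> j" using i by auto
    have "x - y = of_real (d * (real i - real j))" by (simp add: i j node_def algebra_simps)
    then have "norm (x - y) = d * \<bar>real i - real j\<bar>" using d by (simp only: norm_of_real abs_mult abs_of_pos)
    moreover have "1 \<le> \<bar>real i - real j\<bar>" using j(2) by linarith
    ultimately show "d \<le> norm (x - y)" using d by (simp add: mult_le_cancel_left1)
  qed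
  also have "\<dots> \<le> Suc k * (M * ((R + \<beta>) * Suc k / \<beta>) ^ k)"
    using M0 assms(2,3) d
    by (intro mult_left_mono power_mono) (auto simp: d_def divide_right_mono mult_right_mono)
  finally show ?thesis unfolding P v(2) .
qed

lemma on_graph_decompose:
  fixes f :: "complex ^ 'n \<Rightarrow> complex"
  assumes "g \<in> poly_space k"
  obtains B :: "nat \<Rightarrow> complex ^ 'n \<Rightarrow> complex" where "\<And>j. B j \<in> poly_space k"
    "\<And>z. on_graph f g z = (\<Sum>j\<le>k. B j z * f z ^ j)"
  using poly_space_option_decompose[OF assms] unfolding on_graph_def by metis

text \<open>On the line \<open>\<gamma>\<close> from \<open>b\<close> to the point \<open>z1\<close>, where
  \<open>f\<close> is large, let \<open>F\<close> be the restriction of \<open>f\<close>. At a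
  level \<open>lev j\<close> taken \<open>k + 1\<close> times by \<open>F\<close>, the polynomial
  of degree at most \<open>k\<close> obtained by fixing the last variable at \<open>lev j\<close>
  agrees with the restriction of the given polynomial to the graph at these \<open>k + 1\<close>
  zeros. So it is a Hermite interpolant and inherits the bound \<open>\<delta>\<close>. Since
  there are \<open>k + 1\<close> such levels, Lagrange interpolation in the last variable does the
  rest.\<close>

lemma graph_bound_near_origin:
  fixes f :: "complex ^ 'n \<Rightarrow> complex" and c k K :: nat and B :: "nat \<Rightarrow> complex ^ 'n \<Rightarrow> complex"
    and \<eta> R M \<delta> W :: real
  assumes f: "line_holomorphic f" and \<eta>: "0 < \<eta>" "\<eta> \<le> 1" and R: "1 \<le> R" "norm z1 \<le> R"
    and M: "1 \<le> M" "\<And>z. norm z < (1 + 4 * \<eta>) * R \<Longrightarrow> norm (f z) \<le> M"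
    and small: "\<And>z. norm z \<le> 1 \<Longrightarrow> norm (f z) \<le> c"
    and K: "k < K" "2 * (c + K + 4) \<le> norm (f z1)"
    and big: "ln (norm (f z1) / 2) > 3 / \<eta> *
      (ln (8 * (c + K + 4)) + k * ln (16 * R) + ln (500 * M / \<eta>) / (K - k))"
    and B: "\<And>j. B j \<in> poly_space k"
    and \<delta>: "\<And>z. norm z < (1 + 4 * \<eta>) * R \<Longrightarrow> norm (\<Sum>j\<le>k. B j z * f z ^ j) \<le> \<delta>"
    and b: "norm b \<le> \<eta> / 8" and w: "norm w \<le> W"
  shows "norm (\<Sum>j\<le>k. B j b * w ^ j) \<le> Suc k * ((17 / \<eta>) ^ Suc k * \<delta> * (W + (c + K + 4)) ^ k)"
proof -
  define \<gamma> where "\<gamma> = (\<lambda>t. b + t *s (z1 - b))"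
  define F where "F = (\<lambda>t. f (\<gamma> t))"
  let ?D = "ball (0::complex) (1 + 3 * \<eta>)"
  have \<gamma>_norm: "norm (\<gamma> t) \<le> norm t * R + (1 + norm t) * norm b" for t
  proof -
    have "norm (\<gamma> t) \<le> norm b + norm t * norm (z1 - b)"
      unfolding \<gamma>_def by (metis norm_triangle_ineq norm_scalar_mult_vec)
    also have "\<dots> \<le> norm b + norm t * (R + norm b)"
      using R(2) norm_triangle_ineq4[of z1 b] by (intro add_left_mono mult_left_mono) auto
    finally show ?thesis by (simp add: algebra_simps)
  qed
  have \<gamma>_in: "norm (\<gamma> t) < (1 + 4 * \<eta>) * R" if "t \<in> ?D" for t
  proof -
    have t: "norm t < 1 + 3 * \<eta>" using that by simp
    have "norm t * R < (1 + 3 * \<eta>) * R" using t R by (intro mult_strict_right_mono) auto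
    moreover have "(1 + norm t) * norm b \<le> 5 * (\<eta> / 8)"
      using t b \<eta> by (intro mult_mono) auto
    moreover have "5 * (\<eta> / 8) \<le> \<eta> * R" using mult_left_mono[OF R(1), of \<eta>] \<eta> by simp
    ultimately show ?thesis using \<gamma>_norm[of t] by (simp add: algebra_simps)
  qed
  have holF: "F holomorphic_on ?D"
    unfolding F_def \<gamma>_def by (rule line_holomorphicD(1)[OF f])
  have FM: "norm (F t) \<le> M" if "t \<in> ?D" for t
    unfolding F_def by (rule M(2)[OF \<gamma>_in[OF that]])
  have F1: "F 1 = f z1" by (simp add: F_def \<gamma>_def)
  have Fsmall: "norm (F t) \<le> c" if "norm t \<le> 1 / (4 * R)" for t
    unfolding F_def
  proof (rule small)
    have "norm t * R \<le> 1 / 4" using that R by (simp add: field_simps)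
    moreover have "norm t * 1 \<le> norm t * R" using R by (intro mult_left_mono) auto
    ultimately have "norm t * R \<le> 1 / 4" "norm t \<le> 1" by linarith+
    moreover from this have "(1 + norm t) * norm b \<le> 2 * (1 / 8)"
      using b \<eta> by (intro mult_mono) auto
    ultimately show "norm (\<gamma> t) \<le> 1" using \<gamma>_norm[of t] by linarith
  qed
  have big': "ln (norm (F 1) / 2) > 3 / \<eta> *
      (ln (8 * (c + K + 4)) + k * ln (4 / (1 / (4 * R))) + ln (500 * M / \<eta>) / (K - k))"
    using big by (simp add: F1)
  obtain \<zeta> J zs u where \<zeta>: "norm \<zeta> \<le> 2" and J: "J \<subseteq> {..<K}" "card J = Suc k"
    and zs: "\<And>j. j \<in> J \<Longrightarrow> set (zs j) \<subseteq> cball 0 (1 + \<eta>)" "\<And>j. j \<in> J \<Longrightarrow> length (zs j) = Suc k"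
    and u: "\<And>j. j \<in> J \<Longrightarrow> u j holomorphic_on ?D"
    and fac: "\<And>j t. j \<in> J \<Longrightarrow> t \<in> ?D \<Longrightarrow>
      F t - (\<zeta> + of_nat (c + 1 + j)) = prod_list (map (\<lambda>z. t - z) (zs j)) * u j t"
    by (rule many_levels_with_many_zeros[OF holF FM M(1) \<eta> _ _ Fsmall K(1) _ big'])
      (use R K(2) F1 in auto)
  define lev where "lev = (\<lambda>j. \<zeta> + of_nat (c + 1 + j))"
  have d0: "0 \<le> \<delta>"
    using R \<eta> by (intro order_trans[OF norm_ge_zero \<delta>[of 0]]) simp
  have at_level: "norm (\<Sum>i\<le>k. B i b * lev j ^ i) \<le> (17 / \<eta>) ^ Suc k * \<delta>" if j: "j \<in> J" for j
  proof -
    have "\<exists>Q. degree Q \<le> k \<and> (\<forall>t. B i (\<gamma> t) = poly Q t)" for i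
      using poly_space_on_line[OF B] unfolding \<gamma>_def by metis
    then obtain Q where Q: "\<And>i. degree (Q i) \<le> k" "\<And>i t. B i (\<gamma> t) = poly (Q i) t" by metis
    define P where "P = (\<Sum>i\<le>k. smult (lev j ^ i) (Q i))"
    have P: "poly P t = (\<Sum>i\<le>k. B i (\<gamma> t) * lev j ^ i)" for t
      by (simp add: P_def poly_sum Q(2) mult.commute)
    have degP: "degree P \<le> k"
      unfolding P_def using Q(1) by (intro degree_sum_le) (auto intro: order_trans[OF degree_smult_le])
    (* The quotient of the difference of the polynomial at F t and at the level by F t - lev j. *)
    define T where "T = (\<lambda>t. \<Sum>i\<le>k. B i (\<gamma> t) * (\<Sum>l<i. F t ^ l * lev j ^ (i - Suc l)))"
    have holB: "(\<lambda>t. B i (\<gamma> t)) holomorphic_on ?D" for i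
      unfolding \<gamma>_def by (rule line_holomorphicD(1)[OF poly_space_line_holomorphic[OF B]])
    have "norm (poly P 0) \<le> (1 + 8 * (1 + 3 * \<eta>) / (2 * \<eta>)) ^ length (zs j) * \<delta>"
    proof (rule hermite_remainder_bound[where h = "\<lambda>t. \<Sum>i\<le>k. B i (\<gamma> t) * F t ^ i" and U = "\<lambda>t. u j t * T t"])
      show "set (zs j) \<subseteq> cball 0 (1 + 3 * \<eta> - 2 * \<eta>)" using zs(1)[OF j] by (simp add: add.commute)
      show "(\<lambda>t. \<Sum>i\<le>k. B i (\<gamma> t) * F t ^ i) holomorphic_on ?D"
        by (intro holomorphic_intros holB holF)
      show "norm (\<Sum>i\<le>k. B i (\<gamma> t) * F t ^ i) \<le> \<delta>" if "t \<in> ?D" for t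
        unfolding F_def by (rule \<delta>[OF \<gamma>_in[OF that]])
      show "coeff P i = 0" if "length (zs j) \<le> i" for i
        using that degP zs(2)[OF j] by (intro coeff_eq_0) auto
      show "(\<lambda>t. u j t * T t) holomorphic_on ?D"
        unfolding T_def by (intro holomorphic_intros holB holF u[OF j])
      show "(\<Sum>i\<le>k. B i (\<gamma> t) * F t ^ i) - poly P t = prod_list (map (\<lambda>z. t - z) (zs j)) * (u j t * T t)"
        if "t \<in> ?D" for t
      proof -
        have "(\<Sum>i\<le>k. B i (\<gamma> t) * F t ^ i) - poly P t = (\<Sum>i\<le>k. B i (\<gamma> t) * (F t ^ i - lev j ^ i))"
          unfolding P right_diff_distrib sum_subtractf ..
        also have "\<dots> = (F t - lev j) * T t"
          unfolding T_def sum_distrib_left[of "F t - lev j"]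
        proof (rule sum.cong[OF refl])
          fix i
          have "F t ^ i - lev j ^ i = (F t - lev j) * (\<Sum>l<i. F t ^ l * lev j ^ (i - Suc l))"
            unfolding power_diff_sumr2 by (simp only: mult.commute)
          then show "B i (\<gamma> t) * (F t ^ i - lev j ^ i) =
              (F t - lev j) * (B i (\<gamma> t) * (\<Sum>l<i. F t ^ l * lev j ^ (i - Suc l)))"
            by (simp add: mult_ac)
        qed
        finally show ?thesis using fac[OF j that] by (simp add: lev_def mult_ac)
      qed
    qed (use \<eta> in auto)
    also have "\<dots> \<le> (17 / \<eta>) ^ Suc k * \<delta>"
      unfolding zs(2)[OF j] using \<eta> d0
      by (intro mult_right_mono power_mono) (auto simp: field_simps)
    finally show ?thesis using P[of 0] by (simp add: \<gamma>_def)
  qed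
  define P where "P = (\<Sum>i\<le>k. monom (B i b) i)"
  have P: "poly P w = (\<Sum>i\<le>k. B i b * w ^ i)" for w by (simp add: P_def poly_sum poly_monom)
  have "norm (poly P w) \<le> Suc k * ((17 / \<eta>) ^ Suc k * \<delta> * ((norm w + (c + K + 4)) / 1) ^ k)"
  proof (rule lagrange_bound[of "lev ` J"])
    have "inj_on lev J" by (auto simp: lev_def inj_on_def)
    then show "card (lev ` J) = Suc k" using J(2) by (simp add: card_image)
    show "degree P \<le> k"
      unfolding P_def by (intro degree_sum_le) (auto intro: order_trans[OF degree_monom_le])
    fix x assume "x \<in> lev ` J"
    then obtain j where j: "j \<in> J" "x = lev j" by auto
    have "norm x \<le> norm \<zeta> + norm (of_nat (c + 1 + j) :: complex)"
      unfolding j lev_def by (rule norm_triangle_ineq)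
    moreover have "j < K" using j J by auto
    ultimately show "norm x \<le> real (c + K + 4)" using \<zeta> unfolding norm_of_nat by simp
    show "norm (poly P x) \<le> (17 / \<eta>) ^ Suc k * \<delta>" unfolding P j by (rule at_level[OF j(1)])
    fix y assume "y \<in> lev ` J" "x \<noteq> y"
    then obtain i where i: "y = lev i" "j \<noteq> i" using j by auto
    have "x - y = of_int (int j - int i)" by (simp add: j i lev_def)
    then have "norm (x - y) = \<bar>real_of_int (int j - int i)\<bar>" by (metis norm_of_int)
    then show "1 \<le> norm (x - y)" using i(2) by linarith
  qed simp
  also have "\<dots> \<le> Suc k * ((17 / \<eta>) ^ Suc k * \<delta> * (W + (c + K + 4)) ^ k)"
    using w d0 \<eta> by (intro mult_left_mono power_mono mult_nonneg_nonneg) auto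
  finally show ?thesis unfolding P .
qed

text \<open>If \<open>h\<close> grows by at most the factor \<open>E\<close> between two large radii, then
  on the ball of radius \<open>R1\<close> its Taylor polynomial of degree \<open>D\<close> carries
  at least half of it, where \<open>D\<close> is about \<open>ln E / ln (R2 / R1)\<close>. So
  \<open>h\<close> behaves like a polynomial of degree \<open>D\<close> at smaller radii as well.
  It serves the same purpose as the convexity of \<open>ln (mod_sup h r)\<close> in \<open>ln
  r\<close>.\<close>

lemma mod_sup_growth_transfer:
  fixes R1 R2 E :: real and D :: nat
  assumes h: "line_holomorphic h" and R: "1 \<le> R1" "R1 < R2" "2 * exp 1 \<le> R2"
    and E: "mod_sup h R2 \<le> E * mod_sup h R1" "0 \<le> E" "E * (R1 / R2) ^ Suc D / (1 - R1 / R2) \<le> 1 / 2"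
  shows "mod_sup h (exp 1) \<le> 3 * Suc D * exp (Suc D) * mod_sup h 1"
proof -
  define M1 where "M1 = mod_sup h 1"
  have M1: "0 \<le> M1" unfolding M1_def by (rule mod_sup_nonneg[OF h zero_less_one])
  have pos: "0 < R1" "0 < R2" using R by auto
  have coef: "norm (hom_coeff h l z) \<le> M1 * norm z ^ l" for l z
    using hom_coeff_bound[OF h zero_less_one norm_le_mod_sup_closed[OF h zero_less_one], of l z]
    by (simp add: M1_def)
  have bound: "norm (h z) \<le> Suc D * r ^ D * M1 + mod_sup h R2 * (r / R2) ^ Suc D / (1 - r / R2)"
    if z: "norm z < r" "1 \<le> r" "r < R2" for z and r :: real
  proof -
    have "norm (\<Sum>l<Suc D. hom_coeff h l z) \<le> (\<Sum>l<Suc D. M1 * r ^ D)"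
    proof (rule sum_norm_le)
      fix l assume l: "l \<in> {..<Suc D}"
      have "norm z ^ l \<le> r ^ l" using z by (intro power_mono) auto
      also have "\<dots> \<le> r ^ D" using z l by (intro power_increasing) auto
      finally show "norm (hom_coeff h l z) \<le> M1 * r ^ D"
        using coef[of l z] M1 by (meson mult_left_mono order_trans)
    qed
    moreover have "norm (h z - (\<Sum>l<Suc D. hom_coeff h l z)) \<le>
        mod_sup h R2 * (norm z / R2) ^ Suc D / (1 - norm z / R2)"
      by (rule hom_coeff_tail[OF h pos(2) norm_le_mod_sup_closed[OF h pos(2)]]) (use z in auto)
    moreover have "mod_sup h R2 * (norm z / R2) ^ Suc D / (1 - norm z / R2) \<le>
        mod_sup h R2 * (r / R2) ^ Suc D / (1 - r / R2)"
      using z pos mod_sup_nonneg[OF h pos(2)]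
      by (intro frac_le mult_left_mono power_mono mult_nonneg_nonneg zero_le_power divide_nonneg_nonneg
          diff_left_mono divide_right_mono) auto
    ultimately show ?thesis
      using norm_triangle_ineq[of "h z - (\<Sum>l<Suc D. hom_coeff h l z)" "\<Sum>l<Suc D. hom_coeff h l z"]
      by (simp add: mult_ac)
  qed
  have q: "0 < R1 / R2" "R1 / R2 < 1" using R pos by auto
  have M_R1: "mod_sup h R1 \<le> 2 * (Suc D * R1 ^ D * M1)"
  proof -
    have "norm (h z) \<le> Suc D * R1 ^ D * M1 + mod_sup h R1 / 2" if "norm z < R1" for z
    proof -
      have "mod_sup h R2 * (R1 / R2) ^ Suc D / (1 - R1 / R2) \<le>
          (E * mod_sup h R1) * (R1 / R2) ^ Suc D / (1 - R1 / R2)"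
        using E(1) q by (intro divide_right_mono mult_right_mono zero_le_power) auto
      also have "\<dots> = mod_sup h R1 * (E * (R1 / R2) ^ Suc D / (1 - R1 / R2))" by simp
      also have "\<dots> \<le> mod_sup h R1 * (1 / 2)"
        by (intro mult_left_mono E(3) mod_sup_nonneg[OF h pos(1)])
      finally show ?thesis using bound[OF that R(1,2)] by linarith
    qed
    then have "mod_sup h R1 \<le> Suc D * R1 ^ D * M1 + mod_sup h R1 / 2" by (rule mod_sup_le[OF h pos(1)])
    then show ?thesis by simp
  qed
  have fin: "norm (h z) \<le> 3 * Suc D * exp (Suc D) * M1" if "norm z < exp 1" for z
  proof -
    have er: "exp 1 / R2 \<le> 1 / 2" using R(3) pos by (simp add: field_simps)
    have "exp (1::real) < 2 * exp 1" by simp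
    then have eR: "exp 1 < R2" using R(3) by linarith
    have "mod_sup h R2 * (exp 1 / R2) ^ Suc D / (1 - exp 1 / R2) \<le>
        mod_sup h R2 * (exp 1 / R2) ^ Suc D / (1 / 2)"
      using er pos mod_sup_nonneg[OF h pos(2)] by (intro divide_left_mono) auto
    also have "\<dots> \<le> (E * (2 * (Suc D * R1 ^ D * M1))) * (exp 1 / R2) ^ Suc D / (1 / 2)"
      using E(1,2) M_R1 pos by (intro divide_right_mono mult_right_mono) (auto intro: order_trans mult_left_mono)
    also have "\<dots> = 4 * (Suc D * M1 * exp 1 ^ Suc D / R1) * (E * (R1 / R2) ^ Suc D)"
      using pos by (simp add: power_divide field_simps)
    also have "\<dots> \<le> 4 * (Suc D * M1 * exp 1 ^ Suc D / R1) * (1 / 2)"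
    proof -
      have "E * (R1 / R2) ^ Suc D \<le> E * (R1 / R2) ^ Suc D / (1 - R1 / R2)"
      proof -
        have "0 \<le> E * (R1 / R2) ^ Suc D" using q E(2) by (intro mult_nonneg_nonneg zero_le_power) auto
        then have "E * (R1 / R2) ^ Suc D / 1 \<le> E * (R1 / R2) ^ Suc D / (1 - R1 / R2)"
          using q by (intro divide_left_mono) auto
        then show ?thesis by simp
      qed
      then have "E * (R1 / R2) ^ Suc D \<le> 1 / 2" using E(3) by linarith
      then show ?thesis by (rule mult_left_mono) (use M1 pos in simp)
    qed
    also have "\<dots> \<le> 4 * (Suc D * M1 * exp 1 ^ Suc D / 1) * (1 / 2)"
      using M1 R(1) by (intro mult_right_mono mult_left_mono divide_left_mono) auto
    finally have tail: "mod_sup h R2 * (exp 1 / R2) ^ Suc D / (1 - exp 1 / R2) \<le>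
      4 * (Suc D * M1 * exp 1 ^ Suc D / 1) * (1 / 2)" .
    have "norm (h z) \<le> Suc D * exp 1 ^ D * M1 + mod_sup h R2 * (exp 1 / R2) ^ Suc D / (1 - exp 1 / R2)"
      by (rule bound[OF that _ eR]) simp
    also have "\<dots> \<le> Suc D * exp 1 ^ D * M1 + 4 * (Suc D * M1 * exp 1 ^ Suc D / 1) * (1 / 2)"
      by (intro add_left_mono tail)
    also have "\<dots> = Suc D * exp 1 ^ D * M1 + 2 * (Suc D * M1 * exp 1 ^ Suc D)" by simp
    finally have "norm (h z) \<le> Suc D * exp 1 ^ D * M1 + 2 * (Suc D * M1 * exp 1 ^ Suc D)" .
    also have "\<dots> \<le> Suc D * exp 1 ^ Suc D * M1 + 2 * (Suc D * M1 * exp 1 ^ Suc D)"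
      using M1 by (intro add_right_mono mult_right_mono mult_left_mono power_increasing) auto
    also have "\<dots> = 3 * Suc D * exp (Suc D) * M1"
    proof -
      have "exp (real (Suc D)) = exp 1 ^ Suc D" using exp_of_nat_mult[of "Suc D" "1::real"] by simp
      then show ?thesis by (simp only:) (simp add: algebra_simps)
    qed
    finally show ?thesis .
  qed
  show ?thesis unfolding M1_def[symmetric] by (rule mod_sup_le[OF h exp_gt_zero fin])
qed

text \<open>The factors of \<open>E\<close> come from the Hermite interpolation on a line, the Lagrange
  interpolation in the last variable and the Lagrange interpolation in \<open>z\<close>.\<close>

lemma m_fun_upper_bound:
  fixes f :: "complex ^ 'n \<Rightarrow> complex" and c k K D :: nat and \<eta> R R2 M E q :: real
  assumes f: "line_holomorphic f" and \<eta>: "0 < \<eta>" "\<eta> \<le> 1" and R: "1 \<le> R" "norm z1 \<le> R"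
    and R2: "(1 + 4 * \<eta>) * R < R2" "2 * exp 1 \<le> R2"
    and M: "1 \<le> M" "\<And>z. norm z \<le> R2 \<Longrightarrow> norm (f z) \<le> M"
    and small: "\<And>z. norm z \<le> 1 \<Longrightarrow> norm (f z) \<le> c"
    and K: "k < K" "2 * (c + K + 4) \<le> norm (f z1)"
    and big: "ln (norm (f z1) / 2) > 3 / \<eta> *
      (ln (8 * (c + K + 4)) + k * ln (16 * R) + ln (500 * M / \<eta>) / (K - k))"
    and E_def: "E = (Suc k)\<^sup>2 * (17 / \<eta>) ^ Suc k * (M + (c + K + 4)) ^ k * (8 * (R2 + 1) * Suc k / \<eta>) ^ k"
    and q_def: "q = (1 + 4 * \<eta>) * R / R2" and D: "E * q ^ Suc D / (1 - q) \<le> 1 / 2"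
  shows "m_fun k (exp 1) f \<le> ereal (2 * D + 4)"
  unfolding m_fun_def
proof (rule SUP_least)
  fix g assume "g \<in> {g \<in> poly_space k. max_mod (on_graph f g) 1 \<le> 1}"
  then have g: "g \<in> poly_space k" "max_mod (on_graph f g) 1 \<le> 1" by auto
  obtain B :: "nat \<Rightarrow> complex ^ 'n \<Rightarrow> complex" where B: "\<And>j. B j \<in> poly_space k"
    "\<And>z. on_graph f g z = (\<Sum>j\<le>k. B j z * f z ^ j)"
    using on_graph_decompose[OF g(1)] by metis
  define h where "h = (\<lambda>z. \<Sum>j\<le>k. B j z * f z ^ j)"
  have gh: "on_graph f g = h" by (simp add: fun_eq_iff B(2) h_def)
  have h: "line_holomorphic h" unfolding h_def
    by (intro line_holomorphic_sum line_holomorphic_mult line_holomorphic_power f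
        poly_space_line_holomorphic[OF B(1)])
  define R1 where "R1 = (1 + 4 * \<eta>) * R"
  have "1 * R \<le> R1" unfolding R1_def using \<eta> R by (intro mult_right_mono) auto
  then have R1: "1 \<le> R1" "R1 < R2" using R R2 unfolding R1_def by linarith+
  have pos: "0 < R1" "0 < R2" using R1 by auto
  define \<delta> where "\<delta> = mod_sup h R1"
  have \<delta>0: "0 \<le> \<delta>" unfolding \<delta>_def by (rule mod_sup_nonneg[OF h pos(1)])
  have E0: "0 \<le> E" unfolding E_def using \<eta> R1 M(1) by simp
  have hR2: "norm (h z) \<le> E * \<delta>" if z: "norm z < R2" for z
  proof -
    define Mb where "Mb = Suc k * ((17 / \<eta>) ^ Suc k * \<delta> * (M + (c + K + 4)) ^ k)"
    have fz: "norm (f z) \<le> M" using z by (intro M(2)) simp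
    have near: "norm (\<Sum>j\<le>k. B j b * f z ^ j) \<le> Mb" if "norm b \<le> \<eta> / 8" for b
      unfolding Mb_def
    proof (rule graph_bound_near_origin[OF f \<eta> R M(1) _ small K big B(1) _ that fz])
      show "norm (f w) \<le> M" if "norm w < (1 + 4 * \<eta>) * R" for w
        using that R2(1) by (intro M(2)) simp
      show "norm (\<Sum>j\<le>k. B j w * f w ^ j) \<le> \<delta>" if "norm w < (1 + 4 * \<eta>) * R" for w
        using norm_le_mod_sup[OF h pos(1), of w] that by (simp add: \<delta>_def h_def R1_def)
    qed
    have "norm (h z) \<le> Suc k * (Mb * ((R2 + \<eta> / 8) * Suc k / (\<eta> / 8)) ^ k)"
      unfolding h_def by (rule poly_norm_le_on_ball[OF B(1) _ _ near]) (use \<eta> z in auto)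
    also have "\<dots> \<le> Suc k * (Mb * (8 * (R2 + 1) * Suc k / \<eta>) ^ k)"
    proof (intro mult_left_mono power_mono)
      have "(R2 + \<eta> / 8) * Suc k / (\<eta> / 8) \<le> (R2 + 1) * Suc k / (\<eta> / 8)"
        using \<eta> by (intro divide_right_mono mult_right_mono) auto
      also have "(R2 + 1) * Suc k / (\<eta> / 8) = 8 * (R2 + 1) * Suc k / \<eta>" by simp
      finally show "(R2 + \<eta> / 8) * Suc k / (\<eta> / 8) \<le> 8 * (R2 + 1) * Suc k / \<eta>" .
      show "0 \<le> Mb" unfolding Mb_def using \<eta> \<delta>0 M(1) by (intro mult_nonneg_nonneg zero_le_power) auto
    qed (use \<eta> pos in auto)
    also have "\<dots> = E * \<delta>"
      by (simp only: Mb_def E_def power2_eq_square of_nat_mult of_nat_power mult_ac)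
    finally show ?thesis .
  qed
  have "mod_sup h (exp 1) \<le> 3 * Suc D * exp (Suc D) * mod_sup h 1"
  proof (rule mod_sup_growth_transfer[OF h R1 R2(2) _ E0])
    show "mod_sup h R2 \<le> E * mod_sup h R1"
      using mod_sup_le[OF h pos(2) hR2] by (simp add: \<delta>_def)
    show "E * (R1 / R2) ^ Suc D / (1 - R1 / R2) \<le> 1 / 2" using D by (simp add: q_def R1_def)
  qed
  also have "\<dots> \<le> 3 * Suc D * exp (Suc D) * 1"
    using g(2) by (intro mult_left_mono) (auto simp: gh max_mod_eq_mod_sup[OF h] one_ereal_def)
  finally have le: "mod_sup h (exp 1) \<le> 3 * Suc D * exp (Suc D)" by simp
  show "ln_ext (max_mod (on_graph f g) (exp 1)) \<le> ereal (2 * D + 4)"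
  proof (cases "mod_sup h (exp 1) = 0")
    case True
    then show ?thesis by (simp add: gh max_mod_eq_mod_sup[OF h] ln_ext_def)
  next
    case False
    then have p: "0 < mod_sup h (exp 1)" using mod_sup_nonneg[OF h, of "exp 1"] by simp
    have "ln (mod_sup h (exp 1)) \<le> ln (3 * real (Suc D) * exp (real (Suc D)))"
      using le p by (intro ln_mono) auto
    moreover have "ln (3 * real (Suc D) * exp (real (Suc D))) = ln (3 * real (Suc D)) + real (Suc D)"
      by (subst ln_mult_pos) auto
    moreover have "ln (3 * real (Suc D)) = ln 3 + ln (real (Suc D))" by (rule ln_mult_pos) auto
    moreover have "ln (3::real) \<le> 2" using ln_le_minus_one[of "3::real"] by simp
    moreover have "ln (real (Suc D)) \<le> real D" using ln_le_minus_one[of "real (Suc D)"] by simp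
    ultimately have "ln (mod_sup h (exp 1)) \<le> 2 * D + 4" unfolding of_nat_Suc by linarith
    then show ?thesis using p by (simp add: gh max_mod_eq_mod_sup[OF h] ln_ext_def)
  qed
qed


section \<open>Growth of the function, choice of radius and degree\<close>

text \<open>The summand 2 keeps the logarithm positive.\<close>

definition log_growth :: "(complex ^ 'n \<Rightarrow> complex) \<Rightarrow> real \<Rightarrow> real" where
  "log_growth f x = ln (2 + mod_sup f (exp x))"

lemma exp_log_growth:
  assumes "line_holomorphic f"
  shows "exp (log_growth f x) = 2 + mod_sup f (exp x)"
  using mod_sup_nonneg[OF assms, of "exp x"] by (simp add: log_growth_def)

lemma log_growth_mono:
  assumes f: "line_holomorphic f" and "x \<le> y"
  shows "log_growth f x \<le> log_growth f y"
proof -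
  have "mod_sup f (exp x) \<le> mod_sup f (exp y)"
  proof (rule mod_sup_le[OF f])
    fix z :: "complex ^ 'a" assume "norm z < exp x"
    moreover have "exp x \<le> exp y" using assms(2) by simp
    ultimately show "norm (f z) \<le> mod_sup f (exp y)" by (intro norm_le_mod_sup[OF f] exp_gt_zero) linarith
  qed simp
  then show ?thesis
    unfolding log_growth_def using mod_sup_nonneg[OF f, of "exp x"] by (intro ln_mono) auto
qed

text \<open>Linear growth of the logarithm in \<open>x = ln r\<close> is polynomial growth of
  \<open>f\<close>, which Liouville's theorem excludes.\<close>

lemma log_growth_superlinear:
  assumes f: "line_holomorphic f" and np: "\<not> polynomial_fun f"
  shows "\<exists>x\<ge>2. Y * x \<le> log_growth f x"
proof (rule ccontr)
  assume "\<not> (\<exists>x\<ge>2. Y * x \<le> log_growth f x)"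
  then have lin: "log_growth f x < Y * x" if "2 \<le> x" for x using that by force
  define D where "D = nat \<lceil>\<bar>Y\<bar>\<rceil>"
  have D: "Y \<le> D" unfolding D_def by linarith
  obtain M where M: "M > 0" "\<And>z. norm z \<le> exp 2 \<Longrightarrow> norm (f z) \<le> M"
    using line_holomorphic_bounded[OF f] by metis
  have "norm (f z) \<le> (M + 1) * (1 + norm z) ^ D" for z
  proof (cases "norm z \<le> exp 2")
    case True
    have "norm (f z) \<le> (M + 1) * 1" using M(2)[OF True] by simp
    also have "\<dots> \<le> (M + 1) * (1 + norm z) ^ D" using M(1) by (intro mult_left_mono one_le_power) auto
    finally show ?thesis .
  next
    case False
    then have nz: "norm z > 0" using exp_gt_zero[of "2::real"] by linarith
    define x where "x = ln (norm z)"
    have x: "exp x = norm z" unfolding x_def by (rule exp_ln[OF nz])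
    have "2 \<le> x" using False x by (metis exp_le_cancel_iff linear)
    have "norm (f z) \<le> mod_sup f (exp x)"
      by (rule norm_le_mod_sup_closed[OF f exp_gt_zero]) (simp add: x)
    also have "\<dots> \<le> exp (log_growth f x)" by (simp add: exp_log_growth[OF f])
    also have "\<dots> \<le> exp (D * x)"
    proof -
      have "Y * x \<le> D * x" using D \<open>2 \<le> x\<close> by (intro mult_right_mono) auto
      then show ?thesis using lin[OF \<open>2 \<le> x\<close>] by simp
    qed
    also have "\<dots> = norm z ^ D" by (simp add: exp_of_nat_mult x)
    also have "\<dots> \<le> (1 + norm z) ^ D" by (intro power_mono) auto
    also have "\<dots> \<le> (M + 1) * (1 + norm z) ^ D"
      using mult_right_mono[of 1 "M + 1" "(1 + norm z) ^ D"] M(1) by simp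
    finally show ?thesis .
  qed
  then have "separately_polynomial D f"
    by (rule separately_polynomial_of_growth[OF line_holomorphicD(1)[OF f]])
  then show False using np separately_polynomial_imp_polynomial_fun by blast
qed

text \<open>Borel's growth lemma. If it failed, iterating \<open>step\<close> from \<open>x0\<close> would
  double \<open>L x / x\<close> each time, so the relative step lengths would decrease
  geometrically and the iterates would stay bounded, although \<open>L\<close> is unbounded along
  them.\<close>

lemma borel_growth:
  fixes L :: "real \<Rightarrow> real"
  assumes mono: "\<And>x y. x \<le> y \<Longrightarrow> L x \<le> L y" and "\<epsilon> > 0" "1 \<le> x0"
    and S0: "1 \<le> L x0 / x0" "(L x0 / x0) powr - \<epsilon> \<le> 1 / 8"
  shows "\<exists>x\<ge>x0. L x0 / x0 \<le> L x / x \<and> L (x * (1 + 8 * (L x / x) powr - \<epsilon>)) \<le> 4 * L x"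
proof (rule ccontr)
  define S where "S = (\<lambda>x. L x / x)"
  define step where "step = (\<lambda>x. x * (1 + 8 * S x powr - \<epsilon>))"
  assume "\<not> ?thesis"
  then have jump: "4 * L x < L (step x)" if "x0 \<le> x" "S x0 \<le> S x" for x
    using that unfolding S_def step_def by (meson not_le)
  define xs where "xs = (\<lambda>j. (step ^^ j) x0)"
  have xs_Suc: "xs (Suc j) = step (xs j)" for j by (simp add: xs_def)
  define \<rho> where "\<rho> = (2::real) powr - \<epsilon>"
  have \<rho>: "0 < \<rho>" "\<rho> < 1" using \<open>\<epsilon> > 0\<close> by (auto simp: \<rho>_def powr_less_one)
  have S01: "1 \<le> S x0" "S x0 powr - \<epsilon> \<le> 1 / 8" using S0 by (auto simp: S_def)
  have inv: "x0 \<le> xs j \<and> 2 ^ j * S x0 \<le> S (xs j)" for j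
  proof (induction j)
    case 0
    show ?case by (simp add: xs_def)
  next
    case (Suc j)
    have ge: "S x0 \<le> S (xs j)"
    proof -
      have "1 * S x0 \<le> 2 ^ j * S x0" using S01 by (intro mult_right_mono) auto
      then show ?thesis using Suc by linarith
    qed
    have pos: "0 < xs j" using Suc \<open>1 \<le> x0\<close> by linarith
    have "S (xs j) powr - \<epsilon> \<le> S x0 powr - \<epsilon>"
      using ge S01 \<open>\<epsilon> > 0\<close> by (intro powr_mono2') auto
    then have "8 * S (xs j) powr - \<epsilon> \<le> 1" using S01 by linarith
    then have step: "xs j \<le> step (xs j)" "step (xs j) \<le> xs j * 2"
      unfolding step_def using pos by (auto intro!: mult_left_mono simp: mult_le_cancel_left1)
    have L: "L (xs j) = S (xs j) * xs j" using pos by (simp add: S_def)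
    have "2 * S (xs j) * step (xs j) \<le> 2 * S (xs j) * (xs j * 2)"
      using step ge S01 by (intro mult_left_mono) auto
    also have "\<dots> = 4 * L (xs j)" by (simp add: L)
    also have "\<dots> \<le> L (step (xs j))" using jump[OF _ ge] Suc by (intro less_imp_le) auto
    finally have "2 * S (xs j) * step (xs j) \<le> L (step (xs j))" .
    have "2 * S (xs j) \<le> S (step (xs j))"
    proof -
      have "S (step (xs j)) = L (step (xs j)) / step (xs j)" by (simp add: S_def)
      moreover have "0 < step (xs j)" using step pos by linarith
      ultimately show ?thesis
        using \<open>2 * S (xs j) * step (xs j) \<le> L (step (xs j))\<close> by (simp add: pos_le_divide_eq)
    qed
    then show ?case using Suc step by (simp add: xs_Suc)
  qed
  have bound: "xs j \<le> x0 * exp (\<Sum>i<j. \<rho> ^ i)" for j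
  proof (induction j)
    case 0
    show ?case by (simp add: xs_def)
  next
    case (Suc j)
    have "S (xs j) powr - \<epsilon> \<le> (2 ^ j * S x0) powr - \<epsilon>"
      using inv[of j] S01 \<open>\<epsilon> > 0\<close> by (intro powr_mono2') auto
    also have "\<dots> = \<rho> ^ j * S x0 powr - \<epsilon>"
      using S01 by (simp add: powr_mult \<rho>_def powr_powr powr_realpow[symmetric] mult.commute)
    also have "\<dots> \<le> \<rho> ^ j * (1 / 8)" using S01 \<rho> by (intro mult_left_mono) auto
    finally have "1 + 8 * S (xs j) powr - \<epsilon> \<le> 1 + \<rho> ^ j" by simp
    also have "\<dots> \<le> exp (\<rho> ^ j)" by (rule exp_ge_add_one_self)
    finally have "xs (Suc j) \<le> xs j * exp (\<rho> ^ j)"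
      unfolding xs_Suc step_def using inv[of j] \<open>1 \<le> x0\<close> by (intro mult_left_mono) auto
    also have "\<dots> \<le> x0 * exp (\<Sum>i<j. \<rho> ^ i) * exp (\<rho> ^ j)"
      using Suc by (intro mult_right_mono) auto
    finally show ?case by (simp add: exp_add)
  qed
  define X where "X = x0 * exp (1 / (1 - \<rho>))"
  have "xs j \<le> X" for j
  proof -
    have "(\<Sum>i<j. \<rho> ^ i) = (1 - \<rho> ^ j) / (1 - \<rho>)" using \<rho> by (simp add: sum_gp_strict)
    also have "\<dots> \<le> 1 / (1 - \<rho>)" using \<rho> by (intro divide_right_mono) auto
    finally have "x0 * exp (\<Sum>i<j. \<rho> ^ i) \<le> X" unfolding X_def using \<open>1 \<le> x0\<close> by (intro mult_left_mono) auto
    then show ?thesis using bound[of j] by linarith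
  qed
  then have "L (xs j) \<le> L X" for j by (rule mono)
  moreover have "2 ^ j \<le> L (xs j)" for j
  proof -
    have "2 ^ j * 1 * 1 \<le> S (xs j) * xs j"
      using inv[of j] S01 \<open>1 \<le> x0\<close>
      by (intro mult_mono) (auto intro: order_trans[of _ "2 ^ j * S x0"])
    also have "\<dots> = L (xs j)" using inv[of j] \<open>1 \<le> x0\<close> by (auto simp: S_def)
    finally show ?thesis by simp
  qed
  moreover obtain j where "L X < 2 ^ j" using real_arch_pow[of 2 "L X"] by auto
  ultimately show False by (meson leD order_trans)
qed

text \<open>The numerical conditions, all valid for large \<open>S\<close>, under which the parameters
  chosen below fit together. The last one is where \<open>\<tau> > 2\<close> enters.\<close>

lemma eventually_parameters_large:
  fixes c :: real
  assumes "0 < \<epsilon>" "\<epsilon> < 1 / 2" "0 \<le> c" "0 < a" "(1 - \<epsilon>) * (\<tau> - 1) > 1 + \<epsilon>"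
  shows "\<forall>\<^sub>F S in at_top. 8 \<le> S \<and> S powr - \<epsilon> \<le> 1 / 8 \<and>
    3 * S powr \<epsilon> * ln (8 * (c + 122 * S + 4)) \<le> S / 8 \<and> 2 * (c + 122 * S + 4) + 2 \<le> exp S \<and>
    Y \<le> S powr (1 - \<epsilon>) \<and> ln 500 + \<epsilon> * ln S \<le> S \<and> ln (32 * S\<^sup>2) \<le> S \<and>
    14 * S powr (1 + \<epsilon>) < a * (S powr (1 - \<epsilon>) / 220) powr (\<tau> - 1)"
proof (intro eventually_conj)
  show "\<forall>\<^sub>F S in at_top. (8::real) \<le> S" by (rule eventually_ge_at_top)
  show "\<forall>\<^sub>F S in at_top. S powr - \<epsilon> \<le> 1 / 8" using assms(1) by real_asymp
  show "\<forall>\<^sub>F S in at_top. 3 * S powr \<epsilon> * ln (8 * (c + 122 * S + 4)) \<le> S / 8"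
  proof -
    have "\<forall>\<^sub>F S in at_top. 3 * S powr (1 / 2) * ln (8 * (c + 122 * S + 4)) \<le> S / 8" by real_asymp
    moreover have "\<forall>\<^sub>F S in at_top. (1::real) \<le> S" by (rule eventually_ge_at_top)
    ultimately show ?thesis
    proof eventually_elim
      case (elim S)
      have "S powr \<epsilon> \<le> S powr (1 / 2)" using elim assms by (intro powr_mono) auto
      then have "3 * S powr \<epsilon> * ln (8 * (c + 122 * S + 4)) \<le> 3 * S powr (1 / 2) * ln (8 * (c + 122 * S + 4))"
        using elim assms by (intro mult_right_mono mult_left_mono ln_ge_zero) auto
      then show ?case using elim by linarith
    qed
  qed
  show "\<forall>\<^sub>F S in at_top. 2 * (c + 122 * S + 4) + 2 \<le> exp S" by real_asymp
  show "\<forall>\<^sub>F S in at_top. Y \<le> S powr (1 - \<epsilon>)"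
  proof -
    have "filterlim (\<lambda>S::real. S powr (1 - \<epsilon>)) at_top at_top" using assms(2) by real_asymp
    then show ?thesis by (simp add: filterlim_at_top)
  qed
  show "\<forall>\<^sub>F S in at_top. ln 500 + \<epsilon> * ln S \<le> S" by real_asymp
  show "\<forall>\<^sub>F S in at_top. ln (32 * S\<^sup>2) \<le> (S::real)" by real_asymp
  define \<delta> where "\<delta> = (1 - \<epsilon>) * (\<tau> - 1) - (1 + \<epsilon>)"
  have "\<delta> > 0" using assms(5) by (simp add: \<delta>_def)
  define C where "C = 14 * 220 powr (\<tau> - 1) / a"
  have "filterlim (\<lambda>S::real. S powr \<delta>) at_top at_top" using \<open>\<delta> > 0\<close> by real_asymp
  then have "\<forall>\<^sub>F S in at_top. C < S powr \<delta>" by (simp add: filterlim_at_top_dense)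
  moreover have "\<forall>\<^sub>F S in at_top. (1::real) \<le> S" by (rule eventually_ge_at_top)
  ultimately show "\<forall>\<^sub>F S in at_top. 14 * S powr (1 + \<epsilon>) < a * (S powr (1 - \<epsilon>) / 220) powr (\<tau> - 1)"
  proof eventually_elim
    case (elim S)
    have "14 * S powr (1 + \<epsilon>) = C * (a / 220 powr (\<tau> - 1) * S powr (1 + \<epsilon>))"
      using assms(4) by (simp add: C_def)
    also have "\<dots> < S powr \<delta> * (a / 220 powr (\<tau> - 1) * S powr (1 + \<epsilon>))"
      using elim assms(4) by (intro mult_strict_right_mono) auto
    also have "\<dots> = a * (S powr (\<delta> + (1 + \<epsilon>)) / 220 powr (\<tau> - 1))"
      by (simp add: powr_add)
    also have "\<delta> + (1 + \<epsilon>) = (1 - \<epsilon>) * (\<tau> - 1)" by (simp add: \<delta>_def)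
    also have "S powr ((1 - \<epsilon>) * (\<tau> - 1)) / 220 powr (\<tau> - 1) = (S powr (1 - \<epsilon>) / 220) powr (\<tau> - 1)"
      by (simp add: powr_divide powr_powr)
    finally show ?case .
  qed
qed

lemma le_exp_of_ln_le: "0 < x \<Longrightarrow> ln x \<le> y \<Longrightarrow> x \<le> exp y" for x y :: real
  by (metis exp_le_cancel_iff exp_ln)

text \<open>With \<open>S = log_growth f x / x\<close> take \<open>\<eta> = S powr - \<epsilon>\<close> and
  \<open>k\<close> about \<open>S powr (1 - \<epsilon>)\<close>, so that \<open>log_growth f
  x\<close> exceeds \<open>k * x / \<eta>\<close> by a large constant factor, as is required for
  many levels with many zeros. By Borel's lemma the logarithm of the growth factor between the
  radii \<open>exp x\<close> and \<open>exp (x * (1 + 8 * \<eta>))\<close> is at most a multiple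
  of \<open>k * log_growth f x\<close>. Dividing by \<open>\<eta> * x\<close> gives the exponent
  \<open>D\<close>, about \<open>k * S powr (1 + \<epsilon>)\<close>, which is less than the power
  \<open>\<tau>\<close> of \<open>k\<close> if \<open>\<epsilon>\<close> is small. Arbitrarily
  large \<open>S\<close> occur, hence arbitrarily large \<open>k\<close>.\<close>

lemma m_fun_not_eventually_large:
  fixes f :: "complex ^ 'n \<Rightarrow> complex"
  assumes f: "line_holomorphic f" and np: "\<not> polynomial_fun f" and "\<tau> > 2" "0 < a"
  shows "\<exists>k\<ge>k0. m_fun k (exp 1) f < ereal (a * real k powr \<tau>)"
proof -
  (* Any positive value with \<epsilon> * \<tau> < \<tau> - 2 makes (1 - \<epsilon>) * (\<tau> - 1) exceed 1 + \<epsilon>. *)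
  define \<epsilon> where "\<epsilon> = (\<tau> - 2) / (2 * \<tau>)"
  have \<epsilon>: "0 < \<epsilon>" "\<epsilon> < 1 / 2" "(1 - \<epsilon>) * (\<tau> - 1) > 1 + \<epsilon>"
    using \<open>\<tau> > 2\<close> by (auto simp: \<epsilon>_def field_simps)
  define c where "c = nat \<lceil>mod_sup f 1\<rceil>"
  have small: "norm (f z) \<le> c" if "norm z \<le> 1" for z
    using norm_le_mod_sup_closed[OF f zero_less_one that] unfolding c_def by linarith
  define large where "large = (\<lambda>S :: real. 8 \<le> S \<and> S powr - \<epsilon> \<le> 1 / 8 \<and>
    3 * S powr \<epsilon> * ln (8 * (real c + 122 * S + 4)) \<le> S / 8 \<and> 2 * (real c + 122 * S + 4) + 2 \<le> exp S \<and>
    220 * (real k0 + 1) \<le> S powr (1 - \<epsilon>) \<and> ln 500 + \<epsilon> * ln S \<le> S \<and> ln (32 * S\<^sup>2) \<le> S \<and>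
    14 * S powr (1 + \<epsilon>) < a * (S powr (1 - \<epsilon>) / 220) powr (\<tau> - 1))"
  have "eventually large at_top"
    unfolding large_def by (rule eventually_parameters_large) (use \<epsilon> \<open>0 < a\<close> in auto)
  then obtain S0 where S0: "\<And>S. S0 \<le> S \<Longrightarrow> large S" unfolding eventually_at_top_linorder by blast
  let ?L = "log_growth f"
  obtain x0 where x0: "2 \<le> x0" "S0 * x0 \<le> ?L x0" using log_growth_superlinear[OF f np] by blast
  then have "S0 \<le> ?L x0 / x0" by (simp add: field_simps)
  note big0 = S0[OF this]
  have "1 \<le> x0" "1 \<le> ?L x0 / x0" "(?L x0 / x0) powr - \<epsilon> \<le> 1 / 8"
    using x0(1) big0 unfolding large_def by linarith+
  from borel_growth[where L = ?L, OF log_growth_mono[OF f] \<epsilon>(1) this]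
  obtain x where x: "x0 \<le> x" "?L x0 / x0 \<le> ?L x / x" "?L (x * (1 + 8 * (?L x / x) powr - \<epsilon>)) \<le> 4 * ?L x"
    by blast
  define S where "S = ?L x / x"
  define \<psi> where "\<psi> = ?L x"
  define \<eta> where "\<eta> = S powr - \<epsilon>"
  have "S0 \<le> S" using \<open>S0 \<le> ?L x0 / x0\<close> x(2) by (simp add: S_def)
  then have S: "8 \<le> S" "\<eta> \<le> 1 / 8" "3 * S powr \<epsilon> * ln (8 * (c + 122 * S + 4)) \<le> S / 8"
    "2 * (c + 122 * S + 4) + 2 \<le> exp S" "220 * (real k0 + 1) \<le> S powr (1 - \<epsilon>)" "ln 500 + \<epsilon> * ln S \<le> S"
    "ln (32 * S\<^sup>2) \<le> S" "14 * S powr (1 + \<epsilon>) < a * (S powr (1 - \<epsilon>) / 220) powr (\<tau> - 1)"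
    using S0[of S] unfolding large_def \<eta>_def by blast+
  have x2: "2 \<le> x" using x0(1) x(1) by linarith
  have \<psi>: "\<psi> = S * x" using x2 by (simp add: \<psi>_def S_def)
  have S\<psi>: "2 * S \<le> \<psi>" unfolding \<psi> using x2 S(1) by (simp add: mult.commute)
  have x\<psi>: "8 * x \<le> \<psi>" unfolding \<psi> using x2 S(1) by (intro mult_right_mono) auto
  have \<eta>0: "0 < \<eta>" using S(1) by (simp add: \<eta>_def)
  have inv\<eta>: "1 / \<eta> = S powr \<epsilon>" by (simp add: \<eta>_def powr_minus field_simps)
  have ln\<eta>: "ln (1 / \<eta>) = \<epsilon> * ln S" using S(1) unfolding inv\<eta> by (simp add: ln_powr)
  have ge1: "1 \<le> S powr \<epsilon>" using S(1) \<epsilon> by (intro ge_one_powr_ge_zero) auto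
  have leS: "S powr \<epsilon> \<le> S" using powr_mono[of \<epsilon> 1 S] S(1) \<epsilon> by simp
  have split: "S powr (1 - \<epsilon>) * S powr \<epsilon> = S" using S(1) by (simp add: powr_add[symmetric])
  define k where "k = nat \<lfloor>S powr (1 - \<epsilon>) / 110\<rfloor>"
  (* So many extra levels that the loss from the one near the circle is a small part of \<psi>. *)
  define K where "K = k + nat \<lceil>120 / \<eta>\<rceil>"
  have k_le: "real k \<le> S powr (1 - \<epsilon>) / 110" unfolding k_def by (rule of_nat_floor) simp
  have k_ge: "S powr (1 - \<epsilon>) / 110 - 1 \<le> real k" unfolding k_def by linarith
  have "real k0 + 1 \<le> S powr (1 - \<epsilon>) / 220" using S(5) by (simp add: pos_le_divide_eq mult.commute)
  then have k220: "S powr (1 - \<epsilon>) / 220 \<le> real k" and kk0: "k0 \<le> k" and k1: "1 \<le> k"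
    using k_ge by linarith+
  have kS: "real k * S powr \<epsilon> \<le> S / 110"
    using mult_right_mono[OF k_le, of "S powr \<epsilon>"] split by simp
  have "real k * 1 \<le> real k * S powr \<epsilon>" using ge1 by (intro mult_left_mono) auto
  then have kS': "real k \<le> S / 110" using kS by linarith
  have Kk: "120 / \<eta> \<le> real (K - k)" unfolding K_def by (simp add: of_nat_ceiling)
  have "0 < 120 / \<eta>" using \<eta>0 by simp
  then have kK: "k < K" using Kk by (simp add: K_def)
  have KS: "real K \<le> 122 * S"
  proof -
    have "real K \<le> k + (120 / \<eta> + 1)" unfolding K_def using \<open>0 < 120 / \<eta>\<close> by simp
    moreover have "120 / \<eta> \<le> 120 * S" using leS inv\<eta> by (metis mult_left_mono times_divide_eq_right mult.right_neutral zero_le_numeral)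
    ultimately show ?thesis using kS' S(1) by linarith
  qed
  define R where "R = exp x"
  define R2 where "R2 = exp (x * (1 + 8 * \<eta>))"
  define M where "M = exp (4 * \<psi>)"
  have R1: "1 \<le> R" using x2 by (simp add: R_def)
  have \<eta>x: "\<eta> \<le> \<eta> * x" using x2 \<eta>0 by (simp add: mult_le_cancel_left1)
  have four: "1 + 4 * \<eta> \<le> exp (4 * \<eta> * x)"
  proof -
    have "exp (4 * \<eta>) \<le> exp (4 * \<eta> * x)" using \<eta>x by simp
    then show ?thesis using exp_ge_add_one_self[of "4 * \<eta>"] by linarith
  qed
  have R2_eq: "R2 = R * exp (8 * \<eta> * x)" by (simp add: R2_def R_def exp_add[symmetric] algebra_simps)
  have RR2: "(1 + 4 * \<eta>) * R < R2"
  proof -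
    have "4 * \<eta> * x < 8 * \<eta> * x" using \<eta>0 x2 by simp
    then have "1 + 4 * \<eta> < exp (8 * \<eta> * x)" using four by (smt (verit) exp_less_cancel_iff)
    then show ?thesis unfolding R2_eq using R1 by (subst mult.commute) (intro mult_strict_left_mono, auto)
  qed
  have R2_2e: "2 * exp 1 \<le> R2"
  proof -
    have "2 * exp 1 \<le> exp 1 * exp (1::real)" using exp_ge_add_one_self[of "1::real"] by (intro mult_right_mono) auto
    also have "\<dots> = exp (2::real)" by (simp add: exp_add[symmetric])
    also have "\<dots> \<le> R2"
    proof -
      have "x * 1 \<le> x * (1 + 8 * \<eta>)" using x2 \<eta>0 by (intro mult_left_mono) auto
      then have "2 \<le> x * (1 + 8 * \<eta>)" using x2 by linarith
      then show ?thesis by (simp add: R2_def)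
    qed
    finally show ?thesis .
  qed
  have M1: "1 \<le> M" using S\<psi> S(1) by (simp add: M_def)
  have fM: "norm (f z) \<le> M" if "norm z \<le> R2" for z
  proof -
    have "norm (f z) \<le> mod_sup f R2" using that by (intro norm_le_mod_sup_closed[OF f]) (auto simp: R2_def)
    also have "\<dots> \<le> exp (?L (x * (1 + 8 * \<eta>)))" by (simp add: exp_log_growth[OF f] R2_def)
    also have "\<dots> \<le> M" using x(3) by (simp add: M_def \<psi>_def \<eta>_def S_def)
    finally show ?thesis .
  qed
  obtain z1 where z1: "norm z1 \<le> R" "exp \<psi> - 2 \<le> norm (f z1)"
  proof -
    have "continuous_on (cball 0 R) (\<lambda>z. norm (f z))"
      using f by (auto simp: line_holomorphic_def intro: continuous_on_norm continuous_on_subset)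
    then obtain z1 where "z1 \<in> cball 0 R" "\<And>z. z \<in> cball 0 R \<Longrightarrow> norm (f z) \<le> norm (f z1)"
      using continuous_attains_sup[of "cball 0 R" "\<lambda>z. norm (f z)"] R1 by auto
    moreover from this have "mod_sup f (exp x) \<le> norm (f z1)"
      by (intro mod_sup_le[OF f]) (auto simp: R_def)
    ultimately show thesis using that[of z1] by (simp add: \<psi>_def exp_log_growth[OF f])
  qed
  have exp\<psi>: "exp S \<le> exp \<psi>" using S\<psi> S(1) by simp
  have cK: "2 * real c + 2 * real K + 10 \<le> exp S"
  proof -
    have "2 * real c + 244 * S + 10 \<le> exp S" using S(4) by simp
    then show ?thesis using KS by linarith
  qed
  have Kz1: "real (2 * (c + K + 4)) \<le> norm (f z1)"
  proof -
    have "2 * real c + 2 * real K + 10 \<le> exp \<psi>" by (rule order_trans[OF cK exp\<psi>])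
    then have "2 * real c + 2 * real K + 8 \<le> norm (f z1)" using z1(2) by linarith
    then show ?thesis by simp
  qed
  have lnM: "ln (500 * M / \<eta>) \<le> 5 * \<psi>"
  proof -
    have "ln (500 * M / \<eta>) = ln 500 + ln M + ln (1 / \<eta>)"
      using \<eta>0 by (simp add: M_def ln_mult_pos ln_div)
    then show ?thesis using S(6) S\<psi> S(1) unfolding ln\<eta> by (simp add: M_def)
  qed
  have big: "ln (norm (f z1) / 2) > 3 / \<eta> *
      (ln (real (8 * (c + K + 4))) + k * ln (16 * R) + ln (500 * M / \<eta>) / real (K - k))"
  proof -
    have three: "3 / \<eta> = 3 * S powr \<epsilon>" using inv\<eta> by (metis times_divide_eq_right mult.right_neutral)
    have t1: "3 / \<eta> * ln (real (8 * (c + K + 4))) \<le> \<psi> / 8"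
    proof -
      have "ln (real (8 * (c + K + 4))) \<le> ln (8 * (c + 122 * S + 4))"
        using KS S(1) by (intro ln_mono) auto
      then have "3 / \<eta> * ln (real (8 * (c + K + 4))) \<le> 3 * S powr \<epsilon> * ln (8 * (c + 122 * S + 4))"
        unfolding three by (intro mult_left_mono) auto
      then show ?thesis using S(3) S\<psi> S(1) by linarith
    qed
    have t2: "3 / \<eta> * (k * ln (16 * R)) \<le> \<psi> / 4"
    proof -
      have "ln (16 * R) = ln 16 + x" by (simp add: R_def ln_mult_pos)
      also have "\<dots> \<le> 9 * x" using ln_le_minus_one[of "16::real"] x2 by simp
      finally have "3 / \<eta> * (k * ln (16 * R)) \<le> 3 * S powr \<epsilon> * (k * (9 * x))"
        unfolding three by (intro mult_left_mono) auto
      also have "\<dots> = 27 * x * (k * S powr \<epsilon>)" by simp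
      also have "\<dots> \<le> 27 * x * (S / 110)" using kS x2 by (intro mult_left_mono) auto
      also have "\<dots> \<le> \<psi> / 4" using x2 S(1) by (simp add: \<psi> field_simps)
      finally show ?thesis .
    qed
    have t3: "3 / \<eta> * (ln (500 * M / \<eta>) / real (K - k)) \<le> \<psi> / 8"
    proof -
      have "ln (500 * M / \<eta>) / real (K - k) \<le> 5 * \<psi> / (120 / \<eta>)"
        by (intro frac_le lnM Kk \<open>0 < 120 / \<eta>\<close>) (use S\<psi> S(1) in linarith)
      then have "3 / \<eta> * (ln (500 * M / \<eta>) / real (K - k)) \<le> 3 / \<eta> * (5 * \<psi> / (120 / \<eta>))"
        using \<eta>0 by (intro mult_left_mono) auto
      also have "\<dots> = \<psi> / 8" using \<eta>0 by simp
      finally show ?thesis .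
    qed
    have "exp \<psi> / 4 \<le> norm (f z1) / 2"
      using z1(2) S\<psi> S(1) exp_ge_add_one_self[of \<psi>] by linarith
    then have "ln (exp \<psi> / 4) \<le> ln (norm (f z1) / 2)" by (intro ln_mono) auto
    moreover have "ln (exp \<psi> / 4) = \<psi> - ln 4" by (simp add: ln_div)
    moreover have "ln (4::real) \<le> 3" using ln_le_minus_one[of "4::real"] by simp
    ultimately have "\<psi> - 3 \<le> ln (norm (f z1) / 2)" by linarith
    moreover have "3 / \<eta> * (ln (real (8 * (c + K + 4))) + k * ln (16 * R) + ln (500 * M / \<eta>) / real (K - k)) \<le> \<psi> / 2"

      unfolding distrib_left[of "3 / \<eta>"]
      by (rule order_trans[OF add_mono[OF add_mono[OF t1 t2] t3]]) simp
    ultimately show ?thesis using S\<psi> S(1) by linarith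
  qed
  define E where "E = (Suc k)\<^sup>2 * (17 / \<eta>) ^ Suc k * (M + real (c + K + 4)) ^ k * (8 * (R2 + 1) * Suc k / \<eta>) ^ k"
  define q where "q = (1 + 4 * \<eta>) * R / R2"
  (* The exponent: ln E is at most 11 * k * \<psi>, and each unit of D gains 4 * \<eta> * x. *)
  define D where "D = nat \<lceil>4 * k * S powr (1 + \<epsilon>)\<rceil>"
  have E_le: "E \<le> exp (11 * k * \<psi>)"
  proof -
    have e1: "real ((Suc k)\<^sup>2) \<le> exp (k * \<psi>)"
    proof -
      have "real ((Suc k)\<^sup>2) \<le> (exp k)\<^sup>2"
        using exp_ge_add_one_self[of "real k"] by (simp add: add.commute power_mono)
      also have "\<dots> = exp (k * 2)" by (simp add: exp_double[symmetric] mult.commute)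
      also have "\<dots> \<le> exp (k * \<psi>)" using S\<psi> S(1) by (simp add: mult_left_mono)
      finally show ?thesis .
    qed
    have e2: "(17 / \<eta>) ^ Suc k \<le> exp (2 * k * \<psi>)"
    proof -
      have "ln (17 / \<eta>) \<le> \<psi>"
      proof -
        have "ln (17 / \<eta>) = ln 17 + ln (1 / \<eta>)" using \<eta>0 by (simp add: ln_div)
        moreover have "ln (17::real) \<le> ln 500" by simp
        ultimately show ?thesis using S(6) S\<psi> S(1) unfolding ln\<eta> by linarith
      qed
      then have "17 / \<eta> \<le> exp \<psi>" using \<eta>0 by (intro le_exp_of_ln_le) auto
      then have "(17 / \<eta>) ^ Suc k \<le> exp \<psi> ^ Suc k" using \<eta>0 by (intro power_mono) auto
      also have "\<dots> = exp (Suc k * \<psi>)" by (rule exp_of_nat_mult[symmetric])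
      also have "\<dots> \<le> exp (2 * k * \<psi>)" using k1 S\<psi> S(1) by (simp add: mult_right_mono)
      finally show ?thesis .
    qed
    have e3: "(M + real (c + K + 4)) ^ k \<le> exp (5 * k * \<psi>)"
    proof -
      have "real (c + K + 4) \<le> exp (4 * \<psi>)"
      proof -
        have "real (c + K + 4) \<le> exp S" using cK by simp
        also have "\<dots> \<le> exp (4 * \<psi>)" using S\<psi> S(1) by simp
        finally show ?thesis .
      qed
      then have "M + real (c + K + 4) \<le> 2 * exp (4 * \<psi>)" by (simp add: M_def)
      also have "\<dots> \<le> exp \<psi> * exp (4 * \<psi>)"
      proof -
        have "2 \<le> exp \<psi>" using exp_ge_add_one_self[of \<psi>] S\<psi> S(1) by linarith
        then show ?thesis by (rule mult_right_mono) simp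
      qed
      also have "\<dots> = exp (5 * \<psi>)" by (simp add: exp_add[symmetric])
      finally have "(M + real (c + K + 4)) ^ k \<le> exp (5 * \<psi>) ^ k" using M1 by (intro power_mono) auto
      then show ?thesis by (simp add: exp_of_nat_mult[symmetric] mult_ac)
    qed
    have e4: "(8 * (R2 + 1) * Suc k / \<eta>) ^ k \<le> exp (3 * k * \<psi>)"
    proof -
      have "1 \<le> R2" using RR2 R1 \<eta>0 by (smt (verit) mult_le_cancel_right1 mult_less_cancel_right1)
      have "8 * (R2 + 1) * Suc k / \<eta> = 8 * (R2 + 1) * Suc k * S powr \<epsilon>" using inv\<eta> by (metis times_divide_eq_right mult.right_neutral)
      also have "\<dots> \<le> 8 * (2 * R2) * (2 * S) * S"
        using \<open>1 \<le> R2\<close> kS' S(1) leS by (intro mult_mono) auto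
      also have "\<dots> = 32 * S\<^sup>2 * R2" by (simp add: power2_eq_square)
      also have "32 * S\<^sup>2 \<le> exp S" using S(7) S(1) by (intro le_exp_of_ln_le) auto
      also have "exp S \<le> exp \<psi>" by (rule exp\<psi>)
      also have "R2 \<le> exp (2 * \<psi>)"
      proof -
        have "x * (1 + 8 * \<eta>) \<le> x * 2" using S(2) x2 by (intro mult_left_mono) auto
        then have "x * (1 + 8 * \<eta>) \<le> 2 * \<psi>" using x\<psi> x2 by linarith
        then show ?thesis by (simp add: R2_def)
      qed
      finally have "8 * (R2 + 1) * Suc k / \<eta> \<le> exp (3 * \<psi>)" using \<open>1 \<le> R2\<close> by (simp add: exp_add[symmetric])
      then have "(8 * (R2 + 1) * Suc k / \<eta>) ^ k \<le> exp (3 * \<psi>) ^ k"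
        using \<open>1 \<le> R2\<close> \<eta>0 by (intro power_mono) auto
      then show ?thesis by (simp add: exp_of_nat_mult[symmetric] mult_ac)
    qed
    have "E \<le> exp (k * \<psi>) * exp (2 * k * \<psi>) * exp (5 * k * \<psi>) * exp (3 * k * \<psi>)"
      unfolding E_def using e1 e2 e3 e4 \<eta>0 M1 RR2 R1
      by (intro mult_mono mult_nonneg_nonneg zero_le_power) (auto simp: R2_def)
    also have "\<dots> = exp (11 * k * \<psi>)" by (simp add: exp_add[symmetric] algebra_simps)
    finally show ?thesis .
  qed
  define y where "y = 4 * \<eta> * x"
  have y: "8 * \<eta> \<le> y" "0 < y" using \<eta>0 x2 by (auto simp: y_def)
  have R2pos: "0 < R2" by (simp add: R2_def)
  have q: "0 < q" "q \<le> exp (- y)"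
  proof -
    show "0 < q" using \<eta>0 R1 R2pos by (simp add: q_def)
    have "q = (1 + 4 * \<eta>) * exp (- (8 * \<eta> * x))" using R1 by (simp add: q_def R2_eq exp_minus field_simps)
    also have "\<dots> \<le> exp (4 * \<eta> * x) * exp (- (8 * \<eta> * x))" using four by (intro mult_right_mono) auto
    also have "\<dots> = exp (- y)" by (simp add: exp_add[symmetric] y_def)
    finally show "q \<le> exp (- y)" .
  qed
  have inv1q: "1 / (1 - q) \<le> 1 / \<eta>"
  proof -
    have "exp (- y) * (1 + y) \<le> exp (- y) * exp y" using exp_ge_add_one_self[of y] by (intro mult_left_mono) auto
    then have "exp (- y) * (1 + y) \<le> 1" by (simp add: exp_add[symmetric])
    then have "exp (- y) \<le> 1 / (1 + y)" using y by (simp add: field_simps)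
    moreover have "1 / (1 + y) \<le> 1 / (1 + 8 * \<eta>)" using y \<eta>0 by (intro divide_left_mono) auto
    moreover have "1 / (1 + 8 * \<eta>) \<le> 1 - \<eta>"
    proof -
      have "8 * \<eta> * \<eta> \<le> 8 * \<eta> * (1 / 8)" using S(2) \<eta>0 by (intro mult_left_mono) auto
      then have "1 \<le> (1 - \<eta>) * (1 + 8 * \<eta>)" using \<eta>0 by (simp add: algebra_simps)
      then show ?thesis using \<eta>0 by (simp add: field_simps)
    qed
    ultimately have "\<eta> \<le> 1 - q" using q by linarith
    then show ?thesis using \<eta>0 by (intro divide_left_mono) auto
  qed
  have Dge: "4 * k * S powr (1 + \<epsilon>) \<le> D" unfolding D_def by linarith
  have Dle: "real D \<le> 4 * k * S powr (1 + \<epsilon>) + 1"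
    unfolding D_def using S(1) by (simp add: of_nat_ceiling)
  have S1\<epsilon>: "S powr (1 + \<epsilon>) = S * S powr \<epsilon>" using S(1) by (simp add: powr_add)
  have yD: "16 * k * \<psi> \<le> y * Suc D"
  proof -
    have "16 * k * \<psi> = y * (4 * k * S powr (1 + \<epsilon>))"
    proof -
      have "\<eta> * S powr \<epsilon> = 1" using inv\<eta> \<eta>0 by (simp add: field_simps)
      moreover have "y * (4 * k * S powr (1 + \<epsilon>)) = 16 * k * (S * x) * (\<eta> * S powr \<epsilon>)"
        unfolding y_def S1\<epsilon> by (simp add: mult_ac)
      ultimately have "y * (4 * k * S powr (1 + \<epsilon>)) = 16 * k * (S * x)" by simp
      then show ?thesis unfolding \<psi> by (rule sym)
    qed
    also have "\<dots> \<le> y * Suc D" using Dge y by (intro mult_left_mono) auto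
    finally show ?thesis .
  qed
  have E0: "0 \<le> E" unfolding E_def using \<eta>0 M1 R2pos by (intro mult_nonneg_nonneg zero_le_power) auto
  have Dcond: "E * q ^ Suc D / (1 - q) \<le> 1 / 2"
  proof -
    have "q ^ Suc D \<le> exp (- y) ^ Suc D" using q by (intro power_mono) auto
    also have "\<dots> = exp (- (y * Suc D))" by (subst exp_of_nat_mult[symmetric]) (simp add: mult_ac)
    also have "\<dots> \<le> exp (- (16 * k * \<psi>))" using yD by simp
    finally have "E * q ^ Suc D \<le> exp (11 * k * \<psi>) * exp (- (16 * k * \<psi>))"
      using E_le q by (intro mult_mono) auto
    also have "\<dots> = exp (- (5 * (k * \<psi>)))" by (simp add: exp_add[symmetric])
    also have "\<dots> \<le> exp (- (5 * \<psi>))"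
    proof -
      have "1 * \<psi> \<le> k * \<psi>" using k1 S\<psi> S(1) by (intro mult_right_mono) auto
      then show ?thesis by simp
    qed
    finally have le: "E * q ^ Suc D \<le> exp (- (5 * \<psi>))" .
    have "E * q ^ Suc D / (1 - q) = E * q ^ Suc D * (1 / (1 - q))" by simp
    also have "\<dots> \<le> exp (- (5 * \<psi>)) * (1 / \<eta>)"
    proof (rule mult_mono[OF le inv1q])
      have "exp (- y) < 1" using y by simp
      with q(2) have "q < 1" by (rule le_less_trans)
      then show "0 \<le> 1 / (1 - q)" by simp
    qed auto
    also have "1 / \<eta> \<le> exp \<psi>"
    proof -
      have "ln (1 / \<eta>) \<le> \<psi>" unfolding ln\<eta> using S(6) S\<psi> S(1) ln_ge_zero[of "500::real"] by linarith
      then show ?thesis using \<eta>0 by (intro le_exp_of_ln_le) auto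
    qed
    finally have "E * q ^ Suc D / (1 - q) \<le> exp (- (4 * \<psi>))" by (simp add: exp_add[symmetric])
    also have "\<dots> \<le> exp (- 1)" using S\<psi> S(1) by simp
    also have "\<dots> \<le> (1 / 2 :: real)" using exp_ge_add_one_self[of "1::real"] by (simp add: exp_minus field_simps)
    finally show ?thesis .
  qed
  have "m_fun k (exp 1) f \<le> ereal (2 * D + 4)"
    by (rule m_fun_upper_bound[OF f \<eta>0 _ R1 z1(1) RR2 R2_2e M1 fM small kK Kz1 big E_def q_def Dcond])
      (use S(2) in auto)
  also have "2 * real D + 4 < a * real k powr \<tau>"
  proof -
    have "1 * 1 \<le> real k * S powr (1 + \<epsilon>)" using k1 S(1) \<epsilon> by (intro mult_mono ge_one_powr_ge_zero) auto
    then have "2 * real D + 4 \<le> k * (14 * S powr (1 + \<epsilon>))" using Dle by linarith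
    also have "\<dots> < k * (a * (S powr (1 - \<epsilon>) / 220) powr (\<tau> - 1))"
      using k1 S(8) by (intro mult_strict_left_mono) auto
    also have "\<dots> \<le> k * (a * real k powr (\<tau> - 1))"
      using k220 \<open>0 < a\<close> \<open>\<tau> > 2\<close> by (intro mult_left_mono powr_mono2) auto
    also have "\<dots> = a * (real k powr 1 * real k powr (\<tau> - 1))" using k1 by simp
    also have "\<dots> = a * real k powr \<tau>" by (simp only: powr_add[symmetric]) simp
    finally show ?thesis .
  qed
  then have "ereal (2 * D + 4) < ereal (a * real k powr \<tau>)" by simp
  finally show ?thesis using kk0 by blast
qed


section \<open>The lower order of transcendence\<close>

text \<open>With \<open>q\<close> about \<open>k / (n + 1)\<close>, the largest \<open>N\<close> with
  \<open>N ^ n < q ^ (n + 1)\<close> is about \<open>q powr (1 + 1 / n)\<close>.\<close>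

lemma m_fun_eventually_large:
  fixes f :: "complex ^ 'n \<Rightarrow> complex"
  assumes f: "line_holomorphic f" and np: "\<not> polynomial_fun f"
  shows "\<exists>a>0. \<forall>\<^sub>F k in sequentially. ereal (a * real k powr (1 + 1 / real CARD('n))) \<le> m_fun k (exp 1) f"
proof -
  define n where "n = CARD('n)"
  define \<tau> where "\<tau> = 1 + 1 / real n"
  have n: "n \<ge> 1" by (simp add: n_def Suc_le_eq)
  have \<tau>: "\<tau> > 0" "\<tau> * real n = real (n + 1)" using n by (auto simp: \<tau>_def field_simps add_pos_nonneg)
  define a where "a = ln 2 / (2 * real (n + 1) powr \<tau>)"
  have a: "a > 0" by (simp add: a_def)
  have "filterlim (\<lambda>k :: nat. (real k / real (n + 1)) powr \<tau>) at_top sequentially"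
    using \<tau>(1) by real_asymp
  then have "\<forall>\<^sub>F k in sequentially. 4 \<le> (real k / real (n + 1)) powr \<tau>"
    by (simp add: filterlim_at_top)
  then have "\<forall>\<^sub>F k in sequentially. ereal (a * real k powr \<tau>) \<le> m_fun k (exp 1) f"
  proof eventually_elim
    case (elim k)
    define q where "q = k div (n + 1) + 1"
    define N where "N = nat \<lceil>real q powr \<tau>\<rceil> - 1"
    have q_ge: "real k / real (n + 1) \<le> real q"
    proof -
      have "k < (n + 1) * (k div (n + 1)) + (n + 1)"
        using mult_div_mod_eq[of "n + 1" k] mod_less_divisor[of "n + 1" k] by linarith
      then have "k \<le> (n + 1) * q" by (simp add: q_def)
      then have "real k \<le> real ((n + 1) * q)" by (rule of_nat_mono)
      then have le: "real k \<le> real (n + 1) * real q" by (simp only: of_nat_mult)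
      have "0 < real (n + 1)" by simp
      from le show ?thesis
        unfolding pos_divide_le_eq[OF \<open>0 < real (n + 1)\<close>] by (simp only: mult.commute)
    qed
    have pw: "(real k / real (n + 1)) powr \<tau> \<le> real q powr \<tau>"
      using q_ge \<tau>(1) by (intro powr_mono2) auto
    then have four: "4 \<le> real q powr \<tau>" using elim by linarith
    have N: "real N < real q powr \<tau>" "real q powr \<tau> - 1 \<le> real N"
      unfolding N_def using four by linarith+
    have "N ^ CARD('n) < q ^ (CARD('n) + 1)"
    proof -
      have "real N ^ n < (real q powr \<tau>) ^ n" using N(1) n by (intro power_strict_mono) auto
      also have "(real q powr \<tau>) ^ n = real q powr (\<tau> * real n)"
        by (simp add: powr_powr[symmetric] powr_realpow q_def)
      also have "\<dots> = real q ^ (n + 1)" unfolding \<tau>(2) by (rule powr_realpow) (simp add: q_def)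
      finally have "real (N ^ n) < real (q ^ (n + 1))" by simp
      then show ?thesis unfolding n_def by (simp only: of_nat_less_iff)
    qed
    moreover have "(CARD('n) + 1) * (q - 1) \<le> k"
      unfolding q_def n_def add_diff_cancel_right' by (rule times_div_less_eq_dividend)
    ultimately have "ereal (real N * ln 2 - ln 2) \<le> m_fun k (exp 1) f"
      by (intro m_fun_lower_bound[OF f np, where q = q]) (simp_all add: q_def)
    moreover have "a * real k powr \<tau> \<le> real N * ln 2 - ln 2"
    proof -
      have "a * real k powr \<tau> = ln 2 / 2 * (real k / real (n + 1)) powr \<tau>"
        by (simp add: a_def powr_divide)
      also have "\<dots> \<le> ln 2 / 2 * real q powr \<tau>" using pw by (intro mult_left_mono) auto
      also have "\<dots> \<le> ln 2 * (real N - 1)"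
      proof -
        have "real q powr \<tau> / 2 \<le> real N - 1" using N(2) four by linarith
        from mult_left_mono[OF this, of "ln 2"] show ?thesis by simp
      qed
      finally show ?thesis by (simp add: algebra_simps)
    qed
    ultimately show ?case by (meson ereal_less_eq(3) order_trans)
  qed
  then show ?thesis using a unfolding \<tau>_def n_def by blast
qed

theorem corollary2p10:
  fixes f :: "complex ^ 'n \<Rightarrow> complex"
  assumes "entire f" and "\<not> polynomial_fun f"
  shows "ereal (1 + 1 / real CARD('n)) \<le> lower_transcendence_order f \<and>
         lower_transcendence_order f \<le> 2"
proof
  have f: "line_holomorphic f" using assms(1) by (rule entire_imp_line_holomorphic)
  show "ereal (1 + 1 / real CARD('n)) \<le> lower_transcendence_order f"
  proof -
    define \<tau> where "\<tau> = 1 + 1 / real CARD('n)"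
    obtain a where a: "a > 0"
      "\<forall>\<^sub>F k in sequentially. ereal (a * real k powr \<tau>) \<le> m_fun k (exp 1) f"
      using m_fun_eventually_large[OF f assms(2)] unfolding \<tau>_def by blast
    have "\<forall>\<^sub>F k in sequentially. ereal a \<le> m_fun k (exp 1) f / ereal (real k powr \<tau>)"
      using a(2) eventually_gt_at_top[of 0]
    proof eventually_elim
      case (elim k)
      then have "0 < real k powr \<tau>" by simp
      then show ?case using elim by (subst ereal_le_divide_pos) (auto simp: mult.commute)
    qed
    then have "ereal a \<le> liminf (\<lambda>k. m_fun k (exp 1) f / ereal (real k powr \<tau>))"
      by (rule Liminf_bounded)
    then have "liminf (\<lambda>k. m_fun k (exp 1) f / ereal (real k powr \<tau>)) > 0"
      using a(1) by (metis ereal_less(2) less_le_trans)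
    then show ?thesis
      unfolding lower_transcendence_order_def \<tau>_def by (intro Sup_upper) blast
  qed
  show "lower_transcendence_order f \<le> 2"
    unfolding lower_transcendence_order_def
  proof (rule Sup_least)
    fix t assume "t \<in> {ereal \<tau> |\<tau>. liminf (\<lambda>k. m_fun k (exp 1) f / ereal (real k powr \<tau>)) > 0}"
    then obtain \<tau> where t: "t = ereal \<tau>"
      and pos: "0 < liminf (\<lambda>k. m_fun k (exp 1) f / ereal (real k powr \<tau>))" by blast
    have "\<tau> \<le> 2"
    proof (rule ccontr)
      assume "\<not> \<tau> \<le> 2"
      then have "\<tau> > 2" by simp
      obtain a where a: "0 < ereal a" "ereal a < liminf (\<lambda>k. m_fun k (exp 1) f / ereal (real k powr \<tau>))"
        using ereal_dense2[OF pos] by blast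
      have "\<forall>\<^sub>F k in sequentially. ereal a < m_fun k (exp 1) f / ereal (real k powr \<tau>)"
        by (rule less_LiminfD[OF a(2)])
      then obtain k0 where k0: "\<And>k. k0 \<le> k \<Longrightarrow> ereal a < m_fun k (exp 1) f / ereal (real k powr \<tau>)"
        unfolding eventually_sequentially by blast
      obtain k where k: "max k0 1 \<le> k" "m_fun k (exp 1) f < ereal (a * real k powr \<tau>)"
        using m_fun_not_eventually_large[OF f assms(2) \<open>\<tau> > 2\<close>, of a "max k0 1"] a(1) by auto
      have "0 < real k powr \<tau>" using k(1) by simp
      moreover have "ereal a \<le> m_fun k (exp 1) f / ereal (real k powr \<tau>)"
        using k0[of k] k(1) by simp
      ultimately have "ereal (real k powr \<tau>) * ereal a \<le> m_fun k (exp 1) f"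
        by (subst (asm) ereal_le_divide_pos) auto
      then show False using k(2) by (simp add: mult.commute)
    qed
    then show "t \<le> 2" by (simp add: t)
  qed
qed

end
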